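(* The fine moduli space $\mathcal{M}_\vartheta(Q,R)$ of $\vartheta$-stable representations of the bound Special McKay quiver $(Q,R)$ is isomorphic to the toric variety $\mathbb{V}(I_Q)/\!\!/_\vartheta T_Q$.
   Context: $\Bbbk$ is an algebraically closed field of characteristic zero. Toric varieties are not assumed normal. $G\subset\mathrm{GL}(2,\Bbbk)$ is the cyclic group of order $r\ge2$ generated by $\mathrm{diag}(\omega,\omega^a)$, with $\omega$ a primitive $r$th root of unity and $\gcd(a,r)=1$. $X$ is the minimal resolution of $\mathbb{A}^2_\Bbbk/G$, a toric surface with torus $T_M=(\Bbbk^\times)^2/G$. $D_1,\dots,D_\ell$ are the irreducible exceptional curves and $\Sigma(1)$ denotes the set of $T_M$-invariant prime divisors (the rays of the fan). $L_0=\mathscr{O}_X$, and $L_1,\dots,L_\ell$ are the line bundles with $\deg(L_i|_{D_j})=\delta_{ij}$. **Bound Special McKay quiver** $(Q,R)$ (the bound quiver of sections of $(L_0,\dots,L_\ell)$). A nonzero section $s\in H^0(X,L_j\otimes L_i^{-1})=\mathrm{Hom}(L_i,L_j)$ is $T_M$-invariant if its divisor of zeroes $\mathrm{div}(s)$ is; such sections are considered up to scalar. It is irreducible if it is not an isomorphism and is not a composite $L_i\to L_k\to L_j$ of two $T_M$-invariant non-isomorphisms, for any $k\in\{0,\dots,\ell\}$. $Q$ has vertex set $Q_0=\{0,\dots,\ell\}$ and arrows $i\to j$ the irreducible $T_M$-invariant sections of $L_j\otimes L_i^{-1}$. For an arrow $a$, with tail $\mathrm{t}(a)$, head $\mathrm{h}(a)$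 and defining section $s$, put $\mathrm{div}(a)=\mathrm{div}(s)\in\mathbb{N}^{\Sigma(1)}$. For a path $p=a_1\cdots a_k$ put $\mathrm{div}(p)=\sum_j\mathrm{div}(a_j)$ and $y_p=y_{a_1}\cdots y_{a_k}$. $R$ is the two-sided ideal of $\Bbbk Q$ generated by all $p-q$, with $p,q$ paths having the same tail, the same head and $\mathrm{div}(p)=\mathrm{div}(q)$. **Quotients.** $\mathrm{Wt}(Q)=\{\theta\in\mathbb{Z}^{Q_0}:\sum\theta_i=0\}$, $T_Q=\mathrm{Hom}(\mathrm{Wt}(Q),\Bbbk^\times)$. $\Bbbk[y_a:a\in Q_1]$ is $\mathrm{Wt}(Q)$-graded, with $y_a$ of degree $\mathrm{inc}(\chi_a)=\chi_{\mathrm{h}(a)}-\chi_{\mathrm{t}(a)}$. $\vartheta=(-\ell,1,\dots,1)$, with $-\ell$ at vertex $0$. For a homogeneous ideal $I$, $\mathbb{V}(I)/\!\!/_\vartheta T_Q=\mathrm{Proj}\bigoplus_{j\ge0}(\Bbbk[y_a:a\in Q_1]/I)_{j\vartheta}$. - $I_R=(y_p-y_q:p-q\in R)$ and $\mathcal{M}_\vartheta(Q,R)=\mathbb{V}(I_R)/\!\!/_\vartheta T_Q$. This is the fine moduli space of isomorphism classes of representations $W$ of $(Q,R)$, with $\dim_\Bbbk W_i=1$ for all $i$, that are $\vartheta$-stable ($\sum_{i:W'_i\ne0}\vartheta_i>0$ for every proper nonzero subrepresentation $W'\subset W$). - $I_Q$ is the toric ideal generated by $y^u-y^v$ with $u,v\in\mathbb{N}^{Q_1}$,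 $\mathrm{inc}(u)=\mathrm{inc}(v)$ and $\mathrm{div}(u)=\mathrm{div}(v)$, where $\mathrm{inc}$ and $\mathrm{div}$ are extended linearly to $\mathbb{Z}^{Q_1}$. *)

theory Defs
  imports
    "HOL-Analysis.Analysis"
    "HOL-Algebra.QuotRing"
    "HOL-Library.Poly_Mapping"
    "HOL-Computational_Algebra.Polynomial"
begin

section \<open>Ringed spaces over a field and Proj\<close>

text \<open>A space with a sheaf of algebras over the field \<open>'k\<close>; \<open>scal U\<close> is the structure map
  from \<open>'k\<close> to the sections over \<open>U\<close>.\<close>

record ('p, 's, 'k) kspace =
  top_of :: "'p topology"
  sects :: "'p set \<Rightarrow> 's ring"
  restr :: "'p set \<Rightarrow> 'p set \<Rightarrow> 's \<Rightarrow> 's"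
  scal :: "'p set \<Rightarrow> 'k \<Rightarrow> 's"

text \<open>Isomorphism of ringed spaces over \<open>'k\<close>: a homeomorphism together with an isomorphism of
  sheaves of \<open>'k\<close>-algebras. An isomorphism of ringed spaces induces isomorphisms on stalks,
  which are automatically local, so for schemes over \<open>'k\<close> this is isomorphism of schemes.\<close>

definition isomorphic_over_field ::
    "('p, 's, 'k) kspace \<Rightarrow> ('q, 't, 'k) kspace \<Rightarrow> bool" where
  "isomorphic_over_field X Y \<longleftrightarrow>
    (\<exists>f \<psi>. homeomorphic_map (top_of X) (top_of Y) f \<and>
      (let pre = (\<lambda>U. {x \<in> topspace (top_of X). f x \<in> U}) in
        \<forall>U. openin (top_of Y) U \<longrightarrow>
          \<psi> U \<in> ring_iso (sects Y U) (sects X (pre U)) \<and>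
          (\<forall>c. \<psi> U (scal Y U c) = scal X (pre U) c) \<and>
          (\<forall>V s. openin (top_of Y) V \<longrightarrow> V \<subseteq> U \<longrightarrow> s \<in> carrier (sects Y U) \<longrightarrow>
             restr X (pre U) (pre V) (\<psi> U s) = \<psi> V (restr Y U V s))))"

text \<open>A commutative \<open>'k\<close>-algebra graded by the natural numbers.\<close>

record ('a, 'k) graded_algebra = "'a ring" +
  piece :: "nat \<Rightarrow> 'a set"
  scalar :: "'k \<Rightarrow> 'a"

definition proj_points :: "('a, 'k) graded_algebra \<Rightarrow> 'a set set" where
  "proj_points S = {P. primeideal P S \<and> P = genideal S (P \<inter> (\<Union>n. piece S n)) \<and>
                       \<not> (\<Union>n\<in>{0<..}. piece S n) \<subseteq> P}"

text \<open>The topology is generated by the basic open sets \<open>D\<^sub>+(f)\<close>, with \<open>f\<close> homogeneous of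
  positive degree.\<close>

definition proj_topology :: "('a, 'k) graded_algebra \<Rightarrow> 'a set topology" where
  "proj_topology S = topology_generated_by
     {{P \<in> proj_points S. f \<notin> P} | f. \<exists>n>0. f \<in> piece S n}"

text \<open>\<open>hfrac S P a b\<close> is the fraction \<open>a/b\<close> in the degree zero part \<open>S\<^bsub>(P)\<^esub>\<close> of the localization of
  \<open>S\<close> at the homogeneous elements outside \<open>P\<close>, as an equivalence class of pairs.\<close>

definition hfrac :: "('a, 'k) graded_algebra \<Rightarrow> 'a set \<Rightarrow> 'a \<Rightarrow> 'a \<Rightarrow> ('a \<times> 'a) set" where
  "hfrac S P a b = {(c, d). (\<exists>n. c \<in> piece S n \<and> d \<in> piece S n) \<and> d \<notin> P \<and>
     (\<exists>h \<in> (\<Union>n. piece S n) - P.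
        h \<otimes>\<^bsub>S\<^esub> ((a \<otimes>\<^bsub>S\<^esub> d) \<ominus>\<^bsub>S\<^esub> (c \<otimes>\<^bsub>S\<^esub> b)) = \<zero>\<^bsub>S\<^esub>)}"

definition hfrac_add ::
    "('a, 'k) graded_algebra \<Rightarrow> 'a set \<Rightarrow> ('a \<times> 'a) set \<Rightarrow> ('a \<times> 'a) set \<Rightarrow> ('a \<times> 'a) set" where
  "hfrac_add S P x y =
     (\<Union>(a, b)\<in>x. \<Union>(c, d)\<in>y. hfrac S P ((a \<otimes>\<^bsub>S\<^esub> d) \<oplus>\<^bsub>S\<^esub> (c \<otimes>\<^bsub>S\<^esub> b)) (b \<otimes>\<^bsub>S\<^esub> d))"

definition hfrac_mult ::
    "('a, 'k) graded_algebra \<Rightarrow> 'a set \<Rightarrow> ('a \<times> 'a) set \<Rightarrow> ('a \<times> 'a) set \<Rightarrow> ('a \<times> 'a) set" where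
  "hfrac_mult S P x y = (\<Union>(a, b)\<in>x. \<Union>(c, d)\<in>y. hfrac S P (a \<otimes>\<^bsub>S\<^esub> c) (b \<otimes>\<^bsub>S\<^esub> d))"

text \<open>Sections over \<open>U\<close> are the functions sending \<open>P\<close> to an element of \<open>S\<^bsub>(P)\<^esub>\<close> that are locally
  fractions of homogeneous elements of the same degree.\<close>

definition proj_sections ::
    "('a, 'k) graded_algebra \<Rightarrow> 'a set set \<Rightarrow> ('a set \<Rightarrow> ('a \<times> 'a) set) ring" where
  "proj_sections S U =
    \<lparr>carrier = {s \<in> extensional U. \<forall>P\<in>U. \<exists>V. openin (proj_topology S) V \<and> P \<in> V \<and> V \<subseteq> U \<and>
        (\<exists>n. \<exists>a\<in>piece S n. \<exists>b\<in>piece S n. \<forall>P'\<in>V. b \<notin> P' \<and> s P' = hfrac S P' a b)},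
     mult = (\<lambda>s t. \<lambda>P\<in>U. hfrac_mult S P (s P) (t P)),
     one = (\<lambda>P\<in>U. hfrac S P \<one>\<^bsub>S\<^esub> \<one>\<^bsub>S\<^esub>),
     zero = (\<lambda>P\<in>U. hfrac S P \<zero>\<^bsub>S\<^esub> \<one>\<^bsub>S\<^esub>),
     add = (\<lambda>s t. \<lambda>P\<in>U. hfrac_add S P (s P) (t P))\<rparr>"

type_synonym ('a, 'k) proj_space = "('a set, 'a set \<Rightarrow> ('a \<times> 'a) set, 'k) kspace"

definition Proj :: "('a, 'k) graded_algebra \<Rightarrow> ('a, 'k) proj_space" where
  "Proj S = \<lparr>top_of = proj_topology S,
             sects = proj_sections S,
             restr = (\<lambda>U V s. restrict s V),
             scal = (\<lambda>U c. \<lambda>P\<in>U. hfrac S P (scalar S c) \<one>\<^bsub>S\<^esub>)\<rparr>"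


section \<open>The minimal resolution as a toric surface\<close>

definition primitive_root :: "nat \<Rightarrow> 'k::field \<Rightarrow> bool" where
  "primitive_root r \<omega> \<longleftrightarrow> \<omega> ^ r = 1 \<and> (\<forall>n. 0 < n \<and> n < r \<longrightarrow> \<omega> ^ n \<noteq> 1)"

text \<open>The group generated by \<open>diag(\<omega>, \<omega>\<^sup>a)\<close>; a diagonal matrix is written as the pair of its
  diagonal entries, so that the group is a subgroup of the torus of the affine plane.\<close>

definition cyclic_diag :: "'k::field \<Rightarrow> int \<Rightarrow> ('k \<times> 'k) set" where
  "cyclic_diag \<omega> a = range (\<lambda>n::int. (\<omega> powi n, (\<omega> powi a) powi n))"

text \<open>A smooth toric surface with torus \<open>T\<^sub>M\<close> whose fan is a subdivision of the first quadrant: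
  \<open>chars\<close> is the character lattice \<open>M\<close>, inside the lattice of Laurent monomials in two
  variables, and \<open>ray 0, \<dots>, ray (ell + 1)\<close> are the primitive generators of the rays in
  their cyclic order. The maximal cones are spanned by \<open>ray i, ray (i + 1)\<close> for \<open>i \<le> ell\<close>.
  The prime divisor of \<open>ray \<rho>\<close> is compact if and only if \<open>1 \<le> \<rho> \<le> ell\<close>.\<close>

record toric_surface =
  chars :: "(int \<times> int) set"
  ell :: nat
  ray :: "nat \<Rightarrow> real \<times> real"

definition pair :: "int \<times> int \<Rightarrow> real \<times> real \<Rightarrow> real" where
  "pair m u = of_int (fst m) * fst u + of_int (snd m) * snd u"

text \<open>Characters of the quotient torus by \<open>G\<close>, i.e. \<open>G\<close>-invariant Laurent monomials.\<close>

definition invariant_monomials :: "('k::field \<times> 'k) set \<Rightarrow> (int \<times> int) set" where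
  "invariant_monomials G = {m. \<forall>(x, y)\<in>G. x powi fst m * y powi snd m = 1}"

definition dual_lattice :: "(int \<times> int) set \<Rightarrow> (real \<times> real) set" where
  "dual_lattice M = {u. \<forall>m\<in>M. pair m u \<in> \<int>}"

text \<open>The integer \<open>D\<^sub>j\<^sup>2\<close> of an exceptional curve, given by the wall relation of the fan.\<close>

definition self_int :: "toric_surface \<Rightarrow> nat \<Rightarrow> int" where
  "self_int X j = (THE d. ray X (j - 1) + ray X (j + 1) + of_int d *\<^sub>R ray X j = 0)"

text \<open>The affine quotient by \<open>G\<close> is the toric variety of the first quadrant with respect to the
  dual of the lattice of invariant monomials. A toric resolution is a subdivision of this cone
  into cones generated by lattice bases (the determinant condition orders the rays from the
  second coordinate axis to the first, so the cones tile the quadrant), and it is minimal if no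
  exceptional curve is a \<open>(-1)\<close>-curve.\<close>

definition minimal_resolution :: "('k::field \<times> 'k) set \<Rightarrow> toric_surface \<Rightarrow> bool" where
  "minimal_resolution G X \<longleftrightarrow>
     chars X = invariant_monomials G \<and>
     (\<forall>i \<le> ell X + 1. 0 \<le> fst (ray X i) \<and> 0 \<le> snd (ray X i)) \<and>
     fst (ray X 0) = 0 \<and> snd (ray X (ell X + 1)) = 0 \<and>
     (\<forall>i \<le> ell X.
        dual_lattice (chars X) =
          {of_int x *\<^sub>R ray X i + of_int y *\<^sub>R ray X (i + 1) | x y. True} \<and>
        fst (ray X (i + 1)) * snd (ray X i) - fst (ray X i) * snd (ray X (i + 1)) > 0) \<and>
     (\<forall>j \<in> {1..ell X}. self_int X j \<noteq> -1)"

text \<open>Torus-invariant divisors \<open>\<Sum>\<^sub>\<rho> D(\<rho>) D\<^sub>\<rho>\<close> are functions \<open>D :: nat \<Rightarrow> int\<close>, of which only the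
  values at \<open>\<rho> \<le> ell + 1\<close> matter. The line bundle \<open>\<O>(D)\<close> is represented by \<open>D\<close>; every line
  bundle on \<open>X\<close> is of this form. \<open>degree_on X D j\<close> is the degree of \<open>\<O>(D)\<close> on the
  exceptional curve \<open>D\<^sub>j\<close>, i.e. the intersection number.\<close>

definition intersection :: "toric_surface \<Rightarrow> nat \<Rightarrow> nat \<Rightarrow> int" where
  "intersection X \<rho> j =
     (if \<rho> = j then self_int X j else if \<rho> = j + 1 \<or> j = \<rho> + 1 then 1 else 0)"

definition degree_on :: "toric_surface \<Rightarrow> (nat \<Rightarrow> int) \<Rightarrow> nat \<Rightarrow> int" where
  "degree_on X D j = (\<Sum>\<rho> \<le> ell X + 1. D \<rho> * intersection X \<rho> j)"


section \<open>Sections of line bundles\<close>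

text \<open>Regular functions on the torus of \<open>X\<close> are Laurent polynomials with exponents in
  \<open>chars X\<close>.\<close>

type_synonym 'k laurent = "(int \<times> int) \<Rightarrow>\<^sub>0 'k"

text \<open>Order of vanishing along \<open>D\<^sub>\<rho>\<close> of a nonzero function. The floor is only a coercion: the
  pairing is integral.\<close>

definition ord_along :: "toric_surface \<Rightarrow> nat \<Rightarrow> 'k::zero laurent \<Rightarrow> int" where
  "ord_along X \<rho> f = Min ((\<lambda>m. \<lfloor>pair m (ray X \<rho>)\<rfloor>) ` Poly_Mapping.keys f)"

text \<open>\<open>H\<^sup>0(X, \<O>(D))\<close> consists of the rational functions \<open>f\<close> with \<open>f = 0\<close> or \<open>div(f) + D \<ge> 0\<close>.
  As \<open>D\<close> is supported off the torus, such \<open>f\<close> are regular on the torus.\<close>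

definition H0 :: "toric_surface \<Rightarrow> (nat \<Rightarrow> int) \<Rightarrow> 'k::zero laurent set" where
  "H0 X D = {f. Poly_Mapping.keys f \<subseteq> chars X \<and>
                (f \<noteq> 0 \<longrightarrow> (\<forall>\<rho> \<le> ell X + 1. 0 \<le> ord_along X \<rho> f + D \<rho>))}"

text \<open>Multiplicities along the invariant prime divisors of the divisor of zeroes of a section
  \<open>f\<close> of \<open>\<O>(D)\<close>; for an invariant section this is the whole divisor of zeroes.\<close>

definition div_section :: "toric_surface \<Rightarrow> (nat \<Rightarrow> int) \<Rightarrow> 'k::zero laurent \<Rightarrow> nat \<Rightarrow> nat" where
  "div_section X D f = (\<lambda>\<rho>. if \<rho> \<le> ell X + 1 then nat (ord_along X \<rho> f + D \<rho>) else 0)"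

definition chart_ring :: "toric_surface \<Rightarrow> nat \<Rightarrow> 'k::zero laurent set" where
  "chart_ring X i = {f. Poly_Mapping.keys f \<subseteq> chars X \<and>
     (\<forall>m\<in>Poly_Mapping.keys f. 0 \<le> pair m (ray X i) \<and> 0 \<le> pair m (ray X (i + 1)))}"

text \<open>Two nonzero sections of the same line bundle have the same divisor of zeroes iff on each
  affine chart they differ by a unit.\<close>

definition same_divisor :: "toric_surface \<Rightarrow> 'k::comm_ring_1 laurent \<Rightarrow> 'k laurent \<Rightarrow> bool" where
  "same_divisor X f g \<longleftrightarrow>
     (\<forall>i \<le> ell X. \<exists>u\<in>chart_ring X i. \<exists>w\<in>chart_ring X i. u * w = 1 \<and> g = u * f)"

definition torus_act :: "'k::field \<times> 'k \<Rightarrow> 'k laurent \<Rightarrow> 'k laurent" where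
  "torus_act t f = Poly_Mapping.mapp (\<lambda>m c. fst t powi fst m * snd t powi snd m * c) f"

text \<open>Nonzero sections whose divisor of zeroes is torus-invariant; the torus of \<open>X\<close> is
  the quotient of the torus of pairs by \<open>G\<close>, which acts trivially on invariant monomials.\<close>

definition invariant_section :: "toric_surface \<Rightarrow> (nat \<Rightarrow> int) \<Rightarrow> 'k::field laurent \<Rightarrow> bool" where
  "invariant_section X D s \<longleftrightarrow> s \<in> H0 X D \<and> s \<noteq> 0 \<and>
     (\<forall>t1 t2. t1 \<noteq> 0 \<and> t2 \<noteq> 0 \<longrightarrow> same_divisor X s (torus_act (t1, t2) s))"

text \<open>A section of \<open>\<O>(E) \<otimes> \<O>(D)\<inverse>\<close>, viewed as a map \<open>\<O>(D) \<rightarrow> \<O>(E)\<close>; composition of such maps is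
  multiplication.\<close>

abbreviation hom_div :: "(nat \<Rightarrow> int) \<Rightarrow> (nat \<Rightarrow> int) \<Rightarrow> nat \<Rightarrow> int" where
  "hom_div D E \<equiv> (\<lambda>\<rho>. E \<rho> - D \<rho>)"

definition iso_section ::
    "toric_surface \<Rightarrow> (nat \<Rightarrow> int) \<Rightarrow> (nat \<Rightarrow> int) \<Rightarrow> 'k::field laurent \<Rightarrow> bool" where
  "iso_section X D E s \<longleftrightarrow> s \<in> H0 X (hom_div D E) \<and> (\<exists>s' \<in> H0 X (hom_div E D). s * s' = 1)"

definition irreducible_section ::
    "toric_surface \<Rightarrow> (nat \<Rightarrow> nat \<Rightarrow> int) \<Rightarrow> nat \<Rightarrow> nat \<Rightarrow> 'k::field laurent \<Rightarrow> bool" where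
  "irreducible_section X L i j s \<longleftrightarrow>
     invariant_section X (hom_div (L i) (L j)) s \<and>
     \<not> iso_section X (L i) (L j) s \<and>
     \<not> (\<exists>k \<le> ell X. \<exists>s1 s2.
          invariant_section X (hom_div (L i) (L k)) s1 \<and> \<not> iso_section X (L i) (L k) s1 \<and>
          invariant_section X (hom_div (L k) (L j)) s2 \<and> \<not> iso_section X (L k) (L j) s2 \<and>
          s = s1 * s2)"


section \<open>Bound quivers\<close>

text \<open>A quiver whose arrows are labelled by effective divisors.\<close>

record 'a quiver =
  verts :: "nat set"
  arrows :: "'a set"
  tail :: "'a \<Rightarrow> nat"
  head :: "'a \<Rightarrow> nat"
  label :: "'a \<Rightarrow> nat \<Rightarrow> nat"

text \<open>An arrow of the Special McKay quiver is a triple of tail, head and an irreducible section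
  up to scalar, i.e. the set of its nonzero scalar multiples.\<close>

type_synonym 'k mckay_arrow = "nat \<times> nat \<times> 'k laurent set"

definition special_mckay_quiver ::
    "toric_surface \<Rightarrow> (nat \<Rightarrow> nat \<Rightarrow> int) \<Rightarrow> 'k::field mckay_arrow quiver" where
  "special_mckay_quiver X L =
    \<lparr>verts = {0..ell X},
     arrows = {(i, j, {Poly_Mapping.single 0 c * s | c. c \<noteq> 0}) | i j s.
                 i \<le> ell X \<and> j \<le> ell X \<and> irreducible_section X L i j s},
     tail = fst,
     head = fst \<circ> snd,
     label = (\<lambda>(i, j, C). div_section X (hom_div (L i) (L j)) (SOME s. s \<in> C))\<rparr>"

text \<open>A path is a triple of its tail, its list of arrows and its head; the triples
  \<open>(i, [], i)\<close> are the trivial paths.\<close>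

type_synonym 'a path = "nat \<times> 'a list \<times> nat"

fun walk :: "'a quiver \<Rightarrow> nat \<Rightarrow> 'a list \<Rightarrow> nat \<Rightarrow> bool" where
  "walk Q i [] j \<longleftrightarrow> i \<in> verts Q \<and> i = j"
| "walk Q i (a # as) j \<longleftrightarrow> i \<in> verts Q \<and> a \<in> arrows Q \<and> tail Q a = i \<and> walk Q (head Q a) as j"

definition paths :: "'a quiver \<Rightarrow> 'a path set" where
  "paths Q = {(i, as, j). walk Q i as j}"

definition div_path :: "'a quiver \<Rightarrow> 'a path \<Rightarrow> nat \<Rightarrow> nat" where
  "div_path Q = (\<lambda>(i, as, j) \<rho>. \<Sum>a\<leftarrow>as. label Q a \<rho>)"

definition path_algebra :: "'a quiver \<Rightarrow> ('a path \<Rightarrow>\<^sub>0 'k::field) ring" where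
  "path_algebra Q =
    \<lparr>carrier = {f. Poly_Mapping.keys f \<subseteq> paths Q},
     mult = (\<lambda>f g. \<Sum>(i, as, j)\<in>Poly_Mapping.keys f. \<Sum>(i', as', j')\<in>Poly_Mapping.keys g.
               if j = i'
               then Poly_Mapping.single (i, as @ as', j')
                      (Poly_Mapping.lookup f (i, as, j) * Poly_Mapping.lookup g (i', as', j'))
               else 0),
     one = (\<Sum>i\<in>verts Q. Poly_Mapping.single (i, [], i) 1),
     zero = 0,
     add = (+)\<rparr>"

text \<open>The two-sided ideal \<open>R\<close> (ideals of a noncommutative ring are two-sided in HOL-Algebra).\<close>

definition relations :: "'a quiver \<Rightarrow> ('a path \<Rightarrow>\<^sub>0 'k::field) set" where
  "relations Q = genideal (path_algebra Q)
     {Poly_Mapping.single (i, as, j) 1 - Poly_Mapping.single (i, as', j) 1 | i j as as'.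
        (i, as, j) \<in> paths Q \<and> (i, as', j) \<in> paths Q \<and>
        div_path Q (i, as, j) = div_path Q (i, as', j)}"


section \<open>Quotients by the torus of the quiver\<close>

type_synonym ('a, 'k) mpoly = "('a \<Rightarrow>\<^sub>0 nat) \<Rightarrow>\<^sub>0 'k"

text \<open>The polynomial ring with one variable for each arrow.\<close>

definition arrow_polys :: "'a quiver \<Rightarrow> ('a, 'k::field) mpoly ring" where
  "arrow_polys Q =
    \<lparr>carrier = {f. \<forall>u\<in>Poly_Mapping.keys f. Poly_Mapping.keys u \<subseteq> arrows Q},
     mult = (*), one = 1, zero = 0, add = (+)\<rparr>"

definition inc_exp :: "'a quiver \<Rightarrow> ('a \<Rightarrow>\<^sub>0 nat) \<Rightarrow> nat \<Rightarrow> int" where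
  "inc_exp Q u = (\<lambda>i. \<Sum>a\<in>Poly_Mapping.keys u.
      int (Poly_Mapping.lookup u a) * (of_bool (i = head Q a) - of_bool (i = tail Q a)))"

definition div_exp :: "'a quiver \<Rightarrow> ('a \<Rightarrow>\<^sub>0 nat) \<Rightarrow> nat \<Rightarrow> nat" where
  "div_exp Q u = (\<lambda>\<rho>. \<Sum>a\<in>Poly_Mapping.keys u. Poly_Mapping.lookup u a * label Q a \<rho>)"

definition monomial :: "('a \<Rightarrow>\<^sub>0 nat) \<Rightarrow> ('a, 'k::field) mpoly" where
  "monomial u = Poly_Mapping.single u 1"

definition path_exp :: "'a path \<Rightarrow> ('a \<Rightarrow>\<^sub>0 nat)" where
  "path_exp = (\<lambda>(i, as, j). \<Sum>a\<leftarrow>as. Poly_Mapping.single a 1)"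

definition ideal_I_R :: "'a quiver \<Rightarrow> ('a, 'k::field) mpoly set" where
  "ideal_I_R Q = genideal (arrow_polys Q)
     {monomial (path_exp p) - monomial (path_exp q) | p q.
        p \<in> paths Q \<and> q \<in> paths Q \<and>
        Poly_Mapping.single p (1::'k) - Poly_Mapping.single q 1 \<in> relations Q}"

definition ideal_I_Q :: "'a quiver \<Rightarrow> ('a, 'k::field) mpoly set" where
  "ideal_I_Q Q = genideal (arrow_polys Q)
     {monomial u - monomial v | u v.
        Poly_Mapping.keys u \<subseteq> arrows Q \<and> Poly_Mapping.keys v \<subseteq> arrows Q \<and>
        inc_exp Q u = inc_exp Q v \<and> div_exp Q u = div_exp Q v}"

text \<open>The graded algebra \<open>\<Oplus>\<^sub>j (k[y]/I)\<^bsub>j\<theta>\<^esub>\<close> for a homogeneous ideal \<open>I\<close> and a nonzero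
  weight \<open>\<theta>\<close>, as a subring of the quotient ring: degree pieces of the quotient are
  the images of those of the polynomial ring.\<close>

definition semi_invariants ::
    "'a quiver \<Rightarrow> (nat \<Rightarrow> int) \<Rightarrow> ('a, 'k::field) mpoly set
       \<Rightarrow> (('a, 'k) mpoly set, 'k) graded_algebra" where
  "semi_invariants Q \<theta> I =
    \<lparr>carrier = {I +>\<^bsub>arrow_polys Q\<^esub> f | f. f \<in> carrier (arrow_polys Q) \<and>
        (\<forall>u\<in>Poly_Mapping.keys f. \<exists>j::nat. inc_exp Q u = (\<lambda>i. int j * \<theta> i))},
     mult = mult (arrow_polys Q Quot I),
     one = one (arrow_polys Q Quot I),
     zero = zero (arrow_polys Q Quot I),
     add = add (arrow_polys Q Quot I),
     piece = (\<lambda>j. {I +>\<^bsub>arrow_polys Q\<^esub> f | f. f \<in> carrier (arrow_polys Q) \<and>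
        (\<forall>u\<in>Poly_Mapping.keys f. inc_exp Q u = (\<lambda>i. int j * \<theta> i))}),
     scalar = (\<lambda>c. I +>\<^bsub>arrow_polys Q\<^esub> Poly_Mapping.single 0 c)\<rparr>"

text \<open>The quotient of \<open>V(I)\<close> by the torus of the quiver, linearized by \<open>\<theta>\<close>.\<close>

definition git_quotient ::
    "'a quiver \<Rightarrow> (nat \<Rightarrow> int) \<Rightarrow> ('a, 'k::field) mpoly set \<Rightarrow> (('a, 'k) mpoly set, 'k) proj_space" where
  "git_quotient Q \<theta> I = Proj (semi_invariants Q \<theta> I)"

text \<open>The moduli space of \<open>\<theta>\<close>-stable representations of the bound quiver with dimension vector
  \<open>(1, \<dots>, 1)\<close>, constructed as a GIT quotient.\<close>

definition moduli_space ::
    "'a quiver \<Rightarrow> (nat \<Rightarrow> int) \<Rightarrow> (('a, 'k::field) mpoly set, 'k) proj_space" where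
  "moduli_space Q \<theta> = git_quotient Q \<theta> (ideal_I_R Q)"

definition special_weight :: "nat \<Rightarrow> nat \<Rightarrow> int" where
  "special_weight l i = (if i = 0 then - int l else if i \<le> l then 1 else 0)"

end

(* Let S_R and S_Q be the rings of semi-invariants of k[y]/I_R and k[y]/I_Q. As I_R is contained
   in I_Q there is a graded surjection S_R -> S_Q, and it induces an isomorphism of Proj as soon as
   its kernel vanishes in the homogeneous localization at every relevant prime P. The kernel is
   spanned by binomials y^v - y^w with inc(v) = inc(w) and div(v) = div(w), and P misses a monomial
   y^u of weight a positive multiple of theta; the support of u contains a path from the vertex 0 to
   every vertex. So it suffices that y^(Nu) (y^v - y^w) lies in I_R for large N.

   In terms of divisors, the sections of the special bundle L_j are generated by two of them, alpha_j
   and beta_j, supported on the rays before and after the jth. Hence after inverting the arrows in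
   the support of u there is an i such that alpha_j for j <= i and beta_j for j > i are invertible.
   Relative to these the relations in R express every arrow as a monomial in x = beta_i / alpha_i
   and y = alpha_(i+1) / beta_(i+1), the coordinates of the ith torus-invariant chart of X, and the
   exponents are the multiplicities of the divisor of the arrow along the two rays of the ith cone.
   A localized monomial is thus determined by its values of inc and div. *)

theory Submission
  imports Defs
begin

text \<open>The toric geometry enters only through integer sequences indexed by the rays. By the
  wall relations, a sequence is the divisor of an invariant section of Hom(L_i, L_j) exactly when it
  is nonnegative and its second differences, taken with the coefficients b_k = -D_k^2, are those of
  L_j minus those of L_i. Minimality of the resolution gives b_k >= 2, so a sequence of degree zero
  that is nonnegative and does not decrease at one place keeps growing. This convexity is why two
  sections generate each L_j and why two values in the ith cone control an invariant function.

  The obstacle is that R compares only paths with common ends, whereas I_Q compares arbitrary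
  multisets of arrows. Every rewriting of a monomial must therefore be carried by actual paths, and
  the divisor of every factor met on the way must be shown to be nonnegative; the right degrees
  alone are not enough. Paths starting at other vertices are brought back to the vertex 0 by
  composing with sections that are invertible in the chart and are cancelled at the end.\<close>

abbreviation "keys \<equiv> Poly_Mapping.keys"
abbreviation "lookup \<equiv> Poly_Mapping.lookup"
abbreviation "single \<equiv> Poly_Mapping.single"

section \<open>Isomorphisms of Proj\<close>

lemma (in ring_hom_cring) ideal_image:
  assumes "ideal I R" and surj: "h ` carrier R = carrier S"
  shows "ideal (h ` I) S"
proof -
  interpret I: ideal I R by fact
  note ic = I.a_Hcarr
  show ?thesis
  proof (rule idealI)
    show "ring S" by (rule S.ring_axioms)
    show "subgroup (h ` I) (add_monoid S)"
    proof (rule S.add.subgroupI)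
      show "h ` I \<subseteq> carrier S" using ic by auto
      show "h ` I \<noteq> {}" using additive_subgroup.zero_closed[OF I.additive_subgroup_axioms] by (simp only: image_is_empty) (rule notI, simp)
      show "\<ominus>\<^bsub>S\<^esub> x \<in> h ` I" if x: "x \<in> h ` I" for x
      proof -
        obtain i where i: "i \<in> I" "x = h i" using x by auto
        then have "\<ominus>\<^bsub>S\<^esub> x = h (\<ominus> i)" using ic by simp
        then show ?thesis using i I.a_inv_closed by blast
      qed
      show "x \<oplus>\<^bsub>S\<^esub> y \<in> h ` I" if xy: "x \<in> h ` I" "y \<in> h ` I" for x y
      proof -
        obtain i j where i: "i \<in> I" "x = h i" "j \<in> I" "y = h j" using xy by auto
        then have "x \<oplus>\<^bsub>S\<^esub> y = h (i \<oplus> j)" using ic by simp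
        then show ?thesis using i I.a_closed by blast
      qed
    qed
    show *: "x \<otimes>\<^bsub>S\<^esub> a \<in> h ` I" if ax: "a \<in> h ` I" "x \<in> carrier S" for a x
    proof -
      obtain i where i: "i \<in> I" "a = h i" using ax by auto
      obtain y where y: "y \<in> carrier R" "x = h y" using ax surj by auto
      have "x \<otimes>\<^bsub>S\<^esub> a = h (y \<otimes> i)" using i y ic by simp
      then show ?thesis using i y I.I_l_closed by blast
    qed
    show "a \<otimes>\<^bsub>S\<^esub> x \<in> h ` I" if ax: "a \<in> h ` I" "x \<in> carrier S" for a x
      using *[OF ax] ax ic S.m_comm by (metis (no_types, lifting) hom_closed imageE)
  qed
qed

text \<open>The hypothesis \<open>kill\<close> says that the homogeneous kernel vanishes in the homogeneous
  localization at every relevant prime.\<close>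

locale graded_surjection = ring_hom_cring R S h
  for R :: "('a, 'k) graded_algebra" (structure) and S :: "('b, 'k) graded_algebra" and h +
  assumes piece_carrier: "piece R n \<subseteq> carrier R"
    and piece_mult: "a \<in> piece R m \<Longrightarrow> b \<in> piece R n \<Longrightarrow> a \<otimes> b \<in> piece R (m + n)"
    and piece_add: "a \<in> piece R n \<Longrightarrow> b \<in> piece R n \<Longrightarrow> a \<oplus> b \<in> piece R n"
    and piece_minus: "a \<in> piece R n \<Longrightarrow> \<ominus> a \<in> piece R n"
    and piece_one: "\<one> \<in> piece R 0"
    and piece_scalar: "scalar R c \<in> piece R 0"
    and hom_piece: "piece S n = h ` piece R n"
    and hom_scalar: "h (scalar R c) = scalar S c"
    and surj: "h ` carrier R = carrier S"
    and kernel: "a \<in> carrier R \<Longrightarrow> h a = \<zero>\<^bsub>S\<^esub> \<Longrightarrow>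
      a \<in> genideal R {b \<in> (\<Union>n. piece R n). h b = \<zero>\<^bsub>S\<^esub>}"
    and kill: "P \<in> proj_points R \<Longrightarrow> a \<in> piece R n \<Longrightarrow> h a = \<zero>\<^bsub>S\<^esub> \<Longrightarrow>
      \<exists>k \<in> (\<Union>n. piece R n) - P. k \<otimes> a = \<zero>"
begin

lemma piece_in_carrier: "a \<in> piece R n \<Longrightarrow> a \<in> carrier R"
  using piece_carrier by blast

text \<open>A homogeneous \<open>b\<close> in the kernel is annihilated by some \<open>k\<close>
  outside \<open>P\<close>, and \<open>0\<close> lies in the prime \<open>P\<close>, so
  \<open>b\<close> does too. The axiom \<open>kernel\<close> extends this to inhomogeneous elements,
  as the pieces are not assumed to form a direct sum.\<close>

lemma kernel_subset:
  assumes P: "P \<in> proj_points R" and a: "a \<in> carrier R" "h a = \<zero>\<^bsub>S\<^esub>"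
  shows "a \<in> P"
proof -
  interpret P: primeideal P R using P by (simp add: proj_points_def)
  have "{b \<in> (\<Union>n. piece R n). h b = \<zero>\<^bsub>S\<^esub>} \<subseteq> P"
  proof clarify
    fix b n assume b: "b \<in> piece R n" "h b = \<zero>\<^bsub>S\<^esub>"
    obtain k m where k: "k \<in> piece R m" "k \<notin> P" "k \<otimes> b = \<zero>"
      using kill[OF P b] by blast
    have "k \<otimes> b \<in> P"
      using k(3) additive_subgroup.zero_closed[OF P.additive_subgroup_axioms] by simp
    then show "b \<in> P"
      using P.I_prime piece_in_carrier b(1) k(1,2) by blast
  qed
  then have "genideal R {b \<in> (\<Union>n. piece R n). h b = \<zero>\<^bsub>S\<^esub>} \<subseteq> P"
    by (rule R.genideal_minimal[OF P.ideal_axioms])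
  then show ?thesis using kernel[OF a] by blast
qed

text \<open>\<open>P\<close> contains the kernel and is thus a union of fibres of \<open>h\<close>.
  This makes taking images and \<open>preimage\<close> mutually inverse on points of Proj.\<close>

lemma mem_image_iff:
  assumes P: "P \<in> proj_points R" and a: "a \<in> carrier R"
  shows "h a \<in> h ` P \<longleftrightarrow> a \<in> P"
proof
  interpret P: primeideal P R using P by (simp add: proj_points_def)
  assume "h a \<in> h ` P"
  then obtain p where p: "p \<in> P" "h a = h p" by auto
  have pc: "p \<in> carrier R" using p P.a_Hcarr by blast
  then have "h (a \<ominus> p) = \<zero>\<^bsub>S\<^esub>"
    using a p by (simp add: R.minus_eq S.r_neg)
  then have "a \<ominus> p \<in> P" using kernel_subset[OF P] a pc by simp
  then have "(a \<ominus> p) \<oplus> p \<in> P" using p by simp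
  moreover have "(a \<ominus> p) \<oplus> p = a"
    using a pc by (simp add: R.minus_eq R.a_assoc R.l_neg)
  ultimately show "a \<in> P" by simp
qed auto

abbreviation preimage where "preimage P' \<equiv> {a \<in> carrier R. h a \<in> P'}"

lemma preimage_image: "P \<in> proj_points R \<Longrightarrow> preimage (h ` P) = P"
  using mem_image_iff
  by (auto simp: proj_points_def primeideal_def ideal_def dest: additive_subgroup.a_Hcarr)

lemma image_preimage: "P' \<subseteq> carrier S \<Longrightarrow> h ` preimage P' = P'"
  by (fastforce simp flip: surj)

lemma proj_points_subset: "P' \<in> proj_points S \<Longrightarrow> P' \<subseteq> carrier S"
  unfolding proj_points_def primeideal_def ideal_def
  by (auto dest: additive_subgroup.a_Hcarr)

lemma image_proj_point:
  assumes P: "P \<in> proj_points R"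
  shows "h ` P \<in> proj_points S"
proof -
  interpret P: primeideal P R using P by (simp add: proj_points_def)
  have id: "ideal (h ` P) S" by (rule ideal_image[OF P.ideal_axioms surj])
  have prime: "primeideal (h ` P) S"
  proof (rule primeidealI[OF id S.is_cring])
    show "carrier S \<noteq> h ` P"
    proof
      assume "carrier S = h ` P"
      then have "carrier R \<subseteq> P" using mem_image_iff[OF P] surj by blast
      then show False using P.I_notcarr P.a_subset by blast
    qed
    fix a b assume ab: "a \<in> carrier S" "b \<in> carrier S" "a \<otimes>\<^bsub>S\<^esub> b \<in> h ` P"
    then obtain x y where x: "x \<in> carrier R" "y \<in> carrier R" "a = h x" "b = h y"
      using surj by (metis imageE)
    then have "x \<otimes> y \<in> P" using ab mem_image_iff[OF P, of "x \<otimes> y"] by simp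
    then show "a \<in> h ` P \<or> b \<in> h ` P"
      using mem_image_iff[OF P] x P.I_prime by simp
  qed
  let ?H = "\<Union>n. piece R n" let ?H' = "\<Union>n. piece S n"
  have H': "?H' = h ` ?H" by (auto simp: hom_piece)
  \<comment> \<open>Homogeneous generation is carried over by pulling back the ideal generated on
    the \<open>S\<close> side: its preimage is an ideal that contains the homogeneous generators of
    \<open>P\<close>.\<close>
  have "ideal (genideal S (h ` P \<inter> ?H')) S"
    by (rule S.genideal_ideal) (use P.a_subset in auto)
  then have pre: "ideal (preimage (genideal S (h ` P \<inter> ?H'))) R"
    by (rule ring.ideal_vimage)
  have "P \<inter> ?H \<subseteq> preimage (genideal S (h ` P \<inter> ?H'))"
  proof
    fix x assume x: "x \<in> P \<inter> ?H"
    then have "h x \<in> h ` P \<inter> ?H'" using H' by blast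
    moreover have "h ` P \<inter> ?H' \<subseteq> genideal S (h ` P \<inter> ?H')"
      by (rule S.genideal_self) (use P.a_subset in auto)
    ultimately show "x \<in> preimage (genideal S (h ` P \<inter> ?H'))" using x P.a_Hcarr by blast
  qed
  then have "genideal R (P \<inter> ?H) \<subseteq> preimage (genideal S (h ` P \<inter> ?H'))"
    by (rule R.genideal_minimal[OF pre])
  moreover have "P = genideal R (P \<inter> ?H)" using P by (simp add: proj_points_def)
  ultimately have "h ` P \<subseteq> genideal S (h ` P \<inter> ?H')" by blast
  moreover have "genideal S (h ` P \<inter> ?H') \<subseteq> h ` P"
    by (rule S.genideal_minimal[OF id]) blast
  ultimately have eq: "h ` P = genideal S (h ` P \<inter> ?H')" by blast
  have "\<not> (\<Union>n\<in>{0<..}. piece S n) \<subseteq> h ` P"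
  proof
    assume *: "(\<Union>n\<in>{0<..}. piece S n) \<subseteq> h ` P"
    have "(\<Union>n\<in>{0<..}. piece R n) \<subseteq> P"
    proof clarify
      fix n :: nat and x assume x: "0 < n" "x \<in> piece R n"
      then have "h x \<in> h ` P" using * hom_piece by blast
      then show "x \<in> P" using mem_image_iff[OF P piece_in_carrier] x by blast
    qed
    then show False using P by (simp add: proj_points_def)
  qed
  then show ?thesis
    unfolding proj_points_def by (intro CollectI conjI prime eq)
qed

lemma preimage_proj_point:
  assumes P': "P' \<in> proj_points S"
  shows "preimage P' \<in> proj_points R"
proof -
  interpret P': primeideal P' S using P' by (simp add: proj_points_def)
  have id: "ideal (preimage P') R" by (rule ring.ideal_vimage[OF P'.ideal_axioms])
  have prime: "primeideal (preimage P') R"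
  proof (rule primeidealI[OF id R.is_cring])
    show "carrier R \<noteq> preimage P'"
    proof
      assume "carrier R = preimage P'"
      then have "carrier S \<subseteq> P'" by (fastforce simp flip: surj)
      then show False using P'.I_notcarr P'.a_subset by blast
    qed
    fix a b assume "a \<in> carrier R" "b \<in> carrier R" "a \<otimes> b \<in> preimage P'"
    then show "a \<in> preimage P' \<or> b \<in> preimage P'"
      using P'.I_prime by simp
  qed
  let ?H = "\<Union>n. piece R n" let ?H' = "\<Union>n. piece S n"
  let ?G = "genideal R (preimage P' \<inter> ?H)"
  have sub: "preimage P' \<inter> ?H \<subseteq> carrier R" by blast
  interpret G: ideal ?G R by (rule R.genideal_ideal[OF sub])
  have idG: "ideal (h ` ?G) S" by (rule ideal_image[OF G.ideal_axioms surj])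
  have "P' \<inter> ?H' \<subseteq> h ` ?G"
  proof
    fix y assume y: "y \<in> P' \<inter> ?H'"
    then obtain n x where x: "x \<in> piece R n" "y = h x" using hom_piece by auto
    then have "x \<in> preimage P' \<inter> ?H" using y piece_in_carrier by blast
    then show "y \<in> h ` ?G" using R.genideal_self[OF sub] x by blast
  qed
  then have "genideal S (P' \<inter> ?H') \<subseteq> h ` ?G" by (rule S.genideal_minimal[OF idG])
  moreover have "P' = genideal S (P' \<inter> ?H')" using P' by (simp add: proj_points_def)
  ultimately have PG: "P' \<subseteq> h ` ?G" by blast
  \<comment> \<open>The homogeneous kernel elements map to \<open>0\<close>, which lies in
    \<open>P'\<close>, so the whole kernel lies in \<open>?G\<close>. Hence \<open>PG\<close> lifts
    from the image of \<open>?G\<close> to \<open>?G\<close> itself.\<close>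
  have "{b \<in> ?H. h b = \<zero>\<^bsub>S\<^esub>} \<subseteq> ?G"
    using R.genideal_self[OF sub] piece_in_carrier P'.zero_closed by fastforce
  then have kG: "genideal R {b \<in> ?H. h b = \<zero>\<^bsub>S\<^esub>} \<subseteq> ?G"
    by (rule R.genideal_minimal[OF G.ideal_axioms])
  have "preimage P' \<subseteq> ?G"
  proof clarify
    fix a assume a: "a \<in> carrier R" "h a \<in> P'"
    then obtain g where g: "g \<in> ?G" "h a = h g" using PG by blast
    have gc: "g \<in> carrier R" using g G.a_Hcarr by blast
    then have "h (a \<ominus> g) = \<zero>\<^bsub>S\<^esub>" using a g by (simp add: R.minus_eq S.r_neg)
    then have "a \<ominus> g \<in> ?G" using kernel kG a gc by blast
    then have "(a \<ominus> g) \<oplus> g \<in> ?G" using g by simp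
    then show "a \<in> ?G" using a gc by (simp add: R.minus_eq R.a_assoc R.l_neg)
  qed
  moreover have "?G \<subseteq> preimage P'" by (rule R.genideal_minimal[OF id]) blast
  ultimately have eq: "preimage P' = ?G" by blast
  have "\<not> (\<Union>n\<in>{0<..}. piece R n) \<subseteq> preimage P'"
  proof
    assume *: "(\<Union>n\<in>{0<..}. piece R n) \<subseteq> preimage P'"
    have "(\<Union>n\<in>{0<..}. piece S n) \<subseteq> P'" using * hom_piece by fastforce
    then show False using P' by (simp add: proj_points_def)
  qed
  then show ?thesis
    unfolding proj_points_def by (intro CollectI conjI prime eq)
qed

section \<open>The homeomorphism of the underlying spaces\<close>

lemma topspace_proj: "topspace (proj_topology T) = proj_points T"
  for T :: "('c, 'k) graded_algebra"
proof -
  have "\<Union> {{P \<in> proj_points T. f \<notin> P} | f. \<exists>n>0. f \<in> piece T n} = proj_points T"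
  proof (intro equalityI subsetI)
    fix P assume P: "P \<in> proj_points T"
    then have "\<not> (\<Union>n\<in>{0<..}. piece T n) \<subseteq> P" by (simp add: proj_points_def)
    then obtain n f where "n > 0" "f \<in> piece T n" "f \<notin> P" by blast
    then have "{P \<in> proj_points T. f \<notin> P} \<in> {{P \<in> proj_points T. f \<notin> P} | f. \<exists>n>0. f \<in> piece T n}"
      "P \<in> {P \<in> proj_points T. f \<notin> P}" using P by blast+
    then show "P \<in> \<Union> {{P \<in> proj_points T. f \<notin> P} | f. \<exists>n>0. f \<in> piece T n}"
      by (rule UnionI)
  qed auto
  then show ?thesis unfolding proj_topology_def topology_generated_by_topspace .
qed

lemma homeomorphic_maps_proj:
  "homeomorphic_maps (proj_topology R) (proj_topology S) ((`) h) preimage"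
proof -
  have 1: "continuous_map (proj_topology R) (proj_topology S) ((`) h)"
    unfolding proj_topology_def[of S]
  proof (rule continuous_on_generated_topo)
    fix U assume "U \<in> {{P \<in> proj_points S. f \<notin> P} | f. \<exists>n>0. f \<in> piece S n}"
    then obtain f n where f: "U = {P \<in> proj_points S. f \<notin> P}" "n > 0" "f \<in> piece S n" by blast
    then obtain g where g: "g \<in> piece R n" "f = h g" using hom_piece by auto
    have "(`) h -` U \<inter> topspace (proj_topology R) = {P \<in> proj_points R. g \<notin> P}"
      using g f mem_image_iff[OF _ piece_in_carrier[OF g(1)]] image_proj_point
      by (auto simp: topspace_proj)
    moreover have "openin (proj_topology R) {P \<in> proj_points R. g \<notin> P}"
      unfolding proj_topology_def
      by (rule topology_generated_by_Basis) (use g f in blast)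
    ultimately show "openin (proj_topology R) ((`) h -` U \<inter> topspace (proj_topology R))" by simp
  next
    have "\<Union> {{P \<in> proj_points S. f \<notin> P} |f. \<exists>n>0. f \<in> piece S n} = proj_points S"
      using topspace_proj[of S] by (simp add: proj_topology_def)
    then show "(`) h ` topspace (proj_topology R)
        \<subseteq> \<Union> {{P \<in> proj_points S. f \<notin> P} |f. \<exists>n>0. f \<in> piece S n}"
      using image_proj_point by (auto simp: topspace_proj)
  qed
  have 2: "continuous_map (proj_topology S) (proj_topology R) preimage"
    unfolding proj_topology_def[of R]
  proof (rule continuous_on_generated_topo)
    fix U assume "U \<in> {{P \<in> proj_points R. f \<notin> P} | f. \<exists>n>0. f \<in> piece R n}"
    then obtain f n where f: "U = {P \<in> proj_points R. f \<notin> P}" "n > 0" "f \<in> piece R n" by blast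
    have "preimage -` U \<inter> topspace (proj_topology S) = {P \<in> proj_points S. h f \<notin> P}"
      using f piece_in_carrier[OF f(3)] preimage_proj_point
      by (auto simp: topspace_proj)
    moreover have "openin (proj_topology S) {P \<in> proj_points S. h f \<notin> P}"
      unfolding proj_topology_def
      by (rule topology_generated_by_Basis) (use f hom_piece in blast)
    ultimately show "openin (proj_topology S) (preimage -` U \<inter> topspace (proj_topology S))" by simp
  next
    have "\<Union> {{P \<in> proj_points R. f \<notin> P} |f. \<exists>n>0. f \<in> piece R n} = proj_points R"
      using topspace_proj[of R] by (simp add: proj_topology_def)
    then show "preimage ` topspace (proj_topology S)
        \<subseteq> \<Union> {{P \<in> proj_points R. f \<notin> P} |f. \<exists>n>0. f \<in> piece R n}"
      using preimage_proj_point by (auto simp: topspace_proj)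
  qed
  show ?thesis unfolding homeomorphic_maps_def
    using 1 2 preimage_image image_preimage proj_points_subset by (simp add: topspace_proj)
qed

text \<open>The inverse of the map induced by \<open>h\<close> on stalks. Fractions are classes of
  pairs, so it is the preimage of a class under \<open>h\<close> on both components; restricting to
  pairs of equal degree makes the result a full class again, by \<open>stalk_hfrac\<close>.\<close>

definition stalk :: "('b \<times> 'b) set \<Rightarrow> ('a \<times> 'a) set" where
  "stalk x = {(c, d). (\<exists>n. c \<in> piece R n \<and> d \<in> piece R n) \<and> (h c, h d) \<in> x}"

text \<open>Equality of two fractions over \<open>S\<close> is witnessed by a \<open>k\<close>
  outside the image of \<open>P\<close>. Lifted to \<open>R\<close>, it multiplies the homogeneous
  cross difference into the kernel, and \<open>kill\<close> supplies a further factor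
  \<open>q\<close> outside \<open>P\<close>. As \<open>P\<close> is prime, the product of the two
  factors witnesses equality over \<open>R\<close>.\<close>

lemma stalk_hfrac:
  assumes P: "P \<in> proj_points R" and ab: "a \<in> piece R n" "b \<in> piece R n"
  shows "stalk (hfrac S (h ` P) (h a) (h b)) = hfrac R P a b"
proof -
  interpret P: primeideal P R using P by (simp add: proj_points_def)
  note c = piece_in_carrier
  have "(c, d) \<in> hfrac R P a b" if "(c, d) \<in> stalk (hfrac S (h ` P) (h a) (h b))" for c d
  proof -
    from that obtain m k where cd: "c \<in> piece R m" "d \<in> piece R m" and d: "h d \<notin> h ` P"
      and k: "k \<in> (\<Union>n. piece S n) - h ` P"
        "k \<otimes>\<^bsub>S\<^esub> ((h a \<otimes>\<^bsub>S\<^esub> h d) \<ominus>\<^bsub>S\<^esub> (h c \<otimes>\<^bsub>S\<^esub> h b)) = \<zero>\<^bsub>S\<^esub>"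
      unfolding stalk_def hfrac_def by blast
    obtain k' p where k': "k' \<in> piece R p" "k = h k'" using k hom_piece by auto
    let ?e = "(a \<otimes> d) \<ominus> (c \<otimes> b)"
    have e: "?e \<in> piece R (n + m)"
      unfolding R.minus_eq
      using piece_add piece_minus piece_mult[OF ab(1) cd(2)] piece_mult[OF cd(1) ab(2)]
      by (simp add: add.commute)
    have "h (k' \<otimes> ?e) = \<zero>\<^bsub>S\<^esub>"
      using k(2) k' c[OF ab(1)] c[OF ab(2)] c[OF cd(1)] c[OF cd(2)] c[OF k'(1)]
      by (simp add: R.minus_eq S.minus_eq)
    from kill[OF P piece_mult[OF k'(1) e] this] obtain q u
      where q: "q \<in> piece R u" "q \<notin> P" "q \<otimes> (k' \<otimes> ?e) = \<zero>" by blast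
    have "q \<otimes> k' \<in> (\<Union>n. piece R n) - P"
      using piece_mult[OF q(1) k'(1)] P.I_prime[of q k'] q(2) k k' c[OF q(1)] c[OF k'(1)] by blast
    moreover have "(q \<otimes> k') \<otimes> ?e = \<zero>"
      using q(3) c[OF q(1)] c[OF k'(1)] c[OF e] by (simp add: R.m_assoc)
    ultimately show ?thesis
      unfolding hfrac_def using cd d by blast
  qed
  moreover have "(c, d) \<in> stalk (hfrac S (h ` P) (h a) (h b))" if "(c, d) \<in> hfrac R P a b" for c d
  proof -
    from that obtain m k p where cd: "c \<in> piece R m" "d \<in> piece R m" "d \<notin> P"
      and k: "k \<in> piece R p" "k \<notin> P"
        "k \<otimes> ((a \<otimes> d) \<ominus> (c \<otimes> b)) = \<zero>"
      unfolding hfrac_def by blast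
    have "h (k \<otimes> ((a \<otimes> d) \<ominus> (c \<otimes> b))) = \<zero>\<^bsub>S\<^esub>" using k by simp
    then have "h k \<otimes>\<^bsub>S\<^esub> ((h a \<otimes>\<^bsub>S\<^esub> h d) \<ominus>\<^bsub>S\<^esub> (h c \<otimes>\<^bsub>S\<^esub> h b)) = \<zero>\<^bsub>S\<^esub>"
      using c[OF ab(1)] c[OF ab(2)] c[OF cd(1)] c[OF cd(2)] c[OF k(1)]
      by (simp add: R.minus_eq S.minus_eq)
    moreover have "h k \<in> (\<Union>n. piece S n) - h ` P"
      using k mem_image_iff[OF P c[OF k(1)]] hom_piece by blast
    moreover have "h d \<notin> h ` P" using cd mem_image_iff[OF P c[OF cd(2)]] by blast
    moreover have "\<exists>n. h c \<in> piece S n \<and> h d \<in> piece S n" using cd hom_piece by blast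
    ultimately show ?thesis
      unfolding stalk_def hfrac_def using cd by blast
  qed
  ultimately show ?thesis by auto
qed

definition homogeneous_pairs :: "('b \<times> 'b) set" where
  "homogeneous_pairs = {(c, d). \<exists>n. c \<in> piece S n \<and> d \<in> piece S n}"

lemma hfrac_homogeneous: "hfrac S P a b \<subseteq> homogeneous_pairs"
  by (auto simp: hfrac_def homogeneous_pairs_def)

lemma map_prod_stalk: "x \<subseteq> homogeneous_pairs \<Longrightarrow> map_prod h h ` stalk x = x"
  proof (intro equalityI subsetI)
  fix p assume x: "x \<subseteq> homogeneous_pairs" and p: "p \<in> x"
  then have "p \<in> homogeneous_pairs" by blast
  then have "\<exists>n. fst p \<in> h ` piece R n \<and> snd p \<in> h ` piece R n"
    by (simp add: homogeneous_pairs_def hom_piece split_beta)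
  then obtain n where "fst p \<in> h ` piece R n" "snd p \<in> h ` piece R n" by blast
  then obtain c d where cd: "c \<in> piece R n" "d \<in> piece R n" "fst p = h c" "snd p = h d" by blast
  then have "(c, d) \<in> stalk x" "p = map_prod h h (c, d)"
    using p by (auto simp: stalk_def prod_eq_iff simp flip: cd(3,4))
  then show "p \<in> map_prod h h ` stalk x" by blast
qed (auto simp: stalk_def)

lemma stalk_UN: "stalk (\<Union>i\<in>I. f i) = (\<Union>i\<in>I. stalk (f i))"
  by (auto simp: stalk_def)

text \<open>\<open>hfrac_add\<close> is a union over all pairs of representatives. Writing
  \<open>x\<close> and \<open>y\<close> as images of their stalks indexes the union over
  \<open>S\<close> by representatives over \<open>R\<close>, and the two unions then agree term by
  term.\<close>

lemma stalk_hfrac_add: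
  assumes P: "P \<in> proj_points R" and x: "x \<subseteq> homogeneous_pairs" and y: "y \<subseteq> homogeneous_pairs"
  shows "stalk (hfrac_add S (h ` P) x y) = hfrac_add R P (stalk x) (stalk y)"
proof -
  have *: "stalk (hfrac S (h ` P) ((h a \<otimes>\<^bsub>S\<^esub> h d) \<oplus>\<^bsub>S\<^esub> (h c \<otimes>\<^bsub>S\<^esub> h b)) (h b \<otimes>\<^bsub>S\<^esub> h d)) =
      hfrac R P ((a \<otimes> d) \<oplus> (c \<otimes> b)) (b \<otimes> d)"
    if ab: "(a, b) \<in> stalk x" "(c, d) \<in> stalk y" for a b c d
  proof -
    obtain m n where m: "a \<in> piece R m" "b \<in> piece R m" "c \<in> piece R n" "d \<in> piece R n"
      using ab by (auto simp: stalk_def)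
    then have "(a \<otimes> d) \<oplus> (c \<otimes> b) \<in> piece R (m + n)" "b \<otimes> d \<in> piece R (m + n)"
      using piece_add[of _ "m + n"] piece_mult[of a m d n] piece_mult[of c n b m] piece_mult[of b m d n]
      by (simp_all add: add.commute)
    from stalk_hfrac[OF P this] show ?thesis using m piece_in_carrier by simp
  qed
  have "stalk (hfrac_add S (h ` P) (map_prod h h ` stalk x) (map_prod h h ` stalk y)) =
      hfrac_add R P (stalk x) (stalk y)"
    unfolding hfrac_add_def using * by (simp add: stalk_UN split_beta cong: SUP_cong)
  then show ?thesis using map_prod_stalk x y by simp
qed

lemma stalk_hfrac_mult:
  assumes P: "P \<in> proj_points R" and x: "x \<subseteq> homogeneous_pairs" and y: "y \<subseteq> homogeneous_pairs"
  shows "stalk (hfrac_mult S (h ` P) x y) = hfrac_mult R P (stalk x) (stalk y)"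
proof -
  have *: "stalk (hfrac S (h ` P) (h a \<otimes>\<^bsub>S\<^esub> h c) (h b \<otimes>\<^bsub>S\<^esub> h d)) =
      hfrac R P (a \<otimes> c) (b \<otimes> d)"
    if ab: "(a, b) \<in> stalk x" "(c, d) \<in> stalk y" for a b c d
  proof -
    obtain m n where m: "a \<in> piece R m" "b \<in> piece R m" "c \<in> piece R n" "d \<in> piece R n"
      using ab by (auto simp: stalk_def)
    then have "a \<otimes> c \<in> piece R (m + n)" "b \<otimes> d \<in> piece R (m + n)"
      by (simp_all add: piece_mult)
    from stalk_hfrac[OF P this] show ?thesis using m piece_in_carrier by simp
  qed
  have "stalk (hfrac_mult S (h ` P) (map_prod h h ` stalk x) (map_prod h h ` stalk y)) =
      hfrac_mult R P (stalk x) (stalk y)"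
    unfolding hfrac_mult_def using * by (simp add: stalk_UN split_beta cong: SUP_cong)
  then show ?thesis using map_prod_stalk x y by simp
qed

section \<open>The isomorphism of the structure sheaves\<close>

lemma openin_proj_subset: "openin (proj_topology T) U \<Longrightarrow> U \<subseteq> proj_points T"
  for T :: "('c, 'k) graded_algebra"
  using openin_subset topspace_proj by blast

abbreviation pre :: "'b set set \<Rightarrow> 'a set set" where
  "pre U \<equiv> {P \<in> proj_points R. h ` P \<in> U}"

lemma openin_pre: "openin (proj_topology S) U \<Longrightarrow> openin (proj_topology R) (pre U)"
  using homeomorphic_maps_proj
  by (auto simp: homeomorphic_maps_def continuous_map_def topspace_proj)

lemma openin_image:
  assumes V: "openin (proj_topology R) V"
  shows "openin (proj_topology S) ((`) h ` V)"
  using homeomorphic_maps_proj V homeomorphic_map_openness_eq homeomorphic_maps_map by blast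

text \<open>\<open>stalk\<close> and the image under \<open>map_prod h h\<close> invert each other
  on classes of fractions, so \<open>pull\<close> and \<open>push\<close> do on sections.\<close>

definition pull :: "'b set set \<Rightarrow> ('b set \<Rightarrow> ('b \<times> 'b) set) \<Rightarrow> 'a set \<Rightarrow> ('a \<times> 'a) set" where
  "pull U s = (\<lambda>P\<in>pre U. stalk (s (h ` P)))"

definition push :: "'b set set \<Rightarrow> ('a set \<Rightarrow> ('a \<times> 'a) set) \<Rightarrow> 'b set \<Rightarrow> ('b \<times> 'b) set" where
  "push U t = (\<lambda>P'\<in>U. map_prod h h ` t (preimage P'))"

lemma section_homogeneous:
  assumes "s \<in> carrier (proj_sections S U)" "P' \<in> U"
  shows "s P' \<subseteq> homogeneous_pairs"
  using assms hfrac_homogeneous unfolding proj_sections_def by fastforce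

lemma pull_section:
  assumes U: "openin (proj_topology S) U" and s: "s \<in> carrier (proj_sections S U)"
  shows "pull U s \<in> carrier (proj_sections R (pre U))"
proof -
  have "\<exists>V. openin (proj_topology R) V \<and> P \<in> V \<and> V \<subseteq> pre U \<and>
        (\<exists>n. \<exists>a\<in>piece R n. \<exists>b\<in>piece R n. \<forall>P'\<in>V. b \<notin> P' \<and> pull U s P' = hfrac R P' a b)"
    if P: "P \<in> pre U" for P
  proof -
    from P s obtain V n a b where V: "openin (proj_topology S) V" "h ` P \<in> V" "V \<subseteq> U"
      and ab: "a \<in> piece S n" "b \<in> piece S n" "\<forall>P'\<in>V. b \<notin> P' \<and> s P' = hfrac S P' a b"
      unfolding proj_sections_def by auto
    obtain c d where cd: "c \<in> piece R n" "d \<in> piece R n" "a = h c" "b = h d"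
      using ab hom_piece by auto
    have "d \<notin> P' \<and> pull U s P' = hfrac R P' c d" if P': "P' \<in> pre V" for P'
    proof -
      have "P' \<in> pre U" using P' V(3) by blast
      then have "pull U s P' = stalk (s (h ` P'))" by (simp add: pull_def)
      also have "\<dots> = stalk (hfrac S (h ` P') a b)" using ab(3) P' by simp
      also have "\<dots> = hfrac R P' c d" using stalk_hfrac[of P' c n d] P' cd by simp
      finally show ?thesis using ab(3) P' cd(4) by blast
    qed
    then have "\<forall>P'\<in>pre V. d \<notin> P' \<and> pull U s P' = hfrac R P' c d" by blast
    with cd(1,2) have frac: "\<exists>n. \<exists>a\<in>piece R n. \<exists>b\<in>piece R n. \<forall>P'\<in>pre V. b \<notin> P' \<and>
      pull U s P' = hfrac R P' a b" by blast
    have "openin (proj_topology R) (pre V)" by (rule openin_pre[OF V(1)])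
    moreover have "P \<in> pre V" "pre V \<subseteq> pre U" using P V by auto
    ultimately show ?thesis using frac by (intro exI[of _ "pre V"] conjI)
  qed
  moreover have "pull U s \<in> extensional (pre U)" by (simp add: pull_def)
  ultimately show ?thesis unfolding proj_sections_def by simp
qed

lemma push_section:
  assumes U: "openin (proj_topology S) U" and t: "t \<in> carrier (proj_sections R (pre U))"
  shows "push U t \<in> carrier (proj_sections S U)"
proof -
  have "\<exists>V. openin (proj_topology S) V \<and> P' \<in> V \<and> V \<subseteq> U \<and>
        (\<exists>n. \<exists>a\<in>piece S n. \<exists>b\<in>piece S n. \<forall>P\<in>V. b \<notin> P \<and> push U t P = hfrac S P a b)"
    if P': "P' \<in> U" for P'
  proof -
    have pp: "P' \<in> proj_points S" using P' openin_proj_subset[OF U] by blast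
    define P where "P = preimage P'"
    have hP: "h ` P = P'" unfolding P_def by (rule image_preimage[OF proj_points_subset[OF pp]])
    have P: "P \<in> pre U" using preimage_proj_point[OF pp] hP P' by (simp add: P_def)
    from P t obtain V n a b where V: "openin (proj_topology R) V" "P \<in> V" "V \<subseteq> pre U"
      and ab: "a \<in> piece R n" "b \<in> piece R n" "\<forall>P'\<in>V. b \<notin> P' \<and> t P' = hfrac R P' a b"
      unfolding proj_sections_def by auto
    have "h b \<notin> p \<and> push U t p = hfrac S p (h a) (h b)" if p: "p \<in> (`) h ` V" for p
    proof -
      obtain q where q: "q \<in> V" "p = h ` q" using p by blast
      have q': "q \<in> proj_points R" "h ` q \<in> U" using q V(3) by auto
      have "push U t p = map_prod h h ` t q"
        using q q' by (simp add: push_def preimage_image)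
      also have "\<dots> = map_prod h h ` stalk (hfrac S (h ` q) (h a) (h b))"
        using ab(3) q stalk_hfrac[OF q'(1) ab(1,2)] by simp
      also have "\<dots> = hfrac S p (h a) (h b)"
        using q by (simp add: map_prod_stalk hfrac_homogeneous)
      finally show ?thesis
        using mem_image_iff[OF q'(1) piece_in_carrier[OF ab(2)]] ab(3) q by blast
    qed
    then have *: "\<forall>p\<in>(`) h ` V. h b \<notin> p \<and> push U t p = hfrac S p (h a) (h b)" by blast
    have "h a \<in> piece S n" "h b \<in> piece S n" using ab hom_piece by auto
    with * have frac: "\<exists>n. \<exists>a\<in>piece S n. \<exists>b\<in>piece S n. \<forall>p\<in>(`) h ` V. b \<notin> p \<and>
      push U t p = hfrac S p a b" by blast
    have "openin (proj_topology S) ((`) h ` V)" by (rule openin_image[OF V(1)])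
    moreover have "P' \<in> (`) h ` V" "(`) h ` V \<subseteq> U" using hP V by auto
    ultimately show ?thesis using frac by (intro exI[of _ "(`) h ` V"] conjI)
  qed
  moreover have "push U t \<in> extensional U" by (simp add: push_def)
  ultimately show ?thesis unfolding proj_sections_def by simp
qed

lemma push_pull:
  assumes U: "openin (proj_topology S) U" and s: "s \<in> carrier (proj_sections S U)"
  shows "push U (pull U s) = s"
proof
  fix P'
  show "push U (pull U s) P' = s P'"
  proof (cases "P' \<in> U")
    case True
    then have pp: "P' \<in> proj_points S" using openin_proj_subset[OF U] by blast
    have "h ` preimage P' = P'" by (rule image_preimage[OF proj_points_subset[OF pp]])
    then show ?thesis
      using True preimage_proj_point[OF pp] section_homogeneous[OF s True]
      by (simp add: push_def pull_def map_prod_stalk)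
  next
    case False
    then show ?thesis using s by (auto simp: push_def proj_sections_def extensional_def)
  qed
qed

lemma stalk_map_prod:
  assumes P: "P \<in> proj_points R" and ab: "a \<in> piece R n" "b \<in> piece R n"
  shows "stalk (map_prod h h ` hfrac R P a b) = hfrac R P a b"
  using stalk_hfrac[OF P ab] by (metis map_prod_stalk hfrac_homogeneous)

lemma pull_push:
  assumes U: "openin (proj_topology S) U" and t: "t \<in> carrier (proj_sections R (pre U))"
  shows "pull U (push U t) = t"
proof
  fix P
  show "pull U (push U t) P = t P"
  proof (cases "P \<in> pre U")
    case True
    obtain n a b where ab: "a \<in> piece R n" "b \<in> piece R n" "t P = hfrac R P a b"
      using t True unfolding proj_sections_def by auto
    then show ?thesis
      using True preimage_image[of P] stalk_map_prod[of P a n b]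
      by (simp add: push_def pull_def)
  next
    case False
    then show ?thesis using t by (auto simp: pull_def proj_sections_def extensional_def)
  qed
qed

lemma pull_const:
  assumes U: "openin (proj_topology S) U" and a: "a \<in> piece R 0"
  shows "pull U (\<lambda>P\<in>U. hfrac S P (h a) \<one>\<^bsub>S\<^esub>) = (\<lambda>P\<in>pre U. hfrac R P a \<one>)"
  unfolding pull_def by (rule restrict_ext) (use stalk_hfrac[OF _ a piece_one] in auto)

lemma pull_iso:
  assumes U: "openin (proj_topology S) U"
  shows "pull U \<in> ring_iso (proj_sections S U) (proj_sections R (pre U))"
proof (rule ring_iso_memI)
  fix s t assume st: "s \<in> carrier (proj_sections S U)" "t \<in> carrier (proj_sections S U)"
  show "pull U s \<in> carrier (proj_sections R (pre U))" by (rule pull_section[OF U st(1)])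
  note hom = section_homogeneous[OF st(1)] section_homogeneous[OF st(2)]
  show "pull U (s \<otimes>\<^bsub>proj_sections S U\<^esub> t) = pull U s \<otimes>\<^bsub>proj_sections R (pre U)\<^esub> pull U t"
    unfolding pull_def proj_sections_def monoid.simps ring.simps
    by (rule restrict_ext) (use hom in \<open>auto simp: stalk_hfrac_mult\<close>)
  show "pull U (s \<oplus>\<^bsub>proj_sections S U\<^esub> t) = pull U s \<oplus>\<^bsub>proj_sections R (pre U)\<^esub> pull U t"
    unfolding pull_def proj_sections_def monoid.simps ring.simps
    by (rule restrict_ext) (use hom in \<open>auto simp: stalk_hfrac_add\<close>)
next
  show "pull U \<one>\<^bsub>proj_sections S U\<^esub> = \<one>\<^bsub>proj_sections R (pre U)\<^esub>"
    using pull_const[OF U piece_one] by (simp add: proj_sections_def)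
  show "bij_betw (pull U) (carrier (proj_sections S U)) (carrier (proj_sections R (pre U)))"
    by (rule bij_betw_byWitness[where f' = "push U"])
      (use push_pull[OF U] pull_push[OF U] pull_section[OF U] push_section[OF U] in auto)
qed

theorem isomorphic_Proj: "isomorphic_over_field (Proj R) (Proj S)"
  unfolding isomorphic_over_field_def
proof (intro exI[of _ "(`) h"] exI[of _ pull] conjI)
  show "homeomorphic_map (top_of (Proj R)) (top_of (Proj S)) ((`) h)"
    using homeomorphic_maps_proj homeomorphic_maps_map by (auto simp: Proj_def)
  have pre: "{x \<in> topspace (top_of (Proj R)). h ` x \<in> U} = pre U" for U
    by (simp add: Proj_def topspace_proj)
  have scal: "pull U (scal (Proj S) U c) = scal (Proj R) (pre U) c"
    if "openin (proj_topology S) U" for U c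
    using pull_const[OF that piece_scalar] hom_scalar by (simp add: Proj_def)
  have restr: "restr (Proj R) (pre U) (pre V) (pull U s) = pull V (restr (Proj S) U V s)"
    if "V \<subseteq> U" for U V s
    using that by (auto simp: Proj_def pull_def fun_eq_iff restrict_def)
  show "let pre = \<lambda>U. {x \<in> topspace (top_of (Proj R)). h ` x \<in> U}
    in \<forall>U. openin (top_of (Proj S)) U \<longrightarrow>
        pull U \<in> ring_iso (sects (Proj S) U) (sects (Proj R) (pre U)) \<and>
        (\<forall>c. pull U (scal (Proj S) U c) = scal (Proj R) (pre U) c) \<and>
        (\<forall>V s. openin (top_of (Proj S)) V \<longrightarrow> V \<subseteq> U \<longrightarrow> s \<in> carrier (sects (Proj S) U) \<longrightarrow>
          restr (Proj R) (pre U) (pre V) (pull U s) = pull V (restr (Proj S) U V s))"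
    unfolding Let_def pre
    using pull_iso scal restr by (simp add: Proj_def)
qed

end

section \<open>Semi-invariants of the toric ideal\<close>

text \<open>Used for test functionals: if \<open>F\<close> agrees on the two terms of every
  generating binomial and of all its multiples by basis elements, then \<open>lin F\<close> vanishes
  on the ideal that they generate.\<close>

definition lin :: "('b \<Rightarrow> 'k::comm_ring_1) \<Rightarrow> ('b \<Rightarrow>\<^sub>0 'k) \<Rightarrow> 'k" where
  "lin F f = (\<Sum>u\<in>keys f. lookup f u * F u)"

lemma lin_add: "lin F (f + g) = lin F f + lin F g"
  unfolding lin_def by (rule setsum_keys_plus_distrib) (simp_all add: distrib_right)

lemma lin_zero [simp]: "lin F 0 = 0"
  by (simp add: lin_def)

lemma lin_single [simp]: "lin F (single u c) = c * F u"
  by (simp add: lin_def)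

lemma lin_uminus: "lin F (- f) = - lin F f"
  using lin_add[of F f "- f"] by (simp add: eq_neg_iff_add_eq_0 add.commute)

lemma lin_sum: "lin F (\<Sum>x\<in>A. p x) = (\<Sum>x\<in>A. lin F (p x))"
  by (induction A rule: infinite_finite_induct) (simp_all add: lin_add)

lemma sum_single: "(\<Sum>u\<in>keys f. single u (lookup f u)) = f"
  by (rule poly_mapping_eqI)
    (simp add: lookup_sum lookup_single when_def in_keys_iff)

lemma lin_mult:
  fixes f g :: "('b::monoid_add) \<Rightarrow>\<^sub>0 ('k::comm_ring_1)"
  shows "lin F (g * f) = (\<Sum>v\<in>keys g. lookup g v * lin (\<lambda>u. F (v + u)) f)"
proof -
  have "g * f = (\<Sum>v\<in>keys g. single v (lookup g v)) *
      (\<Sum>u\<in>keys f. single u (lookup f u))"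
    by (simp only: sum_single)
  then have "lin F (g * f) = (\<Sum>v\<in>keys g. \<Sum>u\<in>keys f.
      lookup g v * lookup f u * F (v + u))"
    by (simp only: sum_product lin_sum mult_single lin_single)
  then show ?thesis by (simp add: lin_def[of _ f] sum_distrib_left mult.assoc)
qed

section \<open>Weights and divisors of monomials\<close>

lemma inc_exp_add: "inc_exp Q (u + v) = (\<lambda>i. inc_exp Q u i + inc_exp Q v i)"
  unfolding inc_exp_def
  by (rule ext, rule setsum_keys_plus_distrib) (simp_all add: distrib_right)

lemma inc_exp_zero [simp]: "inc_exp Q 0 = (\<lambda>i. 0)"
  by (simp add: inc_exp_def)

lemma div_exp_add: "div_exp Q (u + v) = (\<lambda>\<rho>. div_exp Q u \<rho> + div_exp Q v \<rho>)"
  unfolding div_exp_def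
  by (rule ext, rule setsum_keys_plus_distrib) (simp_all add: distrib_right)

lemma div_exp_zero [simp]: "div_exp Q 0 = (\<lambda>i. 0)"
  by (simp add: div_exp_def)

lemma monomial_mult: "monomial u * monomial v = monomial (u + v)"
  by (simp add: monomial_def mult_single)

lemma keys_add_nat: "keys (u + v) = keys u \<union> keys v"
  for u v :: "'b \<Rightarrow>\<^sub>0 nat"
  by (auto simp: in_keys_iff lookup_add)

lemma arrow_polys_simps:
  "monoid.mult (arrow_polys Q) = (*)" "one (arrow_polys Q) = 1"
  "zero (arrow_polys Q) = 0" "add (arrow_polys Q) = (+)"
  by (simp_all add: arrow_polys_def)

lemma carrier_arrow_polys:
  "f \<in> carrier (arrow_polys Q) \<longleftrightarrow> (\<forall>u\<in>keys f. keys u \<subseteq> arrows Q)"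
  by (simp add: arrow_polys_def)

lemma keys_mult_cases:
  fixes f g :: "('b::monoid_add) \<Rightarrow>\<^sub>0 ('k::semiring_0)"
  assumes "u \<in> keys (f * g)"
  obtains v w where "v \<in> keys f" "w \<in> keys g" "u = v + w"
  using assms keys_mult[of f g] by auto

lemma binomial_in_carrier:
  assumes "keys u \<subseteq> arrows Q" "keys v \<subseteq> arrows Q"
  shows "monomial u - monomial v \<in> carrier (arrow_polys Q)"
  unfolding carrier_arrow_polys
proof
  fix w assume "w \<in> keys (monomial u - monomial v :: ('a, 'k::field) mpoly)"
  then have "w \<in> {u, v}"
    using keys_diff[of "monomial u :: ('a, 'k::field) mpoly" "monomial v"] by (auto simp: monomial_def)
  then show "keys w \<subseteq> arrows Q" using assms by blast
qed

lemma cring_arrow_polys: "cring (arrow_polys Q :: ('a, 'k::field) mpoly ring)"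
proof (rule cringI)
  let ?R = "arrow_polys Q :: ('a, 'k::field) mpoly ring"
  show "abelian_group ?R"
  proof (rule abelian_groupI; unfold arrow_polys_simps)
    fix x y assume "x \<in> carrier ?R" "y \<in> carrier ?R"
    then show "x + y \<in> carrier ?R"
      using keys_add[of x y] unfolding carrier_arrow_polys by blast
  next
    fix x assume "x \<in> carrier ?R"
    then have "- x \<in> carrier ?R" by (simp add: carrier_arrow_polys)
    then show "\<exists>y\<in>carrier ?R. y + x = 0" by (intro bexI[of _ "- x"]) simp_all
  qed (simp_all add: carrier_arrow_polys algebra_simps)
  show "comm_monoid ?R"
  proof (rule comm_monoidI; unfold arrow_polys_simps)
    fix x y assume xy: "x \<in> carrier ?R" "y \<in> carrier ?R"
    show "x * y \<in> carrier ?R"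
      unfolding carrier_arrow_polys
    proof
      fix u assume "u \<in> keys (x * y)"
      then obtain v w where "v \<in> keys x" "w \<in> keys y" "u = v + w"
        by (rule keys_mult_cases)
      then show "keys u \<subseteq> arrows Q"
        using xy by (auto simp: carrier_arrow_polys keys_add_nat)
    qed
  qed (simp_all add: carrier_arrow_polys algebra_simps)
qed (simp add: arrow_polys_simps algebra_simps)

lemma a_inv_arrow_polys:
  assumes "f \<in> carrier (arrow_polys Q :: ('a, 'k::field) mpoly ring)"
  shows "\<ominus>\<^bsub>arrow_polys Q\<^esub> f = - f"
proof -
  interpret cring "arrow_polys Q :: ('a, 'k::field) mpoly ring" by (rule cring_arrow_polys)
  have "- f \<in> carrier (arrow_polys Q)" using assms by (simp add: carrier_arrow_polys)
  then show ?thesis using assms by (intro minus_equality) (simp_all add: arrow_polys_simps)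
qed

text \<open>The set \<open>N\<close> of admissible multiples of the weight serves both cases at
  once: \<open>UNIV\<close> gives the carrier of the ring of semi-invariants and \<open>{n}\<close>
  its piece of degree \<open>n\<close>.\<close>

definition weighted :: "'a quiver \<Rightarrow> (nat \<Rightarrow> int) \<Rightarrow> nat set \<Rightarrow> ('a, 'k::field) mpoly set" where
  "weighted Q \<theta> N = {f \<in> carrier (arrow_polys Q).
     \<forall>u\<in>keys f. \<exists>j\<in>N. inc_exp Q u = (\<lambda>i. int j * \<theta> i)}"

lemma weighted_carrier: "f \<in> weighted Q \<theta> N \<Longrightarrow> f \<in> carrier (arrow_polys Q)"
  by (simp add: weighted_def)

lemma weighted_add: "f \<in> weighted Q \<theta> N \<Longrightarrow> g \<in> weighted Q \<theta> N \<Longrightarrow> f + g \<in> weighted Q \<theta> N"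
  using keys_add[of f g] unfolding weighted_def carrier_arrow_polys by blast

lemma weighted_uminus: "f \<in> weighted Q \<theta> N \<Longrightarrow> - f \<in> weighted Q \<theta> N"
  by (simp add: weighted_def carrier_arrow_polys)

lemma weighted_diff: "f \<in> weighted Q \<theta> N \<Longrightarrow> g \<in> weighted Q \<theta> N \<Longrightarrow> f - g \<in> weighted Q \<theta> N"
  using weighted_add[OF _ weighted_uminus, of f Q \<theta> N g] by simp

lemma weighted_zero: "0 \<in> weighted Q \<theta> N"
  by (simp add: weighted_def carrier_arrow_polys)

lemma weighted_mult:
  assumes f: "f \<in> weighted Q \<theta> M" and g: "g \<in> weighted Q \<theta> N"
    and MN: "\<And>m n. m \<in> M \<Longrightarrow> n \<in> N \<Longrightarrow> m + n \<in> L"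
  shows "f * g \<in> weighted Q \<theta> L"
  unfolding weighted_def carrier_arrow_polys mem_Collect_eq
proof (intro conjI ballI)
  fix u assume "u \<in> keys (f * g)"
  then obtain v w where vw: "v \<in> keys f" "w \<in> keys g" "u = v + w"
    by (rule keys_mult_cases)
  then show "keys u \<subseteq> arrows Q"
    using f g by (auto simp: weighted_def carrier_arrow_polys keys_add_nat)
  obtain m n where "m \<in> M" "inc_exp Q v = (\<lambda>i. int m * \<theta> i)" "n \<in> N" "inc_exp Q w = (\<lambda>i. int n * \<theta> i)"
    using f g vw unfolding weighted_def mem_Collect_eq by metis
  then show "\<exists>j\<in>L. inc_exp Q u = (\<lambda>i. int j * \<theta> i)"
    using MN by (intro bexI[of _ "m + n"]) (auto simp: vw(3) inc_exp_add distrib_right)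
qed

lemma weighted_single:
  "keys u \<subseteq> arrows Q \<Longrightarrow> inc_exp Q u = (\<lambda>i. int n * \<theta> i) \<Longrightarrow> n \<in> N \<Longrightarrow>
    single u c \<in> weighted Q \<theta> N"
  by (auto simp: weighted_def carrier_arrow_polys)

lemma weighted_one: "1 \<in> weighted Q \<theta> {0}"
  unfolding single_one[symmetric] by (rule weighted_single[where n = 0]) simp_all

lemma weighted_mono: "f \<in> weighted Q \<theta> M \<Longrightarrow> M \<subseteq> N \<Longrightarrow> f \<in> weighted Q \<theta> N"
  unfolding weighted_def by blast

lemma semi_invariants_simps:
  "carrier (semi_invariants Q \<theta> I) = (+>\<^bsub>arrow_polys Q\<^esub>) I ` weighted Q \<theta> UNIV"
  "piece (semi_invariants Q \<theta> I) n = (+>\<^bsub>arrow_polys Q\<^esub>) I ` weighted Q \<theta> {n}"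
  "monoid.mult (semi_invariants Q \<theta> I) = monoid.mult (arrow_polys Q Quot I)"
  "one (semi_invariants Q \<theta> I) = one (arrow_polys Q Quot I)"
  "zero (semi_invariants Q \<theta> I) = zero (arrow_polys Q Quot I)"
  "add (semi_invariants Q \<theta> I) = add (arrow_polys Q Quot I)"
  "scalar (semi_invariants Q \<theta> I) c = I +>\<^bsub>arrow_polys Q\<^esub> single 0 c"
  by (auto simp: semi_invariants_def weighted_def)

context
  fixes Q :: "'a quiver" and \<theta> :: "nat \<Rightarrow> int" and I :: "('a, 'k::field) mpoly set"
  assumes I: "ideal I (arrow_polys Q)"
begin

interpretation R: cring "arrow_polys Q :: ('a, 'k) mpoly ring" by (rule cring_arrow_polys)
interpretation I: ideal I "arrow_polys Q" by (rule I)

lemma coset_ops: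
  assumes "f \<in> weighted Q \<theta> UNIV" "g \<in> weighted Q \<theta> UNIV"
  shows "(I +>\<^bsub>arrow_polys Q\<^esub> f) \<otimes>\<^bsub>semi_invariants Q \<theta> I\<^esub> (I +>\<^bsub>arrow_polys Q\<^esub> g) = I +>\<^bsub>arrow_polys Q\<^esub> (f * g)"
    and "(I +>\<^bsub>arrow_polys Q\<^esub> f) \<oplus>\<^bsub>semi_invariants Q \<theta> I\<^esub> (I +>\<^bsub>arrow_polys Q\<^esub> g) = I +>\<^bsub>arrow_polys Q\<^esub> (f + g)"
    and "\<one>\<^bsub>semi_invariants Q \<theta> I\<^esub> = I +>\<^bsub>arrow_polys Q\<^esub> 1"
    and "\<zero>\<^bsub>semi_invariants Q \<theta> I\<^esub> = I +>\<^bsub>arrow_polys Q\<^esub> 0"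
proof -
  interpret h: ring_hom_ring "arrow_polys Q" "arrow_polys Q Quot I" "(+>\<^bsub>arrow_polys Q\<^esub>) I"
    by (rule I.rcos_ring_hom_ring)
  note c = assms[THEN weighted_carrier]
  show "(I +>\<^bsub>arrow_polys Q\<^esub> f) \<otimes>\<^bsub>semi_invariants Q \<theta> I\<^esub> (I +>\<^bsub>arrow_polys Q\<^esub> g) = I +>\<^bsub>arrow_polys Q\<^esub> (f * g)"
    using h.hom_mult[OF c] by (simp add: semi_invariants_simps arrow_polys_simps)
  show "(I +>\<^bsub>arrow_polys Q\<^esub> f) \<oplus>\<^bsub>semi_invariants Q \<theta> I\<^esub> (I +>\<^bsub>arrow_polys Q\<^esub> g) = I +>\<^bsub>arrow_polys Q\<^esub> (f + g)"
    using h.hom_add[OF c] by (simp add: semi_invariants_simps arrow_polys_simps)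
  show "\<one>\<^bsub>semi_invariants Q \<theta> I\<^esub> = I +>\<^bsub>arrow_polys Q\<^esub> 1"
    using h.hom_one by (simp add: semi_invariants_simps arrow_polys_simps)
  show "\<zero>\<^bsub>semi_invariants Q \<theta> I\<^esub> = I +>\<^bsub>arrow_polys Q\<^esub> 0"
    using h.hom_zero by (simp add: semi_invariants_simps arrow_polys_simps)
qed

lemma coset_eq_iff:
  assumes "f \<in> carrier (arrow_polys Q)" "g \<in> carrier (arrow_polys Q)"
  shows "I +>\<^bsub>arrow_polys Q\<^esub> f = I +>\<^bsub>arrow_polys Q\<^esub> g \<longleftrightarrow> f - g \<in> I"
proof -
  have "f \<ominus>\<^bsub>arrow_polys Q\<^esub> g = f - g"
    using assms by (simp add: R.minus_eq a_inv_arrow_polys arrow_polys_simps)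
  then show ?thesis using R.quotient_eq_iff_same_a_r_cos[OF I assms] by simp
qed

lemma cring_semi_invariants: "cring (semi_invariants Q \<theta> I)"
proof -
  let ?S = "semi_invariants Q \<theta> I" let ?p = "(+>\<^bsub>arrow_polys Q\<^esub>) I" let ?W = "weighted Q \<theta> UNIV"
  have one: "1 \<in> ?W" using weighted_one weighted_mono by blast
  have mult: "f * g \<in> ?W" if "f \<in> ?W" "g \<in> ?W" for f g :: "('a, 'k) mpoly"
    using that by (rule weighted_mult) simp
  note ones = coset_ops(3,4)[OF one one]
  note W = weighted_add[of _ Q \<theta> UNIV] mult one weighted_zero
  show ?thesis
  proof (rule cringI)
    show "abelian_group ?S"
    proof (rule abelian_groupI; unfold semi_invariants_simps(1))
      fix x assume "x \<in> ?p ` ?W"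
      then obtain f where "f \<in> ?W" "x = ?p f" by auto
      then show "\<exists>y\<in>?p ` ?W. y \<oplus>\<^bsub>?S\<^esub> x = \<zero>\<^bsub>?S\<^esub>"
        by (intro bexI[of _ "?p (- f)"]) (simp_all add: coset_ops(2) W ones weighted_uminus)
    qed (auto simp: coset_ops(2) W ones ac_simps)
    show "comm_monoid ?S"
      by (rule comm_monoidI; unfold semi_invariants_simps(1)) (auto simp: coset_ops(1) W ones ac_simps)
  qed (auto simp: semi_invariants_simps(1) coset_ops W distrib_right)
qed

end

lemma ideal_I_Q_ideal: "ideal (ideal_I_Q Q) (arrow_polys Q :: ('a, 'k::field) mpoly ring)"
proof -
  interpret R: cring "arrow_polys Q :: ('a, 'k) mpoly ring" by (rule cring_arrow_polys)
  show ?thesis unfolding ideal_I_Q_def by (intro R.genideal_ideal) (auto intro: binomial_in_carrier)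
qed

text \<open>Being annihilated by all functionals that depend only on \<open>inc_exp\<close> and
  \<open>div_exp\<close> is an ideal condition: multiplication by a monomial shifts both by
  constants, which merely replaces \<open>G\<close> by another function \<open>G'\<close>. The
  generating binomials satisfy it.\<close>

lemma lin_ideal_I_Q:
  fixes f :: "('a, 'k::field) mpoly"
  assumes "f \<in> ideal_I_Q Q"
  shows "f \<in> carrier (arrow_polys Q) \<and> lin (\<lambda>u. G (inc_exp Q u, div_exp Q u)) f = 0"
proof -
  let ?R = "arrow_polys Q :: ('a, 'k) mpoly ring"
  interpret R: cring ?R by (rule cring_arrow_polys)
  define K where "K = {f \<in> carrier ?R. \<forall>G. lin (\<lambda>u. G (inc_exp Q u, div_exp Q u)) f = 0}"
  have mult: "g * f \<in> K" if f: "f \<in> K" and g: "g \<in> carrier ?R" for f g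
  proof -
    have "lin (\<lambda>u. G (inc_exp Q (v + u), div_exp Q (v + u))) f = 0" for G v
    proof -
      define G' where "G' = (\<lambda>(c, d). G (\<lambda>i. inc_exp Q v i + c i, \<lambda>i. div_exp Q v i + d i))"
      have "lin (\<lambda>u. G' (inc_exp Q u, div_exp Q u)) f = 0" using f by (simp add: K_def)
      then show ?thesis by (simp add: G'_def inc_exp_add div_exp_add)
    qed
    then show ?thesis using f g R.m_closed[of g f] by (simp add: K_def lin_mult arrow_polys_simps)
  qed
  have "ideal K ?R"
  proof (rule idealI)
    show "ring ?R" by (rule R.ring_axioms)
    show "subgroup K (add_monoid ?R)"
    proof (rule R.add.subgroupI)
      show "K \<subseteq> carrier ?R" by (auto simp: K_def)
      show "K \<noteq> {}" using R.zero_closed by (auto simp: K_def arrow_polys_simps)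
      show "\<ominus>\<^bsub>?R\<^esub> x \<in> K" if "x \<in> K" for x
        using that R.a_inv_closed[of x] by (simp add: K_def a_inv_arrow_polys lin_uminus)
      show "x \<oplus>\<^bsub>?R\<^esub> y \<in> K" if "x \<in> K" "y \<in> K" for x y
        using that R.a_closed[of x y] by (simp add: K_def arrow_polys_simps lin_add)
    qed
    show "x \<otimes>\<^bsub>?R\<^esub> a \<in> K" "a \<otimes>\<^bsub>?R\<^esub> x \<in> K" if "a \<in> K" "x \<in> carrier ?R" for a x
      using mult[OF that] by (simp_all add: arrow_polys_simps mult.commute)
  qed
  then have "ideal_I_Q Q \<subseteq> K"
    unfolding ideal_I_Q_def
  proof (rule R.genideal_minimal, safe)
    fix u v assume *: "keys u \<subseteq> arrows Q" "keys v \<subseteq> arrows Q"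
      "inc_exp Q u = inc_exp Q v" "div_exp Q u = div_exp Q v"
    have "monomial u - monomial v \<in> carrier ?R" using * by (simp add: binomial_in_carrier)
    moreover have "lin F (monomial u - monomial v) = F u - F v" for F :: "_ \<Rightarrow> 'k"
      using lin_add[of F "monomial u" "- monomial v"] by (simp add: lin_uminus monomial_def)
    ultimately show "monomial u - monomial v \<in> K" using * by (simp add: K_def)
  qed
  then show ?thesis using assms by (auto simp: K_def)
qed

text \<open>The coefficients of \<open>f\<close> add up to zero within each class of
  \<open>(inc_exp, div_exp)\<close>. Replacing every monomial by a representative of its class thus
  gives zero, and subtracting this zero from \<open>f\<close> leaves binomials. The representatives
  are monomials of \<open>f\<close> itself and so keep its weights and its arrows.\<close>

lemma ideal_I_Q_expand:
  fixes f :: "('a, 'k::field) mpoly"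
  assumes f: "f \<in> ideal_I_Q Q"
  obtains w where
    "f = (\<Sum>v\<in>keys f. single 0 (lookup f v) * (monomial v - monomial (w v)))"
    and "\<And>v. v \<in> keys f \<Longrightarrow> w v \<in> keys f \<and>
      inc_exp Q (w v) = inc_exp Q v \<and> div_exp Q (w v) = div_exp Q v"
proof -
  let ?c = "\<lambda>v. (inc_exp Q v, div_exp Q v)"
  define rp where "rp c = (SOME v. v \<in> keys f \<and> ?c v = c)" for c
  have rp: "rp (?c v) \<in> keys f \<and> ?c (rp (?c v)) = ?c v" if "v \<in> keys f" for v
    unfolding rp_def by (rule someI_ex[where P = "\<lambda>w. w \<in> keys f \<and> ?c w = ?c v"]) (use that in blast)
  have "(\<Sum>v\<in>keys f. single (rp (?c v)) (lookup f v)) = 0"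
  proof (rule poly_mapping_eqI)
    fix t
    have "lookup (\<Sum>v\<in>keys f. single (rp (?c v)) (lookup f v)) t
      = lin (\<lambda>u. (\<lambda>c. if rp c = t then 1 else 0) (?c u)) f"
      by (simp add: lookup_sum lookup_single when_def lin_def if_distrib cong: if_cong)
    also have "\<dots> = 0" using lin_ideal_I_Q[OF f, of "\<lambda>c. if rp c = t then 1 else 0"] by blast
    finally show "lookup (\<Sum>v\<in>keys f. single (rp (?c v)) (lookup f v)) t
      = lookup 0 t" by simp
  qed
  then have "f = (\<Sum>v\<in>keys f. single 0 (lookup f v) * (monomial v - monomial (rp (?c v))))"
    by (simp add: right_diff_distrib monomial_def mult_single sum_subtractf sum_single)
  then show ?thesis using rp by (intro that[of "\<lambda>v. rp (?c v)"]) auto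
qed

lemma isomorphic_quotients:
  fixes Q :: "'a quiver" and I :: "('a, 'k::field) mpoly set"
  assumes I: "ideal I (arrow_polys Q)" and sub: "I \<subseteq> ideal_I_Q Q"
    and kill: "\<And>u v w n. keys u \<subseteq> arrows Q \<Longrightarrow> keys v \<subseteq> arrows Q \<Longrightarrow>
      keys w \<subseteq> arrows Q \<Longrightarrow> n > 0 \<Longrightarrow> inc_exp Q u = (\<lambda>i. int n * \<theta> i) \<Longrightarrow>
      inc_exp Q v = inc_exp Q w \<Longrightarrow> div_exp Q v = div_exp Q w \<Longrightarrow>
      \<exists>N. monomial u ^ N * (monomial v - monomial w) \<in> I"
  shows "isomorphic_over_field (git_quotient Q \<theta> I) (git_quotient Q \<theta> (ideal_I_Q Q))"
proof -
  let ?R = "arrow_polys Q :: ('a, 'k) mpoly ring"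
  define J where "J = (ideal_I_Q Q :: ('a, 'k) mpoly set)"
  have J: "ideal J ?R" unfolding J_def by (rule ideal_I_Q_ideal)
  interpret R: cring ?R by (rule cring_arrow_polys)
  interpret I: ideal I ?R by (rule I)
  interpret J: ideal J ?R by (rule J)
  let ?S = "semi_invariants Q \<theta> I" let ?T = "semi_invariants Q \<theta> J"
  let ?p = "(+>\<^bsub>?R\<^esub>) I" let ?q = "(+>\<^bsub>?R\<^esub>) J" let ?W = "weighted Q \<theta> UNIV :: ('a, 'k) mpoly set"
  \<comment> \<open>Since \<open>I\<close> lies in \<open>J\<close>, adding \<open>J\<close> to a
    coset of \<open>I\<close> gives the coset of \<open>J\<close> with the same representatives.
    Defined on sets, the map involves no choice.\<close>
  define h where "h C = J <+>\<^bsub>?R\<^esub> C" for C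
  have Ic: "\<And>x y. x \<in> I \<Longrightarrow> y \<in> I \<Longrightarrow> x + y \<in> I" and Jc: "\<And>x y. x \<in> J \<Longrightarrow> y \<in> J \<Longrightarrow> x + y \<in> J"
    using I.a_closed J.a_closed by (simp_all add: arrow_polys_simps)
  have zI: "0 \<in> I" using additive_subgroup.zero_closed[OF I.additive_subgroup_axioms]
    by (simp add: arrow_polys_simps)
  have IJ: "I \<subseteq> J" using sub by (simp add: J_def)
  have hp: "h (?p f) = ?q f" for f
  proof (intro equalityI subsetI)
    fix x assume "x \<in> h (?p f)"
    then obtain j i where "j \<in> J" "i \<in> I" "x = j + (i + f)"
      by (auto simp: h_def set_add_def' a_r_coset_def' arrow_polys_simps)
    then show "x \<in> ?q f" using Jc[of j i] IJ
      by (auto simp: a_r_coset_def' arrow_polys_simps add.assoc[symmetric])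
  next
    fix x assume "x \<in> ?q f"
    then obtain j where "j \<in> J" "x = j + (0 + f)"
      by (auto simp: a_r_coset_def' arrow_polys_simps)
    then show "x \<in> h (?p f)" using zI
      unfolding h_def set_add_def' a_r_coset_def' arrow_polys_simps by blast
  qed
  have mult: "f * g \<in> ?W" if "f \<in> ?W" "g \<in> ?W" for f g
    using that by (rule weighted_mult) simp
  have W1: "1 \<in> ?W" using weighted_one weighted_mono by blast
  have Wn: "f \<in> ?W" if "f \<in> weighted Q \<theta> {n}" for f n using that weighted_mono by blast
  note pops = coset_ops[OF I, of _ \<theta>] and qops = coset_ops[OF J, of _ \<theta>]
  note zero = pops(4)[OF W1 W1] and one = pops(3)[OF W1 W1]
  note zeroJ = qops(4)[OF W1 W1] and oneJ = qops(3)[OF W1 W1]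
  have hom: "h \<in> ring_hom ?S ?T"
  proof (rule ring_hom_memI)
    fix x y assume "x \<in> carrier ?S" "y \<in> carrier ?S"
    then obtain f g where *: "f \<in> ?W" "g \<in> ?W" "x = ?p f" "y = ?p g"
      unfolding semi_invariants_simps(1) by auto
    then show "h x \<in> carrier ?T" unfolding semi_invariants_simps(1) by (auto simp: hp)
    from * show "h (x \<otimes>\<^bsub>?S\<^esub> y) = h x \<otimes>\<^bsub>?T\<^esub> h y" "h (x \<oplus>\<^bsub>?S\<^esub> y) = h x \<oplus>\<^bsub>?T\<^esub> h y"
      by (simp_all add: pops(1,2) qops(1,2) hp)
  next
    show "h \<one>\<^bsub>?S\<^esub> = \<one>\<^bsub>?T\<^esub>" by (simp add: one oneJ hp)
  qed
  interpret S: cring ?S by (rule cring_semi_invariants[OF I])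
  interpret T: cring ?T by (rule cring_semi_invariants[OF J])
  interpret ring_hom_cring ?S ?T h
    by (intro ring_hom_cring.intro ring_hom_cring_axioms.intro S.is_cring T.is_cring hom)
  have zero_carrier: "0 \<in> carrier ?R" by (simp add: carrier_arrow_polys)
  have in_J: "f \<in> J" if f: "f \<in> ?W" and hf: "h (?p f) = \<zero>\<^bsub>?T\<^esub>" for f
  proof -
    have "?q f = ?q 0" using hf by (simp add: hp zeroJ)
    then show ?thesis
      using coset_eq_iff[OF J, of f 0] weighted_carrier[OF f] zero_carrier by simp
  qed
  have a_inv: "\<ominus>\<^bsub>?S\<^esub> (?p f) = ?p (- f)" if "f \<in> ?W" for f
    using that by (intro S.minus_equality)
      (auto simp: pops(2) weighted_uminus zero semi_invariants_simps(1))
  have binom_J: "monomial v - monomial w \<in> J"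
    if "keys v \<subseteq> arrows Q" "keys w \<subseteq> arrows Q" "inc_exp Q v = inc_exp Q w" "div_exp Q v = div_exp Q w" for v w
  proof -
    have "monomial v - monomial w \<in> {monomial u - monomial v | u v.
        keys u \<subseteq> arrows Q \<and> keys v \<subseteq> arrows Q \<and>
        inc_exp Q u = inc_exp Q v \<and> div_exp Q u = div_exp Q v}" using that by blast
    then show ?thesis unfolding J_def ideal_I_Q_def genideal_def by blast
  qed
  have "graded_surjection ?S ?T h"
  proof (unfold_locales)
    show "piece ?S n \<subseteq> carrier ?S" for n
      unfolding semi_invariants_simps using Wn by blast
    show "a \<otimes>\<^bsub>?S\<^esub> b \<in> piece ?S (m + n)" if ab: "a \<in> piece ?S m" "b \<in> piece ?S n" for a b m n
    proof -
      obtain f g where fg: "f \<in> weighted Q \<theta> {m}" "g \<in> weighted Q \<theta> {n}" "a = ?p f" "b = ?p g"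
        using ab by (auto simp: semi_invariants_simps(2))
      have "f * g \<in> weighted Q \<theta> {m + n}" using fg(1,2) by (rule weighted_mult) simp
      then show ?thesis unfolding semi_invariants_simps(2)
        using pops(1)[OF Wn[OF fg(1)] Wn[OF fg(2)]] fg by auto
    qed
    show "a \<oplus>\<^bsub>?S\<^esub> b \<in> piece ?S n" if ab: "a \<in> piece ?S n" "b \<in> piece ?S n" for a b n
    proof -
      obtain f g where fg: "f \<in> weighted Q \<theta> {n}" "g \<in> weighted Q \<theta> {n}" "a = ?p f" "b = ?p g"
        using ab by (auto simp: semi_invariants_simps(2))
      then show ?thesis unfolding semi_invariants_simps(2)
        using pops(2)[OF Wn[OF fg(1)] Wn[OF fg(2)]] weighted_add[OF fg(1,2)] by auto
    qed
    show "\<ominus>\<^bsub>?S\<^esub> a \<in> piece ?S n" if a: "a \<in> piece ?S n" for a n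
      using a a_inv[OF Wn] weighted_uminus by (fastforce simp: semi_invariants_simps(2))
    show "\<one>\<^bsub>?S\<^esub> \<in> piece ?S 0"
      unfolding semi_invariants_simps(2) one using weighted_one by blast
    show "scalar ?S c \<in> piece ?S 0" for c
      unfolding semi_invariants_simps by (intro imageI weighted_single[where n = 0]) simp_all
    show "piece ?T n = h ` piece ?S n" for n
      unfolding semi_invariants_simps(2) by (simp add: image_image hp)
    show "h (scalar ?S c) = scalar ?T c" for c
      by (simp add: semi_invariants_simps hp)
    show "h ` carrier ?S = carrier ?T"
      unfolding semi_invariants_simps(1) by (simp add: image_image hp)
    show "a \<in> genideal ?S {b \<in> (\<Union>n. piece ?S n). h b = \<zero>\<^bsub>?T\<^esub>}"
      if a: "a \<in> carrier ?S" "h a = \<zero>\<^bsub>?T\<^esub>" for a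
    proof -
      let ?H = "{b \<in> (\<Union>n. piece ?S n). h b = \<zero>\<^bsub>?T\<^esub>}"
      have Hc: "?H \<subseteq> carrier ?S" unfolding semi_invariants_simps using Wn by blast
      interpret G: ideal "genideal ?S ?H" ?S by (rule S.genideal_ideal[OF Hc])
      obtain f where f: "f \<in> ?W" "a = ?p f" using a by (auto simp: semi_invariants_simps(1))
      then have "f \<in> J" using in_J a by blast
      then obtain w where w: "f = (\<Sum>v\<in>keys f.
            single 0 (lookup f v) * (monomial v - monomial (w v)))"
        "\<And>v. v \<in> keys f \<Longrightarrow> w v \<in> keys f \<and>
          inc_exp Q (w v) = inc_exp Q v \<and> div_exp Q (w v) = div_exp Q v"
        unfolding J_def by (rule ideal_I_Q_expand) blast
      define t where "t v = single 0 (lookup f v) * (monomial v - monomial (w v))" for v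
      have t: "t v \<in> ?W \<and> ?p (t v) \<in> genideal ?S ?H" if v: "v \<in> keys f" for v
      proof -
        from v f obtain j where j: "inc_exp Q v = (\<lambda>i. int j * \<theta> i)" by (auto simp: weighted_def)
        have k: "keys v \<subseteq> arrows Q" "keys (w v) \<subseteq> arrows Q"
          using v w(2)[OF v] weighted_carrier[OF f(1)] by (auto simp: carrier_arrow_polys)
        have "monomial v - monomial (w v) \<in> weighted Q \<theta> {j}"
          unfolding monomial_def using k j w(2)[OF v]
          by (intro weighted_diff weighted_single[where n = j]) simp_all
        moreover have s: "single 0 (lookup f v) \<in> weighted Q \<theta> {0}"
          by (intro weighted_single[where n = 0]) simp_all
        ultimately have tj: "t v \<in> weighted Q \<theta> {j}"
          unfolding t_def by (intro weighted_mult) auto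
        have "t v \<in> J"
          using J.I_l_closed[OF binom_J weighted_carrier[OF s], of v "w v"] k w(2)[OF v]
          by (simp add: t_def arrow_polys_simps)
        then have "?q (t v) = ?q 0"
          using coset_eq_iff[OF J, of "t v" 0] weighted_carrier[OF tj] zero_carrier by simp
        then have "h (?p (t v)) = \<zero>\<^bsub>?T\<^esub>" by (simp add: hp zeroJ)
        moreover have "?p (t v) \<in> piece ?S j" using tj by (simp add: semi_invariants_simps(2))
        ultimately show ?thesis using S.genideal_self[OF Hc] Wn[OF tj] by blast
      qed
      have "(\<Sum>v\<in>V. t v) \<in> ?W \<and> ?p (\<Sum>v\<in>V. t v) \<in> genideal ?S ?H"
        if "finite V" "V \<subseteq> keys f" for V
        using that
      proof (induction V rule: finite_induct)
        case empty
        then show ?case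
          using additive_subgroup.zero_closed[OF G.additive_subgroup_axioms] by (simp add: zero weighted_zero)
      next
        case (insert x V)
        then show ?case
          using G.a_closed[of "?p (t x)" "?p (sum t V)"] t[of x] by (simp add: pops(2) weighted_add)
      qed
      from this[of "keys f"] show ?thesis using w(1) f(2) by (simp add: t_def)
    qed
    show "\<exists>k\<in>(\<Union>n. piece ?S n) - P. k \<otimes>\<^bsub>?S\<^esub> a = \<zero>\<^bsub>?S\<^esub>"
      if P: "P \<in> proj_points ?S" and a: "a \<in> piece ?S n" "h a = \<zero>\<^bsub>?T\<^esub>" for P a n
    proof -
      interpret P: primeideal P ?S using P by (simp add: proj_points_def)
      have "\<not> (\<Union>n\<in>{0<..}. piece ?S n) \<subseteq> P" using P by (simp add: proj_points_def)
      then obtain m g where g: "m > 0" "g \<in> weighted Q \<theta> {m}" "?p g \<notin> P"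
        by (auto simp: semi_invariants_simps(2))
      let ?s = "\<lambda>u. single u (lookup g u)"
      have inc: "inc_exp Q u = (\<lambda>i. int m * \<theta> i)" "keys u \<subseteq> arrows Q"
        if "u \<in> keys g" for u
        using g that by (auto simp: weighted_def carrier_arrow_polys)
      have s: "?s u \<in> weighted Q \<theta> {m}" if "u \<in> keys g" for u
        using inc[OF that] by (intro weighted_single) auto
      \<comment> \<open>\<open>g\<close> is the sum of its terms and \<open>P\<close> is closed
        under addition, so some term avoids \<open>P\<close>. As \<open>P\<close> absorbs scalars,
        the monomial of that term avoids \<open>P\<close> as well.\<close>
      have "\<exists>u\<in>keys g. ?p (?s u) \<notin> P"
      proof (rule ccontr)
        assume "\<not> ?thesis"
        then have *: "\<And>u. u \<in> keys g \<Longrightarrow> ?p (?s u) \<in> P" by blast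
        have "sum ?s V \<in> ?W \<and> ?p (sum ?s V) \<in> P"
          if "finite V" "V \<subseteq> keys g" for V
          using that
        proof (induction V rule: finite_induct)
          case empty
          then show ?case
            using additive_subgroup.zero_closed[OF P.additive_subgroup_axioms] by (simp add: zero weighted_zero)
        next
          case (insert x V)
          then show ?case
            using P.a_closed[of "?p (?s x)" "?p (sum ?s V)"] Wn[OF s[of x]] *[of x]
            by (simp add: pops(2) weighted_add)
        qed
        from this[of "keys g"] show False using g(3) by (simp add: sum_single)
      qed
      then obtain u where u: "u \<in> keys g" "?p (?s u) \<notin> P" by blast
      have mu: "(monomial u :: ('a, 'k) mpoly) \<in> weighted Q \<theta> {m}"
        unfolding monomial_def using inc[OF u(1)] by (intro weighted_single) auto
      have c: "single 0 c \<in> ?W" for c :: 'k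
        by (intro weighted_single[where n = 0]) simp_all
      have pu: "?p (monomial u) \<notin> P"
      proof
        assume "?p (monomial u) \<in> P"
        then have "?p (single 0 (lookup g u)) \<otimes>\<^bsub>?S\<^esub> ?p (monomial u) \<in> P"
          by (rule P.I_l_closed) (use c in \<open>simp add: semi_invariants_simps(1)\<close>)
        then show False
          using u(2) pops(1)[OF c Wn[OF mu]] by (simp add: monomial_def mult_single)
      qed
      have pw: "(monomial u :: ('a, 'k) mpoly) ^ N \<in> weighted Q \<theta> {m * N} \<and> ?p (monomial u ^ N) \<notin> P" for N
      proof (induction N)
        case 0
        have "?p 1 \<notin> P"
        proof
          assume "?p 1 \<in> P"
          then have "P = carrier ?S" using P.one_imp_carrier one by simp
          then show False using P.I_notcarr by simp
        qed
        then show ?case using weighted_one by simp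
      next
        case (Suc N)
        have 1: "(monomial u :: ('a, 'k) mpoly) ^ Suc N \<in> weighted Q \<theta> {m * Suc N}"
          unfolding power_Suc using mu conjunct1[OF Suc] by (rule weighted_mult) simp
        have "?p (monomial u ^ Suc N) = ?p (monomial u) \<otimes>\<^bsub>?S\<^esub> ?p (monomial u ^ N)"
          using pops(1)[OF Wn[OF mu] Wn[OF conjunct1[OF Suc]]] by simp
        moreover have "?p (monomial u) \<in> carrier ?S" "?p (monomial u ^ N) \<in> carrier ?S"
          using Wn[OF mu] Wn[OF conjunct1[OF Suc]] by (simp_all add: semi_invariants_simps(1))
        ultimately have "?p (monomial u ^ Suc N) \<notin> P"
          using P.I_prime[of "?p (monomial u)" "?p (monomial u ^ N)"] pu conjunct2[OF Suc] by auto
        with 1 show ?case by blast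
      qed
      obtain f where f: "f \<in> weighted Q \<theta> {n}" "a = ?p f" using a by (auto simp: semi_invariants_simps(2))
      then have "f \<in> J" using in_J[OF Wn] a by blast
      then obtain w where w: "f = (\<Sum>v\<in>keys f.
            single 0 (lookup f v) * (monomial v - monomial (w v)))"
        "\<And>v. v \<in> keys f \<Longrightarrow> w v \<in> keys f \<and>
          inc_exp Q (w v) = inc_exp Q v \<and> div_exp Q (w v) = div_exp Q v"
        unfolding J_def by (rule ideal_I_Q_expand) blast
      have "\<exists>N. monomial u ^ N * (monomial v - monomial (w v)) \<in> I" if v: "v \<in> keys f" for v
      proof (rule kill)
        show "keys v \<subseteq> arrows Q" "keys (w v) \<subseteq> arrows Q"
          using v w(2)[OF v] weighted_carrier[OF f(1)] by (auto simp: carrier_arrow_polys)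
      qed (use inc[OF u(1)] g(1) w(2)[OF v] in auto)
      then obtain N where N: "\<And>v. v \<in> keys f \<Longrightarrow> monomial u ^ N v * (monomial v - monomial (w v)) \<in> I"
        by metis
      \<comment> \<open>\<open>kill\<close> gives one exponent for each monomial of
        \<open>f\<close>; their sum bounds them all, so a single power of \<open>monomial u\<close>
        works for \<open>f\<close>.\<close>
      define M where "M = (\<Sum>v\<in>keys f. N v)"
      have trm: "monomial u ^ M * (single 0 (lookup f v) * (monomial v - monomial (w v))) \<in> I"
        if v: "v \<in> keys f" for v
      proof -
        have "N v \<le> M" unfolding M_def using v by (intro member_le_sum) auto
        then have eq: "monomial u ^ M = monomial u ^ (M - N v) * monomial u ^ N v"
          by (simp flip: power_add)
        have "single 0 (lookup f v) * monomial u ^ (M - N v) \<in> carrier ?R"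
          using weighted_carrier[OF mult[OF c Wn[OF conjunct1[OF pw]]]] by blast
        from I.I_l_closed[OF N[OF v] this] show ?thesis
          by (simp add: eq arrow_polys_simps mult_ac)
      qed
      have "(\<Sum>v\<in>V. monomial u ^ M * (single 0 (lookup f v) * (monomial v - monomial (w v)))) \<in> I"
        if "finite V" "V \<subseteq> keys f" for V
        using that by (induction V rule: finite_induct) (simp_all add: zI Ic trm)
      from this[of "keys f"] have "monomial u ^ M * f \<in> I"
        using w(1) by (simp flip: sum_distrib_left)
      moreover have fM: "monomial u ^ M * f \<in> carrier ?R"
        using weighted_carrier[OF mult[OF Wn[OF conjunct1[OF pw]] Wn[OF f(1)]]] by blast
      ultimately have "?p (monomial u ^ M * f) = ?p 0"
        using coset_eq_iff[OF I, of "monomial u ^ M * f" 0] zero_carrier by simp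
      then have "?p (monomial u ^ M) \<otimes>\<^bsub>?S\<^esub> a = \<zero>\<^bsub>?S\<^esub>"
        using pops(1)[OF Wn[OF conjunct1[OF pw]] Wn[OF f(1)]] f(2) zero by simp
      moreover have "?p (monomial u ^ M) \<in> (\<Union>n. piece ?S n) - P"
        using pw[of M] by (auto simp: semi_invariants_simps(2))
      ultimately show ?thesis by blast
    qed
  qed
  then have "isomorphic_over_field (Proj ?S) (Proj ?T)" by (rule graded_surjection.isomorphic_Proj)
  then show ?thesis by (simp add: git_quotient_def J_def)
qed

section \<open>The path algebra\<close>

lemma additive_eqI:
  fixes F G :: "('b \<Rightarrow>\<^sub>0 'k::comm_ring_1) \<Rightarrow> 'c::ab_group_add"
  assumes F: "\<And>f g. F (f + g) = F f + F g" and G: "\<And>f g. G (f + g) = G f + G g"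
    and single: "\<And>p c. p \<in> keys f \<Longrightarrow> F (single p c) = G (single p c)"
  shows "F f = G f"
proof -
  have 0: "F 0 = 0" "G 0 = 0" using F[of 0 0] G[of 0 0] by simp_all
  have "F (\<Sum>p\<in>A. single p (lookup f p)) = G (\<Sum>p\<in>A. single p (lookup f p))"
    if "finite A" "A \<subseteq> keys f" for A
    using that by (induction A rule: finite_induct) (simp_all add: 0 F G single)
  from this[of "keys f"] show ?thesis by (simp add: sum_single)
qed

text \<open>The product of two basis paths, scaled by \<open>c\<close>. Keeping the scalar as an
  additive argument makes the bilinearity of \<open>path_mult\<close> an instance of
  \<open>setsum_keys_plus_distrib\<close>.\<close>

definition path_product :: "'a path \<Rightarrow> 'a path \<Rightarrow> 'k \<Rightarrow> ('a path \<Rightarrow>\<^sub>0 'k::field)" where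
  "path_product p q c = (if snd (snd p) = fst q
     then single (fst p, fst (snd p) @ fst (snd q), snd (snd q)) c else 0)"

lemma path_product_add: "path_product p q (c + d) = path_product p q c + path_product p q d"
  by (simp add: path_product_def single_add)

lemma path_product_zero [simp]: "path_product p q 0 = 0"
  by (simp add: path_product_def)

definition path_mult :: "('a path \<Rightarrow>\<^sub>0 'k::field) \<Rightarrow> ('a path \<Rightarrow>\<^sub>0 'k) \<Rightarrow> ('a path \<Rightarrow>\<^sub>0 'k)" where
  "path_mult f g = (\<Sum>p\<in>keys f. \<Sum>q\<in>keys g.
     path_product p q (lookup f p * lookup g q))"

lemma path_algebra_simps:
  "monoid.mult (path_algebra Q) = path_mult"
  "one (path_algebra Q) = (\<Sum>i\<in>verts Q. single (i, [], i) 1)"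
  "zero (path_algebra Q) = 0" "add (path_algebra Q) = (+)"
  "carrier (path_algebra Q) = {f. keys f \<subseteq> paths Q}"
  by (auto simp: path_algebra_def path_mult_def path_product_def fun_eq_iff split_beta
      intro!: sum.cong)

lemma path_mult_add_left: "path_mult (f + f') g = path_mult f g + path_mult f' g"
  unfolding path_mult_def
  by (rule setsum_keys_plus_distrib)
    (simp_all add: distrib_right path_product_add sum.distrib)

lemma path_mult_add_right: "path_mult f (g + g') = path_mult f g + path_mult f g'"
proof -
  have "(\<Sum>q\<in>keys (g + g'). path_product p q (c * lookup (g + g') q)) =
      (\<Sum>q\<in>keys g. path_product p q (c * lookup g q)) +
      (\<Sum>q\<in>keys g'. path_product p q (c * lookup g' q))" for p c
    by (rule setsum_keys_plus_distrib) (simp_all add: distrib_left path_product_add)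
  then show ?thesis unfolding path_mult_def by (simp add: sum.distrib)
qed

lemma path_mult_zero [simp]: "path_mult 0 g = 0" "path_mult f 0 = 0"
  by (simp_all add: path_mult_def)

lemma path_mult_single [simp]:
  "path_mult (single p c) (single q d) = path_product p q (c * d)"
  by (simp add: path_mult_def)

lemma path_mult_sum_left: "path_mult (\<Sum>x\<in>A. f x) g = (\<Sum>x\<in>A. path_mult (f x) g)"
  by (induction A rule: infinite_finite_induct) (simp_all add: path_mult_add_left)

lemma path_mult_sum_right: "path_mult g (\<Sum>x\<in>A. f x) = (\<Sum>x\<in>A. path_mult g (f x))"
  by (induction A rule: infinite_finite_induct) (simp_all add: path_mult_add_right)

lemma path_mult_assoc:
  fixes f g h :: "'b path \<Rightarrow>\<^sub>0 'c::field"
  shows "path_mult (path_mult f g) h = path_mult f (path_mult g h)"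
proof -
  have 1: "path_mult (path_mult (single p b) (single q c)) (single r d) =
      path_mult (single p b) (path_mult (single q c) (single r d))"
    for p q r :: "'b path" and b c d :: 'c
    by (auto simp: path_product_def mult.assoc)
  have 2: "path_mult (path_mult (single p b) (single q c)) h =
      path_mult (single p b) (path_mult (single q c) h)" for p q b c
    by (rule additive_eqI) (simp_all only: path_mult_add_left path_mult_add_right 1)
  have 3: "path_mult (path_mult (single p b) g) h =
      path_mult (single p b) (path_mult g h)" for p b
    by (rule additive_eqI[where F = "\<lambda>g. path_mult (path_mult (single p b) g) h"])
      (simp_all only: path_mult_add_left path_mult_add_right 2)
  show ?thesis
    by (rule additive_eqI[where F = "\<lambda>f. path_mult (path_mult f g) h"])
      (simp_all only: path_mult_add_left path_mult_add_right 3)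
qed

lemma walk_append: "walk Q i as j \<Longrightarrow> walk Q j bs k \<Longrightarrow> walk Q i (as @ bs) k"
  by (induction as arbitrary: i) auto

lemma walk_verts: "walk Q i as j \<Longrightarrow> i \<in> verts Q \<and> j \<in> verts Q"
  by (induction as arbitrary: i) auto

lemma walk_arrows: "walk Q i as j \<Longrightarrow> set as \<subseteq> arrows Q"
  by (induction as arbitrary: i) auto

lemma path_product_paths:
  assumes "p \<in> paths Q" "q \<in> paths Q"
  shows "keys (path_product p q c) \<subseteq> paths Q"
  using assms by (auto simp: path_product_def paths_def walk_append split: if_splits)

lemma path_mult_paths:
  assumes "keys f \<subseteq> paths Q" "keys g \<subseteq> paths Q"
  shows "keys (path_mult f g) \<subseteq> paths Q"
proof -
  have "keys (path_mult f g) \<subseteq>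
      (\<Union>p\<in>keys f. \<Union>q\<in>keys g.
        keys (path_product p q (lookup f p * lookup g q)))"
    unfolding path_mult_def by (intro order_trans[OF keys_sum] UN_mono order_refl keys_sum)
  also have "\<dots> \<subseteq> paths Q" using assms path_product_paths by blast
  finally show ?thesis .
qed

lemma path_mult_one:
  fixes f :: "'a path \<Rightarrow>\<^sub>0 'k::field"
  assumes fin: "finite (verts Q)" and f: "keys f \<subseteq> paths Q"
  shows "path_mult (\<Sum>i\<in>verts Q. single (i, [], i) 1) f = f"
    and "path_mult f (\<Sum>i\<in>verts Q. single (i, [], i) 1) = f"
proof -
  have v: "fst p \<in> verts Q" "snd (snd p) \<in> verts Q" if "p \<in> keys f" for p
  proof -
    have "walk Q (fst p) (fst (snd p)) (snd (snd p))" using that f by (auto simp: paths_def)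
    from walk_verts[OF this] show "fst p \<in> verts Q" "snd (snd p) \<in> verts Q" by auto
  qed
  show "path_mult (\<Sum>i\<in>verts Q. single (i, [], i) 1) f = f"
  proof (rule additive_eqI[where G = "\<lambda>f. f"])
    fix p and c :: 'k assume p: "p \<in> keys f"
    have "path_mult (\<Sum>i\<in>verts Q. single (i, [], i) 1) (single p c) =
        (\<Sum>i\<in>verts Q. if i = fst p then single p c else 0)"
      unfolding path_mult_sum_left by (intro sum.cong refl) (simp add: path_product_def)
    then show "path_mult (\<Sum>i\<in>verts Q. single (i, [], i) 1) (single p c) = single p c"
      using fin v(1)[OF p] by simp
  qed (simp_all add: path_mult_add_right)
  show "path_mult f (\<Sum>i\<in>verts Q. single (i, [], i) 1) = f"
  proof (rule additive_eqI[where G = "\<lambda>f. f"])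
    fix p and c :: 'k assume p: "p \<in> keys f"
    have "path_mult (single p c) (\<Sum>i\<in>verts Q. single (i, [], i) 1) =
        (\<Sum>i\<in>verts Q. if i = snd (snd p) then single p c else 0)"
      unfolding path_mult_sum_right by (intro sum.cong refl) (auto simp add: path_product_def)
    then show "path_mult (single p c) (\<Sum>i\<in>verts Q. single (i, [], i) 1) = single p c"
      using fin v(2)[OF p] by simp
  qed (simp_all add: path_mult_add_left)
qed

lemma ring_path_algebra:
  assumes fin: "finite (verts Q)"
  shows "ring (path_algebra Q :: ('a path \<Rightarrow>\<^sub>0 'k::field) ring)"
proof (rule ringI)
  let ?A = "path_algebra Q :: ('a path \<Rightarrow>\<^sub>0 'k::field) ring"
  show "abelian_group ?A"
  proof (rule abelian_groupI; unfold path_algebra_simps mem_Collect_eq)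
    fix x y :: "'a path \<Rightarrow>\<^sub>0 'k" assume "keys x \<subseteq> paths Q" "keys y \<subseteq> paths Q"
    then show "keys (x + y) \<subseteq> paths Q" using keys_add[of x y] by blast
  next
    fix x :: "'a path \<Rightarrow>\<^sub>0 'k" assume "keys x \<subseteq> paths Q"
    then show "\<exists>y\<in>{f. keys f \<subseteq> paths Q}. y + x = 0" by (intro bexI[of _ "- x"]) simp_all
  qed (simp_all add: algebra_simps)
  show "Group.monoid ?A"
  proof (rule monoidI; unfold path_algebra_simps mem_Collect_eq)
    show "keys (\<Sum>i\<in>verts Q. single (i, [], i) (1::'k)) \<subseteq> paths Q"
      by (rule order_trans[OF keys_sum]) (auto simp: paths_def)
  qed (simp_all add: path_mult_paths path_mult_assoc path_mult_one[OF fin])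
qed (simp_all add: path_algebra_simps path_mult_add_left path_mult_add_right)

lemma a_inv_path_algebra:
  assumes "finite (verts Q)" "f \<in> carrier (path_algebra Q :: ('a path \<Rightarrow>\<^sub>0 'k::field) ring)"
  shows "\<ominus>\<^bsub>path_algebra Q\<^esub> f = - f"
proof -
  interpret ring "path_algebra Q :: ('a path \<Rightarrow>\<^sub>0 'k) ring" by (rule ring_path_algebra) fact
  have "- f \<in> carrier (path_algebra Q)" using assms by (simp add: path_algebra_simps)
  then show ?thesis using assms by (intro minus_equality) (simp_all add: path_algebra_simps)
qed

lemma lin_path_product:
  "lin F (path_product p q c) =
    c * (if snd (snd p) = fst q then F (fst p, fst (snd p) @ fst (snd q), snd (snd q)) else 0)"
  by (simp add: path_product_def)

lemma lin_path_mult: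
  "lin F (path_mult f g) = (\<Sum>p\<in>keys f. lookup f p *
     lin (\<lambda>q. if snd (snd p) = fst q then F (fst p, fst (snd p) @ fst (snd q), snd (snd q)) else 0) g)"
  "lin F (path_mult f g) = (\<Sum>q\<in>keys g. lookup g q *
     lin (\<lambda>p. if snd (snd p) = fst q then F (fst p, fst (snd p) @ fst (snd q), snd (snd q)) else 0) f)"
proof -
  have *: "lin F (path_mult f g) = (\<Sum>p\<in>keys f. \<Sum>q\<in>keys g.
      lookup f p * lookup g q *
      (if snd (snd p) = fst q then F (fst p, fst (snd p) @ fst (snd q), snd (snd q)) else 0))"
    unfolding path_mult_def lin_sum lin_path_product ..
  then show "lin F (path_mult f g) = (\<Sum>p\<in>keys f. lookup f p *
     lin (\<lambda>q. if snd (snd p) = fst q then F (fst p, fst (snd p) @ fst (snd q), snd (snd q)) else 0) g)"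
    by (simp add: lin_def sum_distrib_left mult.assoc)
  show "lin F (path_mult f g) = (\<Sum>q\<in>keys g. lookup g q *
     lin (\<lambda>p. if snd (snd p) = fst q then F (fst p, fst (snd p) @ fst (snd q), snd (snd q)) else 0) f)"
    unfolding * by (subst sum.swap) (simp add: lin_def sum_distrib_left mult_ac)
qed

definition path_class :: "'a quiver \<Rightarrow> 'a path \<Rightarrow> nat \<times> nat \<times> (nat \<Rightarrow> nat)" where
  "path_class Q p = (fst p, snd (snd p), div_path Q p)"

lemma div_path_append:
  "div_path Q (i, as @ bs, k) = (\<lambda>\<rho>. div_path Q (i', as, j') \<rho> + div_path Q (j'', bs, k'') \<rho>)"
  by (simp add: div_path_def)

text \<open>\<open>ideal_I_R\<close> takes every difference of paths that lies in the two-sided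
  ideal, not only the generators. The elements annihilated by all functionals of the path class form
  a two-sided ideal, because concatenation on either side acts on classes. The indicator of one
  class then separates paths of different classes.\<close>

lemma relations_same_class:
  assumes fin: "finite (verts Q)"
    and rel: "single p (1::'k::field) - single q 1 \<in> relations Q"
  shows "path_class Q p = path_class Q q"
proof -
  let ?A = "path_algebra Q :: ('a path \<Rightarrow>\<^sub>0 'k::field) ring"
  interpret A: ring ?A by (rule ring_path_algebra[OF fin])
  define K where "K = {f \<in> carrier ?A. \<forall>G. lin (\<lambda>p. G (path_class Q p)) f = 0}"
  have K: "lin (\<lambda>p. G (path_class Q p)) f = 0" if "f \<in> K" for f G using that by (simp add: K_def)
  have left: "path_mult g f \<in> K" if f: "f \<in> K" and g: "g \<in> carrier ?A" for f g
  proof -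
    have "lin (\<lambda>q. if snd (snd p) = fst q
        then G (path_class Q (fst p, fst (snd p) @ fst (snd q), snd (snd q))) else 0) f = 0" for G p
    proof -
      define G' where "G' = (\<lambda>(i, j, d). if snd (snd p) = i
        then G (fst p, j, \<lambda>\<rho>. div_path Q p \<rho> + d \<rho>) else 0)"
      have "(\<lambda>q. if snd (snd p) = fst q
        then G (path_class Q (fst p, fst (snd p) @ fst (snd q), snd (snd q))) else 0) =
        (\<lambda>q. G' (path_class Q q))"
        by (auto simp: G'_def path_class_def div_path_def split_beta fun_eq_iff)
      then show ?thesis using K[OF f, of G'] by simp
    qed
    moreover have "path_mult g f \<in> carrier ?A"
      using A.m_closed[OF g, of f] f by (simp add: K_def path_algebra_simps)
    ultimately show ?thesis by (simp add: K_def lin_path_mult(1))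
  qed
  have right: "path_mult f g \<in> K" if f: "f \<in> K" and g: "g \<in> carrier ?A" for f g
  proof -
    have "lin (\<lambda>p. if snd (snd p) = fst q
        then G (path_class Q (fst p, fst (snd p) @ fst (snd q), snd (snd q))) else 0) f = 0" for G q
    proof -
      define G' where "G' = (\<lambda>(i, j, d). if j = fst q
        then G (i, snd (snd q), \<lambda>\<rho>. d \<rho> + div_path Q q \<rho>) else 0)"
      have "(\<lambda>p. if snd (snd p) = fst q
        then G (path_class Q (fst p, fst (snd p) @ fst (snd q), snd (snd q))) else 0) =
        (\<lambda>p. G' (path_class Q p))"
        by (auto simp: G'_def path_class_def div_path_def split_beta fun_eq_iff)
      then show ?thesis using K[OF f, of G'] by simp
    qed
    moreover have "path_mult f g \<in> carrier ?A"
      using A.m_closed[of f g] f g by (simp add: K_def path_algebra_simps)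
    ultimately show ?thesis by (simp add: K_def lin_path_mult(2))
  qed
  have idK: "ideal K ?A"
  proof (rule idealI)
    show "ring ?A" by (rule A.ring_axioms)
    show "subgroup K (add_monoid ?A)"
    proof (rule A.add.subgroupI)
      show "K \<subseteq> carrier ?A" by (auto simp: K_def)
      have "0 \<in> K" by (simp add: K_def path_algebra_simps)
      then show "K \<noteq> {}" by blast
      show "\<ominus>\<^bsub>?A\<^esub> x \<in> K" if "x \<in> K" for x
        using that A.a_inv_closed[of x] by (simp add: K_def a_inv_path_algebra[OF fin] lin_uminus)
      show "x \<oplus>\<^bsub>?A\<^esub> y \<in> K" if "x \<in> K" "y \<in> K" for x y
        using that A.a_closed[of x y] by (simp add: K_def path_algebra_simps lin_add)
    qed
  qed (simp_all add: path_algebra_simps left right)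
  have diff: "lin F (single p 1 - single q 1) = F p - F q"
    for F :: "'a path \<Rightarrow> 'k" and p q
    using lin_add[of F "single p 1" "- single q 1"] by (simp add: lin_uminus)
  have "relations Q \<subseteq> K"
    unfolding relations_def
  proof (rule A.genideal_minimal[OF idK], safe)
    fix i j as bs assume p: "(i, as, j) \<in> paths Q" "(i, bs, j) \<in> paths Q"
      and d: "div_path Q (i, as, j) = div_path Q (i, bs, j)"
    have "single (i, as, j) 1 - single (i, bs, j) 1 \<in> carrier ?A"
      using p keys_diff[of "single (i, as, j) (1::'k)" "single (i, bs, j) 1"]
      by (auto simp: path_algebra_simps)
    then show "single (i, as, j) 1 - single (i, bs, j) 1 \<in> K"
      using d by (simp add: K_def diff path_class_def)
  qed
  then have "lin (\<lambda>p'. if path_class Q p' = path_class Q p then 1 else 0)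
      (single p (1::'k) - single q 1) = 0"
    using rel K[of _ "\<lambda>c. if c = path_class Q p then 1 else 0"] by blast
  then show ?thesis unfolding diff by (simp split: if_splits)
qed

section \<open>From paths to monomials\<close>

lemma path_exp_simps:
  "path_exp (i, [], j) = 0"
  "path_exp (i, a # as, j) = single a 1 + path_exp (i', as, j)"
  "path_exp (i, as @ bs, j) = path_exp (i, as, j') + path_exp (i', bs, j)"
  by (simp_all add: path_exp_def)

lemma keys_path_exp: "keys (path_exp (i, as, j)) = set as"
  by (induction as) (auto simp: path_exp_simps keys_add_nat path_exp_simps(2)[of i _ _ j i])

lemma div_exp_single: "div_exp Q (single a (Suc 0)) = label Q a"
  by (simp add: div_exp_def)

lemma inc_exp_single:
  "inc_exp Q (single a (Suc 0)) = (\<lambda>i. of_bool (i = head Q a) - of_bool (i = tail Q a))"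
  by (simp add: inc_exp_def)

lemma div_path_exp: "div_exp Q (path_exp (i, as, j)) = div_path Q (i, as, j)"
  by (induction as)
    (simp_all add: path_exp_simps path_exp_simps(2)[of i _ _ j i] div_exp_add div_exp_single div_path_def fun_eq_iff)

lemma inc_path_exp:
  "walk Q i as j \<Longrightarrow> inc_exp Q (path_exp (i, as, j)) = (\<lambda>k. of_bool (k = j) - of_bool (k = i))"
proof (induction as arbitrary: i)
  case (Cons a as)
  then show ?case
    by (auto simp: path_exp_simps(2)[of i a as j "head Q a"] inc_exp_add inc_exp_single fun_eq_iff)
qed (auto simp: path_exp_simps)

lemma ideal_I_R_ideal: "ideal (ideal_I_R Q) (arrow_polys Q :: ('a, 'k::field) mpoly ring)"
proof -
  interpret R: cring "arrow_polys Q :: ('a, 'k) mpoly ring" by (rule cring_arrow_polys)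
  have "monomial (path_exp p) - monomial (path_exp q) \<in> carrier (arrow_polys Q)"
    if "p \<in> paths Q" "q \<in> paths Q" for p q
    using that walk_arrows
    by (cases p; cases q) (intro binomial_in_carrier; simp add: keys_path_exp paths_def)
  then show ?thesis unfolding ideal_I_R_def by (intro R.genideal_ideal) auto
qed

text \<open>\<open>inc_exp\<close> of a path depends only on its ends and \<open>div_exp\<close> is
  its divisor, so by \<open>relations_same_class\<close> each generator of \<open>ideal_I_R\<close>
  is one of \<open>ideal_I_Q\<close>.\<close>

lemma ideal_I_R_subset_ideal_I_Q:
  assumes fin: "finite (verts Q)"
  shows "ideal_I_R Q \<subseteq> (ideal_I_Q Q :: ('a, 'k::field) mpoly set)"
proof -
  let ?R = "arrow_polys Q :: ('a, 'k) mpoly ring"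
  interpret R: cring ?R by (rule cring_arrow_polys)
  show ?thesis unfolding ideal_I_R_def
  proof (rule R.genideal_minimal[OF ideal_I_Q_ideal], safe)
    fix i as j i' bs j'
    assume p: "(i, as, j) \<in> paths Q" "(i', bs, j') \<in> paths Q"
      and "single (i, as, j) (1::'k) - single (i', bs, j') 1 \<in> relations Q"
    then have c: "path_class Q (i, as, j) = path_class Q (i', bs, j')"
      by (intro relations_same_class[OF fin])
    then have "monomial (path_exp (i, as, j)) - monomial (path_exp (i', bs, j')) \<in>
      {monomial u - monomial v | u v.
        keys u \<subseteq> arrows Q \<and> keys v \<subseteq> arrows Q \<and>
        inc_exp Q u = inc_exp Q v \<and> div_exp Q u = div_exp Q v}"
    proof -
      have w: "walk Q i as j" "walk Q i' bs j'" using p by (simp_all add: paths_def)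
      have "keys (path_exp (i, as, j)) \<subseteq> arrows Q"
        "keys (path_exp (i', bs, j')) \<subseteq> arrows Q"
        using walk_arrows[OF w(1)] walk_arrows[OF w(2)] by (simp_all add: keys_path_exp)
      moreover have "inc_exp Q (path_exp (i, as, j)) = inc_exp Q (path_exp (i', bs, j'))"
        "div_exp Q (path_exp (i, as, j)) = div_exp Q (path_exp (i', bs, j'))"
        using c inc_path_exp[OF w(1)] inc_path_exp[OF w(2)] by (auto simp: path_class_def div_path_exp)
      ultimately show ?thesis by blast
    qed
    then show "monomial (path_exp (i, as, j)) - monomial (path_exp (i', bs, j')) \<in> ideal_I_Q Q"
      unfolding ideal_I_Q_def genideal_def by blast
  qed
qed

lemma path_relation:
  assumes "walk Q i as j" "walk Q i bs j" "div_path Q (i, as, j) = div_path Q (i, bs, j)"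
  shows "monomial (path_exp (i, as, j)) - monomial (path_exp (i, bs, j)) \<in> (ideal_I_R Q :: ('a, 'k::field) mpoly set)"
proof -
  have "single (i, as, j) (1::'k) - single (i, bs, j) 1 \<in> relations Q"
    unfolding relations_def genideal_def using assms by (fastforce simp: paths_def)
  then show ?thesis
    unfolding ideal_I_R_def genideal_def using assms by (fastforce simp: paths_def)
qed

section \<open>Divisor sequences and congruences of exponents\<close>

text \<open>\<open>continuant b s\<close> is zero up to the ray \<open>s\<close> and continues from there as the linear function
  that vanishes on the ray \<open>s\<close> and is \<open>1\<close> on the next one. By the symmetry of continuants, the
  same is true of \<open>\<lambda>t. continuant b t s\<close> with the order of the rays reversed.\<close>

fun continuant :: "(nat \<Rightarrow> int) \<Rightarrow> nat \<Rightarrow> nat \<Rightarrow> int" where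
  "continuant b s 0 = 0"
| "continuant b s (Suc 0) = (if s = 0 then 1 else 0)"
| "continuant b s (Suc (Suc t)) =
    (if Suc (Suc t) \<le> s then 0 else if Suc t = s then 1
     else b (Suc t) * continuant b s (Suc t) - continuant b s t)"

lemma continuant_le [simp]: "t \<le> s \<Longrightarrow> continuant b s t = 0"
  by (cases "(b, s, t)" rule: continuant.cases) auto

lemma continuant_Suc [simp]: "continuant b s (Suc s) = 1"
  by (cases s) auto

lemma continuant_rec: "s < t \<Longrightarrow> continuant b s (Suc t) = b t * continuant b s t - continuant b s (t - 1)"
  by (cases t) auto

lemma continuant_diff_right:
  assumes "1 \<le> t"
  shows "continuant b s (t - 1) - b t * continuant b s t + continuant b s (t + 1) = of_bool (t = s)"
proof -
  consider "t < s" | "t = s" | "s < t" by linarith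
  then show ?thesis using assms by cases (simp_all add: continuant_rec)
qed

text \<open>The recursion in the second argument holds by definition; this is the one in the first.
  For \<open>j\<close> at least \<open>t + 3\<close> the three continuants obey the same recursion
  in \<open>j\<close>, so their combination is again a combination of its values at
  \<open>j - 1\<close> and \<open>j - 2\<close>, both zero by induction. The cases near the diagonal
  are computed.\<close>

lemma continuant_diff_left:
  assumes "1 \<le> t"
  shows "continuant b (t - 1) j - b t * continuant b t j + continuant b (t + 1) j = of_bool (t = j)"
proof (induction j rule: less_induct)
  case (less j)
  consider "j < t" | "j = t" | "j = t + 1" | "j = t + 2" | "t + 3 \<le> j" by linarith
  then show ?case
  proof cases
    case 1
    then show ?thesis by simp
  next
    case 2
    obtain s where "t = Suc s" using assms by (cases t) auto
    then show ?thesis using 2 by simp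
  next
    case 3
    obtain s where "t = Suc s" using assms by (cases t) auto
    then show ?thesis using 3 by simp
  next
    case 4
    obtain s where "t = Suc s" using assms by (cases t) auto
    then show ?thesis using 4 by simp
  next
    case 5
    then obtain k where k: "j = Suc k" "t + 2 \<le> k" by (cases j) auto
    have eq: "continuant b s j = b k * continuant b s k - continuant b s (k - 1)" if "s \<le> t + 1" for s
      using k that by (simp add: continuant_rec)
    then have "continuant b (t - 1) j - b t * continuant b t j + continuant b (t + 1) j =
        b k * (continuant b (t - 1) k - b t * continuant b t k + continuant b (t + 1) k) -
        (continuant b (t - 1) (k - 1) - b t * continuant b t (k - 1) + continuant b (t + 1) (k - 1))"
    proof -
      have "continuant b (t - 1) j = b k * continuant b (t - 1) k - continuant b (t - 1) (k - 1)"
        "continuant b t j = b k * continuant b t k - continuant b t (k - 1)"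
        "continuant b (t + 1) j = b k * continuant b (t + 1) k - continuant b (t + 1) (k - 1)"
        by (rule eq, simp)+
      then show ?thesis by (simp only:) (simp add: algebra_simps)
    qed
    also have "\<dots> = 0"
    proof -
      have "k < j" "k - 1 < j" "t \<noteq> k" "t \<noteq> k - 1" using k by auto
      then show ?thesis using less[of k] less[of "k - 1"] by (simp only: of_bool_eq)
    qed
    finally show ?thesis using 5 by simp
  qed
qed

text \<open>When \<open>b k\<close> is minus the self-intersection of the exceptional curve D_k,
  this is the intersection number of the divisor \<open>h\<close> with D_k.\<close>

definition second_diff :: "(nat \<Rightarrow> int) \<Rightarrow> (nat \<Rightarrow> int) \<Rightarrow> nat \<Rightarrow> int" where
  "second_diff b h k = h (k - 1) - b k * h k + h (k + 1)"

lemma second_diff_add: "second_diff b (\<lambda>\<rho>. h \<rho> + g \<rho>) k = second_diff b h k + second_diff b g k"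
  by (simp add: second_diff_def algebra_simps)

lemma second_diff_minus: "second_diff b (\<lambda>\<rho>. h \<rho> - g \<rho>) k = second_diff b h k - second_diff b g k"
  by (simp add: second_diff_def algebra_simps)

text \<open>Where \<open>h k\<close> is nonnegative, \<open>b k >= 2\<close> turns the recursion
  into \<open>h (k + 1) - h k >= h k - h (k - 1)\<close>, so a nonnegative nondecreasing start
  propagates. \<open>grows_left\<close> is the mirror image.\<close>

lemma grows_right:
  assumes b: "\<And>k. k \<in> {s<..l} \<Longrightarrow> 2 \<le> b k" and h: "\<And>k. k \<in> {s<..l} \<Longrightarrow> second_diff b h k = 0"
    and s: "0 \<le> h s" "h s \<le> h (Suc s)" and t: "s \<le> t" "t \<le> l"
  shows "0 \<le> h t \<and> h t \<le> h (Suc t)"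
  using t
proof (induction t rule: dec_induct)
  case base
  then show ?case using s by simp
next
  case (step n)
  have "2 * h (Suc n) \<le> b (Suc n) * h (Suc n)"
    using step b[of "Suc n"] by (intro mult_right_mono) auto
  then show ?case using step h[of "Suc n"] by (simp add: second_diff_def)
qed

lemma grows_left:
  assumes b: "\<And>k. k \<in> {1..s} \<Longrightarrow> 2 \<le> b k" and h: "\<And>k. k \<in> {1..s} \<Longrightarrow> second_diff b h k = 0"
    and s: "0 \<le> h (Suc s)" "h (Suc s) \<le> h s" and t: "t \<le> s"
  shows "0 \<le> h (Suc t) \<and> h (Suc t) \<le> h t"
  using t
proof (induction t rule: inc_induct)
  case base
  then show ?case using s by simp
next
  case (step n)
  have "2 * h (Suc n) \<le> b (Suc n) * h (Suc n)"
    using step b[of "Suc n"] by (intro mult_right_mono) auto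
  then show ?case using step h[of "Suc n"] by (simp add: second_diff_def)
qed

text \<open>Divisors of sections of the line bundle \<open>L\<^sub>j \<otimes> L\<^sub>i\<inverse>\<close>, where \<open>b k\<close> is minus the
  self-intersection of the \<open>k\<close>th exceptional curve; both \<open>0\<close> and \<open>l + 1\<close> stand for the
  trivial bundle.\<close>

definition hom_divisors :: "(nat \<Rightarrow> int) \<Rightarrow> nat \<Rightarrow> nat \<Rightarrow> nat \<Rightarrow> (nat \<Rightarrow> int) set" where
  "hom_divisors b l i j = {h. (\<forall>\<rho>\<le>l + 1. 0 \<le> h \<rho>) \<and>
     (\<forall>k\<in>{1..l}. second_diff b h k = of_bool (k = j) - of_bool (k = i))}"

lemma hom_divisors_nonneg: "h \<in> hom_divisors b l i j \<Longrightarrow> \<rho> \<le> l + 1 \<Longrightarrow> 0 \<le> h \<rho>"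
  by (simp add: hom_divisors_def)

lemma hom_divisors_add:
  "h \<in> hom_divisors b l i j \<Longrightarrow> g \<in> hom_divisors b l j k \<Longrightarrow> (\<lambda>\<rho>. h \<rho> + g \<rho>) \<in> hom_divisors b l i k"
  by (simp add: hom_divisors_def second_diff_add)

lemma hom_divisors_zero: "(\<lambda>\<rho>. 0) \<in> hom_divisors b l i i"
  by (simp add: hom_divisors_def second_diff_def)

text \<open>The relations of \<open>ideal_I_R\<close> on the level of exponent vectors. The chart
  argument takes place in this additive monoid; \<open>path_cong_ideal\<close> leads back to
  polynomials.\<close>

inductive path_cong :: "'a quiver \<Rightarrow> ('a \<Rightarrow>\<^sub>0 nat) \<Rightarrow> ('a \<Rightarrow>\<^sub>0 nat) \<Rightarrow> bool" for Q where
  path_cong_refl: "path_cong Q u u"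
| path_cong_sym: "path_cong Q u v \<Longrightarrow> path_cong Q v u"
| path_cong_trans: "path_cong Q u v \<Longrightarrow> path_cong Q v w \<Longrightarrow> path_cong Q u w"
| path_cong_add: "path_cong Q u v \<Longrightarrow> path_cong Q (u + w) (v + w)"
| path_cong_path: "walk Q i as j \<Longrightarrow> walk Q i bs j \<Longrightarrow> div_path Q (i, as, j) = div_path Q (i, bs, j) \<Longrightarrow>
    path_cong Q (path_exp (i, as, j)) (path_exp (i, bs, j))"

text \<open>The equivalence of supports is carried through the induction because, in the case of
  transitivity, the middle exponent must be supported on arrows before the two binomials can be
  added.\<close>

lemma path_cong_ideal:
  assumes "path_cong Q u v"
  shows "(keys u \<subseteq> arrows Q \<longleftrightarrow> keys v \<subseteq> arrows Q) \<and>
    (keys u \<subseteq> arrows Q \<longrightarrow>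
      monomial u - monomial v \<in> (ideal_I_R Q :: ('a, 'k::field) mpoly set))"
proof -
  let ?R = "arrow_polys Q :: ('a, 'k) mpoly ring" let ?I = "ideal_I_R Q :: ('a, 'k) mpoly set"
  interpret R: cring ?R by (rule cring_arrow_polys)
  interpret I: ideal ?I ?R by (rule ideal_I_R_ideal)
  have add: "x + y \<in> ?I" if "x \<in> ?I" "y \<in> ?I" for x y
    using I.a_closed[OF that] by (simp add: arrow_polys_simps)
  have neg: "- x \<in> ?I" if "x \<in> ?I" for x
    using I.a_inv_closed[OF that] I.a_Hcarr[OF that] by (simp add: a_inv_arrow_polys)
  from assms show ?thesis
  proof induction
    case (path_cong_refl u)
    then show ?case using additive_subgroup.zero_closed[OF I.additive_subgroup_axioms]
      by (simp add: arrow_polys_simps)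
  next
    case (path_cong_sym u v)
    then show ?case using neg[of "monomial u - monomial v"] by auto
  next
    case (path_cong_trans u v w)
    then show ?case using add[of "monomial u - monomial v" "monomial v - monomial w"] by auto
  next
    case (path_cong_add u v w)
    have "monomial (u + w) - monomial (v + w :: 'a \<Rightarrow>\<^sub>0 nat) = (monomial w * (monomial u - monomial v) :: ('a, 'k) mpoly)"
      by (simp add: right_diff_distrib monomial_mult add.commute)
    moreover have "(monomial w * (monomial u - monomial v) :: ('a, 'k) mpoly) \<in> ?I"
      if "keys w \<subseteq> arrows Q" "monomial u - monomial v \<in> ?I"
      using I.I_l_closed[OF that(2), of "monomial w"] that(1)
      by (simp add: arrow_polys_simps carrier_arrow_polys monomial_def)
    ultimately show ?case using path_cong_add.IH unfolding keys_add_nat by auto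
  next
    case (path_cong_path i as j bs)
    then show ?case
      using path_relation[OF path_cong_path.hyps] walk_arrows[OF path_cong_path.hyps(1)] walk_arrows[OF path_cong_path.hyps(2)]
      by (simp add: keys_path_exp)
  qed
qed

section \<open>Localization of the monoid of exponents\<close>

primrec rep :: "nat \<Rightarrow> 'm::comm_monoid_add \<Rightarrow> 'm" where
  "rep 0 u = 0"
| "rep (Suc n) u = u + rep n u"

lemma rep_add: "rep (m + n) u = rep m u + rep n u"
  by (induction m) (simp_all add: add.assoc)

lemma rep_sum: "rep (\<Sum>x\<in>A. n x) u = (\<Sum>x\<in>A. rep (n x) u)"
  by (induction A rule: infinite_finite_induct) (simp_all add: rep_add)

lemma monomial_rep: "monomial (rep n u) = monomial u ^ n"
  by (induction n) (simp_all add: monomial_mult[symmetric], simp add: monomial_def)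

text \<open>Congruence and divisibility after inverting the arrows in the support of \<open>U\<close>.\<close>

definition local_cong :: "'a quiver \<Rightarrow> ('a \<Rightarrow>\<^sub>0 nat) \<Rightarrow> ('a \<Rightarrow>\<^sub>0 nat) \<Rightarrow> ('a \<Rightarrow>\<^sub>0 nat) \<Rightarrow> bool" where
  "local_cong Q U u v \<longleftrightarrow> (\<exists>N. path_cong Q (u + rep N U) (v + rep N U))"

definition local_unit :: "'a quiver \<Rightarrow> ('a \<Rightarrow>\<^sub>0 nat) \<Rightarrow> ('a \<Rightarrow>\<^sub>0 nat) \<Rightarrow> bool" where
  "local_unit Q U e \<longleftrightarrow> (\<exists>e' N. path_cong Q (e + e') (rep N U))"

lemma local_congI: "path_cong Q u v \<Longrightarrow> local_cong Q U u v"
  unfolding local_cong_def using path_cong_add by blast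

lemma local_cong_refl: "local_cong Q U u u"
  by (rule local_congI) (rule path_cong_refl)

lemma local_cong_sym: "local_cong Q U u v \<Longrightarrow> local_cong Q U v u"
  unfolding local_cong_def using path_cong_sym by blast

lemma path_cong_add2:
  assumes "path_cong Q u v" "path_cong Q u' v'"
  shows "path_cong Q (u + u') (v + v')"
proof -
  have "path_cong Q (v + u') (v + v')"
    using path_cong_add[OF assms(2), of v] by (simp add: add.commute)
  with path_cong_add[OF assms(1), of u'] show ?thesis by (rule path_cong_trans)
qed

lemma local_cong_trans [trans]:
  assumes "local_cong Q U u v" "local_cong Q U v w"
  shows "local_cong Q U u w"
proof -
  obtain M N where MN: "path_cong Q (u + rep M U) (v + rep M U)" "path_cong Q (v + rep N U) (w + rep N U)"
    using assms by (auto simp: local_cong_def)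
  have "path_cong Q (u + rep (M + N) U) (v + rep (M + N) U)"
    using path_cong_add[OF MN(1), of "rep N U"] by (simp add: rep_add add.assoc)
  moreover have "path_cong Q (v + rep (M + N) U) (w + rep (M + N) U)"
    using path_cong_add[OF MN(2), of "rep M U"] by (simp add: rep_add ac_simps)
  ultimately show ?thesis unfolding local_cong_def using path_cong_trans by blast
qed

lemma local_cong_add:
  assumes "local_cong Q U u v" "local_cong Q U u' v'"
  shows "local_cong Q U (u + u') (v + v')"
proof -
  obtain M N where "path_cong Q (u + rep M U) (v + rep M U)" "path_cong Q (u' + rep N U) (v' + rep N U)"
    using assms by (auto simp: local_cong_def)
  from path_cong_add2[OF this] have "path_cong Q (u + u' + rep (M + N) U) (v + v' + rep (M + N) U)"
    by (simp add: rep_add ac_simps)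
  then show ?thesis by (auto simp: local_cong_def)
qed

text \<open>Adding the partner \<open>e'\<close> turns \<open>e\<close> into a multiple of
  \<open>U\<close>, which \<open>local_cong\<close> absorbs.\<close>

lemma local_cong_cancel:
  assumes e: "local_unit Q U e" and uv: "local_cong Q U (u + e) (v + e)"
  shows "local_cong Q U u v"
proof -
  obtain e' M where e': "path_cong Q (e + e') (rep M U)" using e by (auto simp: local_unit_def)
  obtain N where N: "path_cong Q (u + e + rep N U) (v + e + rep N U)" using uv by (auto simp: local_cong_def)
  have *: "path_cong Q (w + e + rep N U + e') (w + rep (M + N) U)" for w
    using path_cong_add[OF e', of "w + rep N U"] by (simp add: rep_add ac_simps)
  from path_cong_trans[OF path_cong_trans[OF path_cong_sym[OF *] path_cong_add[OF N]] *]
  show ?thesis by (auto simp: local_cong_def)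
qed

lemma local_unit_zero: "local_unit Q U 0"
  unfolding local_unit_def by (intro exI[of _ 0] exI[of _ "0::nat"]) (simp add: path_cong_refl)

lemma local_unit_add:
  assumes "local_unit Q U d" "local_unit Q U e"
  shows "local_unit Q U (d + e)"
proof -
  obtain d' M e' N where "path_cong Q (d + d') (rep M U)" "path_cong Q (e + e') (rep N U)"
    using assms by (auto simp: local_unit_def)
  from path_cong_add2[OF this] have "path_cong Q (d + e + (d' + e')) (rep (M + N) U)"
    by (simp add: rep_add ac_simps)
  then show ?thesis by (auto simp: local_unit_def)
qed

lemma local_unit_addD:
  assumes "local_unit Q U (d + e)"
  shows "local_unit Q U d" "local_unit Q U e"
proof -
  obtain f N where f: "path_cong Q (d + e + f) (rep N U)"
    using assms by (auto simp: local_unit_def)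
  have "path_cong Q (d + (e + f)) (rep N U)" "path_cong Q (e + (d + f)) (rep N U)"
    using f by (simp_all add: ac_simps)
  then show "local_unit Q U d" "local_unit Q U e" unfolding local_unit_def by blast+
qed

lemma local_unit_cong:
  assumes "local_unit Q U d" "path_cong Q d e"
  shows "local_unit Q U e"
proof -
  obtain d' N where d': "path_cong Q (d + d') (rep N U)" using assms by (auto simp: local_unit_def)
  have "path_cong Q (e + d') (rep N U)"
    using path_cong_trans[OF path_cong_add[OF path_cong_sym[OF assms(2)]] d'] .
  then show ?thesis by (auto simp: local_unit_def)
qed

lemma local_unit_rep: "local_unit Q U e \<Longrightarrow> local_unit Q U (rep n e)"
  by (induction n) (simp_all add: local_unit_zero local_unit_add)

lemma local_unit_sum: "(\<And>x. x \<in> A \<Longrightarrow> local_unit Q U (f x)) \<Longrightarrow> local_unit Q U (\<Sum>x\<in>A. f x)"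
  by (induction A rule: infinite_finite_induct) (simp_all add: local_unit_zero local_unit_add)

lemma poly_mapping_nat_remove:
  fixes v :: "'a \<Rightarrow>\<^sub>0 nat"
  assumes "a \<in> keys v"
  shows "v = single a 1 + (v - single a 1)"
proof (rule poly_mapping_eqI)
  fix k
  show "lookup v k = lookup (single a 1 + (v - single a 1)) k"
    using assms by (auto simp: lookup_add lookup_minus lookup_single when_def in_keys_iff)
qed

lemma poly_mapping_nat_induct [case_names zero add]:
  fixes v :: "'a \<Rightarrow>\<^sub>0 nat"
  assumes zero: "P 0" and add: "\<And>a v. P v \<Longrightarrow> P (single a 1 + v)"
  shows "P v"
proof (induction "\<Sum>a\<in>keys v. lookup v a" arbitrary: v)
  case 0
  then have "v = 0" by (auto intro!: poly_mapping_eqI simp: in_keys_iff)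
  then show ?case using zero by simp
next
  case (Suc n)
  then have "keys v \<noteq> {}" by auto
  then obtain a where a: "a \<in> keys v" by blast
  define w where "w = v - single a 1"
  have v: "v = single a 1 + w" unfolding w_def by (rule poly_mapping_nat_remove[OF a])
  have "(\<Sum>k\<in>keys (single a (1::nat) + w). id (lookup (single a 1 + w) k)) =
      (\<Sum>k\<in>keys (single a (1::nat)). id (lookup (single a 1) k)) +
      (\<Sum>k\<in>keys w. id (lookup w k))"
    by (rule setsum_keys_plus_distrib) simp_all
  then have "n = (\<Sum>k\<in>keys w. lookup w k)" using Suc(2) v by simp
  then have "P w" by (rule Suc(1))
  then show ?case unfolding v by (rule add)
qed

section \<open>The charts of the moduli space\<close>

lemma second_diff_left: "1 \<le> k \<Longrightarrow> second_diff b (\<lambda>t. continuant b t j) k = of_bool (k = j)"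
  using continuant_diff_left[of k b j] by (simp add: second_diff_def)

lemma second_diff_right: "1 \<le> k \<Longrightarrow> second_diff b (\<lambda>t. continuant b j t) k = of_bool (k = j)"
  using continuant_diff_right[of k b j] by (simp add: second_diff_def)

lemmas second_diff_simps = second_diff_add second_diff_minus second_diff_left second_diff_right

text \<open>The divisor of a round trip: from L_j to L_(j+1) by the quotient of alpha_(j+1) by
  alpha_j, and back by the quotient of beta_j by beta_(j+1). Its multiplicities along the rays
  \<open>j\<close> and \<open>j + 1\<close> are \<open>1\<close>, so in the jth chart it is the
  product xy of the two coordinates.\<close>

definition loop_divisor :: "(nat \<Rightarrow> int) \<Rightarrow> nat \<Rightarrow> nat \<Rightarrow> int" where
  "loop_divisor b j t = (continuant b t (Suc j) - continuant b t j) + (continuant b j t - continuant b (Suc j) t)"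

context
  fixes b :: "nat \<Rightarrow> int" and l :: nat
  assumes b: "\<And>k. k \<in> {1..l} \<Longrightarrow> 2 \<le> b k"
begin

lemma continuant_mono_right:
  assumes "j \<le> l"
  shows "0 \<le> continuant b t j \<and> continuant b t j \<le> continuant b t (Suc j)"
proof (cases "t \<le> j")
  case True
  show ?thesis
    by (rule grows_right[of t l b "continuant b t"])
      (use b True assms second_diff_right[of _ b t] in auto)
next
  case False
  then show ?thesis by simp
qed

lemma continuant_mono_left:
  assumes "t \<le> Suc l"
  shows "0 \<le> continuant b (Suc j) t \<and> continuant b (Suc j) t \<le> continuant b j t"
proof (cases "j < t")
  case True
  then obtain s where s: "t = Suc s" "j \<le> s" by (cases t) auto
  show ?thesis
    by (rule grows_left[of s b "\<lambda>j. continuant b j t"])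
      (use b s assms second_diff_left[of _ b t] in auto)
next
  case False
  then show ?thesis by simp
qed

lemma continuant_nonneg: "j \<le> Suc l \<Longrightarrow> 0 \<le> continuant b t j"
  using continuant_mono_right[of "j - 1" t] by (cases j) auto

lemma left_divisor: "j \<le> Suc l \<Longrightarrow> (\<lambda>t. continuant b t j) \<in> hom_divisors b l 0 j"
  using continuant_nonneg[of j] by (auto simp: hom_divisors_def second_diff_simps)

lemma right_divisor: "(\<lambda>t. continuant b j t) \<in> hom_divisors b l 0 j"
  using continuant_nonneg by (auto simp: hom_divisors_def second_diff_simps)

text \<open>alpha_(j+1) is alpha_j times a section of Hom(L_j, L_(j+1)); effectivity of its divisor
  is the monotonicity of continuants. In the same way \<open>right_step\<close> divides beta_j by
  beta_(j+1), which gives a section in the opposite direction.\<close>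

lemma left_step:
  "j \<le> l \<Longrightarrow> (\<lambda>t. continuant b t (Suc j) - continuant b t j) \<in> hom_divisors b l j (Suc j)"
  using continuant_mono_right[of j] by (auto simp: hom_divisors_def second_diff_simps)

lemma right_step:
  "j \<le> l \<Longrightarrow> (\<lambda>t. continuant b j t - continuant b (Suc j) t) \<in> hom_divisors b l (Suc j) j"
  using continuant_mono_left by (auto simp: hom_divisors_def second_diff_simps)

text \<open>Control over the two rays of one cone suffices: on each side of it nonnegativity is
  either known beforehand or grows out of the values at \<open>i\<close> and
  \<open>i + 1\<close>.\<close>

lemma linear_nonneg:
  assumes h: "\<And>k. k \<in> {1..l} \<Longrightarrow> second_diff b h k = 0" and i: "i \<le> l"
    and left: "(\<forall>t\<le>i. 0 \<le> h t) \<or> 0 \<le> h (Suc i) \<and> h (Suc i) \<le> h i"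
    and right: "(\<forall>t\<in>{Suc i..Suc l}. 0 \<le> h t) \<or> 0 \<le> h i \<and> h i \<le> h (Suc i)"
  shows "h \<in> hom_divisors b l 0 0"
proof -
  have "0 \<le> h t" if "t \<le> Suc l" for t
  proof (cases "t \<le> i")
    case True
    from left show ?thesis
    proof
      assume "0 \<le> h (Suc i) \<and> h (Suc i) \<le> h i"
      then have "0 \<le> h (Suc t) \<and> h (Suc t) \<le> h t"
        by (intro grows_left[of i b h]) (use b h i True in auto)
      then show ?thesis by simp
    qed (use True in auto)
  next
    case False
    from right show ?thesis
    proof
      assume "0 \<le> h i \<and> h i \<le> h (Suc i)"
      then have "0 \<le> h (t - 1) \<and> h (t - 1) \<le> h (Suc (t - 1))"
        by (intro grows_right[of i l b h]) (use b h i that False in auto)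
      then show ?thesis using False by simp
    qed (use False that in auto)
  qed
  then show ?thesis using h by (auto simp: hom_divisors_def)
qed

text \<open>This is what makes the bundles \<open>L\<^sub>j\<close> special: two of their sections generate all the
  others.\<close>

lemma divisor_cases:
  assumes h: "h \<in> hom_divisors b l 0 j" and j: "j \<in> {1..l}"
  shows "(\<lambda>t. h t - continuant b t j) \<in> hom_divisors b l 0 0 \<or>
    (\<lambda>t. h t - continuant b j t) \<in> hom_divisors b l 0 0"
proof -
  obtain i where i: "j = Suc i" "i < l" using j by (cases j) auto
  have nonneg: "0 \<le> h t" if "t \<le> Suc l" for t using h that by (simp add: hom_divisors_def)
  have diff: "second_diff b h k = of_bool (k = j)" if "k \<in> {1..l}" for k
    using h that by (auto simp: hom_divisors_def)
  \<comment> \<open>Degree one on the jth curve means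
    \<open>h (j - 1) + h (j + 1) = b j * h j + 1\<close>, which is at least
    \<open>2 * h j + 1\<close>, so some neighbour exceeds \<open>h j\<close>. The generator
    supported on that side is subtracted: it lowers this neighbour by one and leaves
    \<open>h j\<close> and the other side alone, so growth from \<open>j\<close> outwards still
    applies.\<close>
  have "2 * h j \<le> b j * h j" using b j nonneg[of j] by (intro mult_right_mono) auto
  moreover have "h i + h (j + 1) = b j * h j + 1"
    using diff[of j] i by (simp add: second_diff_def)
  ultimately have "h j + 1 \<le> h (j + 1) \<or> h j + 1 \<le> h i" by linarith
  then show ?thesis
  proof
    assume *: "h j + 1 \<le> h (j + 1)"
    have "(\<lambda>t. h t - continuant b j t) \<in> hom_divisors b l 0 0"
      by (rule linear_nonneg[of _ j]) (use * i nonneg j diff in \<open>auto simp: second_diff_simps\<close>)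
    then show ?thesis by blast
  next
    assume *: "h j + 1 \<le> h i"
    have "(\<lambda>t. h t - continuant b t j) \<in> hom_divisors b l 0 0"
      by (rule linear_nonneg[of _ i]) (use * i nonneg j diff in \<open>auto simp: second_diff_simps\<close>)
    then show ?thesis by blast
  qed
qed

lemma loop_divisor: "j \<le> l \<Longrightarrow> loop_divisor b j \<in> hom_divisors b l 0 0"
  using continuant_mono_right[of j] continuant_mono_left
  by (auto simp: hom_divisors_def loop_divisor_def[abs_def] second_diff_simps add_nonneg_nonneg)

end

text \<open>What the chart argument takes from geometry. By \<open>walk_exists\<close> every
  effective divisor of the right degrees is the divisor of a path, so relations can be found by
  computing with divisors alone. By \<open>label_outside\<close> the divisor of a path is determined
  by the rays up to \<open>l + 1\<close>.\<close>

locale mckay_quiver =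
  fixes Q :: "'a quiver" and l :: nat and b :: "nat \<Rightarrow> int"
  assumes verts: "verts Q = {0..l}"
    and b_ge: "k \<in> {1..l} \<Longrightarrow> 2 \<le> b k"
    and arrow_ends: "a \<in> arrows Q \<Longrightarrow> tail Q a \<le> l \<and> head Q a \<le> l"
    and label_divisor: "a \<in> arrows Q \<Longrightarrow>
      (\<lambda>\<rho>. int (label Q a \<rho>)) \<in> hom_divisors b l (tail Q a) (head Q a)"
    and label_outside: "a \<in> arrows Q \<Longrightarrow> \<rho> > l + 1 \<Longrightarrow> label Q a \<rho> = 0"
    and walk_exists: "i \<le> l \<Longrightarrow> j \<le> l \<Longrightarrow> h \<in> hom_divisors b l i j \<Longrightarrow>
      \<exists>as. walk Q i as j \<and> (\<forall>\<rho>\<le>l + 1. int (div_path Q (i, as, j) \<rho>) = h \<rho>)"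
begin

abbreviation divisors :: "nat \<Rightarrow> nat \<Rightarrow> (nat \<Rightarrow> int) set" where
  "divisors \<equiv> hom_divisors b l"

text \<open>The last cone involves the index \<open>l + 1\<close>, whose bundle is trivial. Sending
  it to the vertex 0 lets all cones be treated alike.\<close>

definition vtx :: "nat \<Rightarrow> nat" where "vtx j = (if j = l + 1 then 0 else j)"

lemma vtx_le: "j \<le> l + 1 \<Longrightarrow> vtx j \<le> l"
  by (simp add: vtx_def)

lemma vtx_eq [simp]: "j \<le> l \<Longrightarrow> vtx j = j"
  by (simp add: vtx_def)

lemma hom_divisors_vtx [simp]: "divisors (vtx i) (vtx j) = divisors i j"
proof -
  have "(k = vtx j) = (k = j)" if "k \<in> {1..l}" for k j
    using that by (auto simp: vtx_def)
  then show ?thesis by (simp add: hom_divisors_def)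
qed

text \<open>A chosen path with divisor \<open>h\<close>. By \<open>edge_eqI\<close> every other
  choice is congruent, so \<open>edge\<close> acts as the section with divisor
  \<open>h\<close>.\<close>

definition edge :: "nat \<Rightarrow> nat \<Rightarrow> (nat \<Rightarrow> int) \<Rightarrow> ('a \<Rightarrow>\<^sub>0 nat)" where
  "edge i j h = path_exp (vtx i, (SOME as. walk Q (vtx i) as (vtx j) \<and>
     (\<forall>\<rho>\<le>l + 1. int (div_path Q (vtx i, as, vtx j) \<rho>) = h \<rho>)), vtx j)"

lemma edge_walk:
  assumes "i \<le> l + 1" "j \<le> l + 1" "h \<in> divisors i j"
  obtains as where "walk Q (vtx i) as (vtx j)" "edge i j h = path_exp (vtx i, as, vtx j)"
    "\<And>\<rho>. \<rho> \<le> l + 1 \<Longrightarrow> int (div_path Q (vtx i, as, vtx j) \<rho>) = h \<rho>"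
proof -
  have "\<exists>as. walk Q (vtx i) as (vtx j) \<and> (\<forall>\<rho>\<le>l + 1. int (div_path Q (vtx i, as, vtx j) \<rho>) = h \<rho>)"
    using assms by (intro walk_exists vtx_le) simp_all
  from someI_ex[OF this] show ?thesis using that unfolding edge_def by blast
qed

lemma div_path_outside: "walk Q i as j \<Longrightarrow> \<rho> > l + 1 \<Longrightarrow> div_path Q (i, as, j) \<rho> = 0"
  by (induction as arbitrary: i) (auto simp: div_path_def label_outside)

lemma path_cong_walk:
  assumes "walk Q i as j" "walk Q i bs j"
    and "\<And>\<rho>. \<rho> \<le> l + 1 \<Longrightarrow> int (div_path Q (i, as, j) \<rho>) = int (div_path Q (i, bs, j) \<rho>)"
  shows "path_cong Q (path_exp (i, as, j)) (path_exp (i, bs, j))"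
proof (rule path_cong_path[OF assms(1,2)])
  show "div_path Q (i, as, j) = div_path Q (i, bs, j)"
  proof
    fix \<rho> show "div_path Q (i, as, j) \<rho> = div_path Q (i, bs, j) \<rho>"
      using assms(3)[of \<rho>] div_path_outside[OF assms(1)] div_path_outside[OF assms(2)]
      by (cases "\<rho> \<le> l + 1") auto
  qed
qed

lemma edge_eqI:
  assumes "i \<le> l + 1" "j \<le> l + 1" "h \<in> divisors i j"
    and "walk Q (vtx i) as (vtx j)" "\<And>\<rho>. \<rho> \<le> l + 1 \<Longrightarrow> int (div_path Q (vtx i, as, vtx j) \<rho>) = h \<rho>"
  shows "path_cong Q (path_exp (vtx i, as, vtx j)) (edge i j h)"
proof -
  obtain bs where bs: "walk Q (vtx i) bs (vtx j)" "edge i j h = path_exp (vtx i, bs, vtx j)"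
    "\<And>\<rho>. \<rho> \<le> l + 1 \<Longrightarrow> int (div_path Q (vtx i, bs, vtx j) \<rho>) = h \<rho>"
    using edge_walk[OF assms(1-3)] by blast
  show ?thesis unfolding bs(2) by (rule path_cong_walk) (use assms bs in auto)
qed

text \<open>Multiplication of sections: the composite of the two chosen paths has the ends and the
  divisor of the path chosen for \<open>f\<close>. Most relations of R used below come from this
  lemma.\<close>

lemma edge_add:
  assumes "i \<le> l + 1" "j \<le> l + 1" "k \<le> l + 1"
    and h: "h \<in> divisors i j" and g: "g \<in> divisors j k"
    and f: "\<And>\<rho>. \<rho> \<le> l + 1 \<Longrightarrow> f \<rho> = h \<rho> + g \<rho>"
  shows "path_cong Q (edge i j h + edge j k g) (edge i k f)"
proof -
  obtain as where as: "walk Q (vtx i) as (vtx j)" "edge i j h = path_exp (vtx i, as, vtx j)"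
    "\<And>\<rho>. \<rho> \<le> l + 1 \<Longrightarrow> int (div_path Q (vtx i, as, vtx j) \<rho>) = h \<rho>"
    using edge_walk[OF assms(1,2) h] by blast
  obtain bs where bs: "walk Q (vtx j) bs (vtx k)" "edge j k g = path_exp (vtx j, bs, vtx k)"
    "\<And>\<rho>. \<rho> \<le> l + 1 \<Longrightarrow> int (div_path Q (vtx j, bs, vtx k) \<rho>) = g \<rho>"
    using edge_walk[OF assms(2,3) g] by blast
  have "(\<lambda>\<rho>. h \<rho> + g \<rho>) \<in> divisors i k" using h g by (rule hom_divisors_add)
  then have fH: "f \<in> divisors i k"
    using f by (auto simp: hom_divisors_def second_diff_def)
  have "edge i j h + edge j k g = path_exp (vtx i, as @ bs, vtx k)"
    unfolding as(2) bs(2) by (rule path_exp_simps(3)[symmetric])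
  moreover have "path_cong Q (path_exp (vtx i, as @ bs, vtx k)) (edge i k f)"
  proof (rule edge_eqI)
    show "walk Q (vtx i) (as @ bs) (vtx k)" using as(1) bs(1) by (rule walk_append)
    fix \<rho> assume "\<rho> \<le> l + 1"
    then show "int (div_path Q (vtx i, as @ bs, vtx k) \<rho>) = f \<rho>"
      using as(3) bs(3) f
      unfolding div_path_append[of Q "vtx i" as bs "vtx k" "vtx i" "vtx j" "vtx j" "vtx k"] by simp
  qed (use assms fH in auto)
  ultimately show ?thesis by simp
qed

lemma edge_zero:
  assumes "i \<le> l + 1" "\<And>\<rho>. \<rho> \<le> l + 1 \<Longrightarrow> h \<rho> = 0"
  shows "path_cong Q (edge i i h) 0"
proof -
  have "h \<in> divisors i i" using assms by (auto simp: hom_divisors_def second_diff_def)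
  then have "path_cong Q (path_exp (vtx i, [], vtx i)) (edge i i h)"
    using assms vtx_le[of i] verts by (intro edge_eqI) (auto simp: div_path_def)
  then show ?thesis by (simp add: path_exp_simps path_cong_sym)
qed

lemma edge_0_last: "edge 0 (Suc l) h = edge 0 0 h"
  by (simp add: edge_def vtx_def)

lemma walk_divisor:
  "walk Q i as j \<Longrightarrow> (\<lambda>\<rho>. int (div_path Q (i, as, j) \<rho>)) \<in> divisors i j"
proof (induction as arbitrary: i)
  case Nil
  then show ?case using hom_divisors_zero[of b l j] by (auto simp: div_path_def)
next
  case (Cons a as)
  then have "(\<lambda>\<rho>. int (label Q a \<rho>) + int (div_path Q (head Q a, as, j) \<rho>)) \<in> divisors i j"
    using hom_divisors_add[OF label_divisor[of a]] by auto
  then show ?case by (simp add: div_path_def)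
qed

lemma arrow_edge:
  assumes "a \<in> arrows Q"
  shows "path_cong Q (single a 1) (edge (tail Q a) (head Q a) (\<lambda>\<rho>. int (label Q a \<rho>)))"
proof -
  have e: "tail Q a \<le> l" "head Q a \<le> l" using arrow_ends[OF assms] by auto
  have "path_cong Q (path_exp (vtx (tail Q a), [a], vtx (head Q a)))
      (edge (tail Q a) (head Q a) (\<lambda>\<rho>. int (label Q a \<rho>)))"
    by (rule edge_eqI) (use e assms label_divisor verts in \<open>auto simp: div_path_def\<close>)
  then show ?thesis by (simp add: path_exp_def)
qed

end

text \<open>A chart of the moduli space: where the arrows in the support of \<open>U\<close> are invertible, so are
  the sections of the bundles \<open>L\<^sub>j\<close> that generate at the torus-fixed point of the \<open>i\<close>th cone.\<close>

locale mckay_chart = mckay_quiver Q l b for Q :: "'a quiver" and l b +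
  fixes U :: "'a \<Rightarrow>\<^sub>0 nat" and i :: nat and base_div :: "nat \<Rightarrow> nat \<Rightarrow> int"
  defines "base_div j \<equiv> (if j \<le> i then (\<lambda>t. continuant b t j) else (\<lambda>t. continuant b j t))"
  assumes i_le: "i \<le> l"
    and base_unit: "j \<le> l + 1 \<Longrightarrow> local_unit Q U (edge 0 j (base_div j))"
begin

abbreviation eqv (infix "\<doteq>" 50) where "u \<doteq> v \<equiv> local_cong Q U u v"

definition base :: "nat \<Rightarrow> ('a \<Rightarrow>\<^sub>0 nat)" where "base j = edge 0 j (base_div j)"

definition right_gen :: "'a \<Rightarrow>\<^sub>0 nat" where "right_gen = edge 0 i (\<lambda>t. continuant b i t)"

definition left_gen :: "'a \<Rightarrow>\<^sub>0 nat" where "left_gen = edge 0 (Suc i) (\<lambda>t. continuant b t (Suc i))"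

lemma base_div_zero [simp]: "base_div j i = 0" "base_div j (Suc i) = 0"
  by (auto simp: base_div_def)

lemma base_div_divisor: "j \<le> Suc l \<Longrightarrow> base_div j \<in> divisors 0 j"
  using left_divisor[of l b] right_divisor[of l b] b_ge by (auto simp: base_div_def)

lemma base_0: "base 0 \<doteq> 0"
  unfolding base_def by (intro local_congI edge_zero) (auto simp: base_div_def)

text \<open>\<open>good j h\<close>: in the chart, the section of \<open>L\<^sub>j\<close> with divisor \<open>h\<close> is the base section times
  the monomial in the two local coordinates that its divisor dictates. All inverses have been
  moved to the other side of the equation.\<close>

definition good :: "nat \<Rightarrow> (nat \<Rightarrow> int) \<Rightarrow> bool" where
  "good j h \<longleftrightarrow> edge 0 j h + rep (nat (h (Suc i))) (base i) + rep (nat (h i)) (base (Suc i)) \<doteq>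
     base j + rep (nat (h (Suc i))) right_gen + rep (nat (h i)) left_gen"

lemma good_base: "good j (base_div j)"
  by (simp add: good_def base_def local_cong_refl)

text \<open>beta_i has multiplicity \<open>1\<close> along the ray \<open>i + 1\<close> and
  \<open>0\<close> along the ray \<open>i\<close>, so the claim reads beta_i + alpha_i = alpha_i +
  beta_i: it is the definition of the coordinate x. Likewise \<open>good_left\<close> is the
  definition of y.\<close>

lemma good_right: "good i (\<lambda>t. continuant b i t)"
  by (simp add: good_def right_gen_def add.commute local_cong_refl)

lemma good_left: "good (Suc i) (\<lambda>t. continuant b t (Suc i))"
  by (simp add: good_def left_gen_def add.commute local_cong_refl)

lemma good_add:
  assumes g: "good 0 g" "g \<in> divisors 0 0" and h: "good j h" "h \<in> divisors 0 j"
    and j: "j \<le> Suc l" and f: "\<And>\<rho>. \<rho> \<le> l + 1 \<Longrightarrow> f \<rho> = g \<rho> + h \<rho>"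
  shows "good j f"
proof -
  have nn: "0 \<le> g i" "0 \<le> g (Suc i)" "0 \<le> h i" "0 \<le> h (Suc i)"
    using i_le g(2) h(2) by (auto simp: hom_divisors_def)
  have f': "nat (f (Suc i)) = nat (g (Suc i)) + nat (h (Suc i))" "nat (f i) = nat (g i) + nat (h i)"
    using nn f i_le by (simp_all add: nat_add_distrib)
  have "edge 0 j f \<doteq> edge 0 0 g + edge 0 j h"
    by (rule local_cong_sym, rule local_congI, rule edge_add) (use j g h f in auto)
  from local_cong_add[OF this local_cong_refl[of Q U "rep (nat (f (Suc i))) (base i) + rep (nat (f i)) (base (Suc i))"]]
  have "edge 0 j f + rep (nat (f (Suc i))) (base i) + rep (nat (f i)) (base (Suc i)) \<doteq>
      (edge 0 0 g + rep (nat (g (Suc i))) (base i) + rep (nat (g i)) (base (Suc i))) +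
      (edge 0 j h + rep (nat (h (Suc i))) (base i) + rep (nat (h i)) (base (Suc i)))"
    by (simp add: f' rep_add ac_simps)
  also have "\<dots> \<doteq> (base 0 + rep (nat (g (Suc i))) right_gen + rep (nat (g i)) left_gen) +
      (base j + rep (nat (h (Suc i))) right_gen + rep (nat (h i)) left_gen)"
    using g(1) h(1) unfolding good_def by (rule local_cong_add)
  also have "\<dots> \<doteq> 0 + (rep (nat (g (Suc i))) right_gen + rep (nat (g i)) left_gen +
      (base j + rep (nat (h (Suc i))) right_gen + rep (nat (h i)) left_gen))"
    using local_cong_add[OF base_0 local_cong_refl[of Q U "rep (nat (g (Suc i))) right_gen +
      rep (nat (g i)) left_gen + (base j + rep (nat (h (Suc i))) right_gen + rep (nat (h i)) left_gen)"]]
    by (simp add: ac_simps)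
  finally show ?thesis unfolding good_def by (simp add: f' rep_add ac_simps)
qed

text \<open>The section with divisor \<open>\<kappa>\<close> divides the base section at
  \<open>k\<close>, which is invertible in the chart, so it is invertible too. It can be multiplied
  on to reach \<open>k\<close> and cancelled afterwards.\<close>

lemma good_transfer:
  assumes j: "j \<le> Suc l" and k: "k \<le> Suc l" and \<kappa>: "\<kappa> \<in> divisors j k"
    and base: "\<And>\<rho>. \<rho> \<le> l + 1 \<Longrightarrow> base_div k \<rho> = base_div j \<rho> + \<kappa> \<rho>"
    and h: "h \<in> divisors 0 j" and f: "\<And>\<rho>. \<rho> \<le> l + 1 \<Longrightarrow> f \<rho> = h \<rho> + \<kappa> \<rho>"
    and good: "good k f"
  shows "good j h"
proof -
  have k0: "\<kappa> i = 0" "\<kappa> (Suc i) = 0" using base[of i] base[of "Suc i"] i_le by auto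
  then have fi: "f i = h i" "f (Suc i) = h (Suc i)" using f i_le by auto
  have 1: "path_cong Q (base j + edge j k \<kappa>) (base k)"
    unfolding base_def by (rule edge_add) (use j k \<kappa> base base_div_divisor in auto)
  have 2: "path_cong Q (edge 0 j h + edge j k \<kappa>) (edge 0 k f)"
    by (rule edge_add) (use j k \<kappa> h f in auto)
  have u: "local_unit Q U (edge j k \<kappa>)"
    using local_unit_addD(2)[OF local_unit_cong[OF base_unit path_cong_sym[OF 1[unfolded base_def]]]] k
    by simp
  let ?X = "rep (nat (h (Suc i))) (base i) + rep (nat (h i)) (base (Suc i))"
  let ?Y = "rep (nat (h (Suc i))) right_gen + rep (nat (h i)) left_gen"
  have "(edge 0 j h + ?X) + edge j k \<kappa> \<doteq> edge 0 k f + ?X"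
    using local_cong_add[OF local_congI[OF 2] local_cong_refl[of Q U ?X]] by (simp add: ac_simps)
  also have "\<dots> \<doteq> base k + ?Y"
    using good by (simp add: good_def fi ac_simps)
  also have "\<dots> \<doteq> (base j + ?Y) + edge j k \<kappa>"
    using local_cong_add[OF local_cong_sym[OF local_congI[OF 1]] local_cong_refl[of Q U ?Y]]
    by (simp add: ac_simps)
  finally have "edge 0 j h + ?X \<doteq> base j + ?Y" by (rule local_cong_cancel[OF u])
  then show ?thesis by (simp add: good_def add.assoc)
qed

lemma loop_divisor_local: "loop_divisor b i \<in> divisors 0 0" "loop_divisor b i \<in> divisors i i"
  "loop_divisor b i i = 1" "loop_divisor b i (Suc i) = 1"
proof -
  show "loop_divisor b i \<in> divisors 0 0" using loop_divisor[of l b i] b_ge i_le by blast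
  show "loop_divisor b i \<in> divisors i i"
    using hom_divisors_add[OF left_step[of l b i] right_step[of l b i]] b_ge i_le
    by (simp add: loop_divisor_def[abs_def])
qed (simp_all add: loop_divisor_def)

text \<open>The loop at the vertex 0 and the loop at \<open>i\<close> with the same divisor are
  different paths, which R compares only after composition with the base section at
  \<open>i\<close>. The loop at \<open>i\<close> then splits at \<open>i + 1\<close>: one half
  completes alpha_i to \<open>left_gen\<close>, the other completes beta_(i+1) to
  \<open>right_gen\<close>.\<close>

lemma good_loop_divisor: "good 0 (loop_divisor b i)"
proof -
  let ?l = "loop_divisor b i"
  let ?\<kappa> = "edge i (Suc i) (\<lambda>t. continuant b t (Suc i) - continuant b t i)"
  let ?\<kappa>' = "edge (Suc i) i (\<lambda>t. continuant b i t - continuant b (Suc i) t)"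
  let ?f = "\<lambda>t. base_div i t + ?l t"
  note steps = left_step[of l b i, OF b_ge i_le] right_step[of l b i, OF b_ge i_le]
  note divs = base_div_divisor[of i] base_div_divisor[of "Suc i"] loop_divisor_local
  have 1: "path_cong Q (base i + ?\<kappa>) left_gen"
    unfolding base_def left_gen_def
    by (rule edge_add) (use i_le steps divs in \<open>auto simp: base_div_def\<close>)
  have 2: "path_cong Q (base (Suc i) + ?\<kappa>') right_gen"
    unfolding base_def right_gen_def
    by (rule edge_add) (use i_le steps divs in \<open>auto simp: base_div_def\<close>)
  have 3: "path_cong Q (?\<kappa> + ?\<kappa>') (edge i i ?l)"
    by (rule edge_add) (use i_le steps in \<open>auto simp: loop_divisor_def\<close>)
  have 4: "path_cong Q (base i + edge i i ?l) (edge 0 i ?f)"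
    unfolding base_def by (rule edge_add) (use i_le divs in auto)
  have 5: "path_cong Q (edge 0 0 ?l + base i) (edge 0 i ?f)"
    unfolding base_def by (rule edge_add) (use i_le divs in auto)
  have "edge 0 0 ?l + base i + base (Suc i) \<doteq> base i + edge i i ?l + base (Suc i)"
    using path_cong_trans[OF 5 path_cong_sym[OF 4]] by (intro local_cong_add local_cong_refl local_congI)
  also have "\<dots> \<doteq> (?\<kappa> + ?\<kappa>') + (base i + base (Suc i))"
    using local_cong_add[OF local_cong_sym[OF local_congI[OF 3]] local_cong_refl[of Q U "base i + base (Suc i)"]]
    by (simp add: ac_simps)
  also have "\<dots> \<doteq> left_gen + right_gen"
    using local_cong_add[OF local_congI[OF 1] local_congI[OF 2]] by (simp add: ac_simps)
  also have "\<dots> \<doteq> base 0 + (left_gen + right_gen)"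
    using local_cong_add[OF local_cong_sym[OF base_0] local_cong_refl[of Q U "left_gen + right_gen"]] by simp
  finally show ?thesis by (simp add: good_def loop_divisor_local ac_simps)
qed

text \<open>An invariant function is divided by x, y or xy until it is constant; the measure is the
  sum of its multiplicities along the two rays of the cone. Which division leaves an effective
  divisor is decided by comparing the two multiplicities.\<close>

lemma good_loop:
  assumes "g \<in> divisors 0 0"
  shows "good 0 g"
  using assms
proof (induction "nat (g i + g (Suc i))" arbitrary: g rule: less_induct)
  case less
  have nn: "0 \<le> g t" if "t \<le> Suc l" for t using less.prems that by (simp add: hom_divisors_def)
  have diff: "second_diff b g k = 0" if "k \<in> {1..l}" for k
    using less.prems that by (auto simp: hom_divisors_def)
  have cnn: "0 \<le> continuant b t j" if "j \<le> Suc l" for t j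
    using continuant_nonneg[of l b j] b_ge that by blast
  have lin: "h \<in> divisors 0 0" if "\<And>k. k \<in> {1..l} \<Longrightarrow> second_diff b h k = 0"
     "(\<forall>t\<le>i. 0 \<le> h t) \<or> 0 \<le> h (Suc i) \<and> h (Suc i) \<le> h i"
     "(\<forall>t\<in>{Suc i..Suc l}. 0 \<le> h t) \<or> 0 \<le> h i \<and> h i \<le> h (Suc i)" for h
    using linear_nonneg[of l b h i] b_ge that i_le by blast
  consider "g i < g (Suc i)" | "g (Suc i) < g i" | "g i = g (Suc i)" by linarith
  then show ?case
  proof cases
    case 1
    \<comment> \<open>Division by x: beta_i is traded for alpha_i. Rays up to \<open>i\<close> only
      gain, and the strict inequality leaves \<open>g' i \<le> g' (Suc i)\<close>, so growth to the
      right keeps \<open>g'\<close> nonnegative.\<close>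
    define g' where "g' t = g t + continuant b t i - continuant b i t" for t
    have g': "g' \<in> divisors 0 0"
      by (rule lin) (use 1 nn cnn i_le diff in \<open>auto simp: g'_def[abs_def] second_diff_simps\<close>)
    have v: "g' i = g i" "g' (Suc i) = g (Suc i) - 1" by (simp_all add: g'_def)
    have IH: "good 0 g'" using less.hyps[OF _ g'] v nn[of i] nn[of "Suc i"] i_le 1 by simp
    let ?f = "\<lambda>t. g t + continuant b t i"
    have "path_cong Q (edge 0 0 g + base i) (edge 0 i ?f)"
      unfolding base_def
      by (rule edge_add) (use i_le less.prems base_div_divisor[of i] in \<open>auto simp: base_div_def\<close>)
    moreover have "path_cong Q (edge 0 0 g' + right_gen) (edge 0 i ?f)"
      unfolding right_gen_def
      by (rule edge_add) (use i_le g' right_divisor[of l b i] b_ge in \<open>auto simp: g'_def\<close>)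
    ultimately have 2: "edge 0 0 g + base i \<doteq> edge 0 0 g' + right_gen"
      by (intro local_congI) (blast intro: path_cong_trans path_cong_sym)
    have n: "nat (g (Suc i)) = Suc (nat (g' (Suc i)))" "nat (g i) = nat (g' i)"
      using v 1 nn[of i] i_le by auto
    let ?X = "rep (nat (g' (Suc i))) (base i) + rep (nat (g' i)) (base (Suc i))"
    have "(edge 0 0 g + base i) + ?X \<doteq> (edge 0 0 g' + right_gen) + ?X"
      using 2 by (rule local_cong_add) (rule local_cong_refl)
    also have "\<dots> \<doteq> (base 0 + rep (nat (g' (Suc i))) right_gen + rep (nat (g' i)) left_gen) + right_gen"
      using local_cong_add[OF IH[unfolded good_def] local_cong_refl[of Q U right_gen]] by (simp add: ac_simps)
    finally show ?thesis by (simp add: good_def n ac_simps)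
  next
    case 2
    define g' where "g' t = g t + continuant b (Suc i) t - continuant b t (Suc i)" for t
    have g': "g' \<in> divisors 0 0"
      by (rule lin) (use 2 nn cnn i_le diff in \<open>auto simp: g'_def[abs_def] second_diff_simps\<close>)
    have v: "g' i = g i - 1" "g' (Suc i) = g (Suc i)" by (simp_all add: g'_def)
    have IH: "good 0 g'" using less.hyps[OF _ g'] v nn[of i] nn[of "Suc i"] i_le 2 by simp
    let ?f = "\<lambda>t. g t + continuant b (Suc i) t"
    have "path_cong Q (edge 0 0 g + base (Suc i)) (edge 0 (Suc i) ?f)"
      unfolding base_def
      by (rule edge_add) (use i_le less.prems base_div_divisor[of "Suc i"] in \<open>auto simp: base_div_def\<close>)
    moreover have "path_cong Q (edge 0 0 g' + left_gen) (edge 0 (Suc i) ?f)"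
      unfolding left_gen_def
      by (rule edge_add) (use i_le g' left_divisor[of l b "Suc i"] b_ge in \<open>auto simp: g'_def\<close>)
    ultimately have 3: "edge 0 0 g + base (Suc i) \<doteq> edge 0 0 g' + left_gen"
      by (intro local_congI) (blast intro: path_cong_trans path_cong_sym)
    have n: "nat (g i) = Suc (nat (g' i))" "nat (g (Suc i)) = nat (g' (Suc i))"
      using v 2 nn[of "Suc i"] i_le by auto
    let ?X = "rep (nat (g' (Suc i))) (base i) + rep (nat (g' i)) (base (Suc i))"
    have "(edge 0 0 g + base (Suc i)) + ?X \<doteq> (edge 0 0 g' + left_gen) + ?X"
      using 3 by (rule local_cong_add) (rule local_cong_refl)
    also have "\<dots> \<doteq> (base 0 + rep (nat (g' (Suc i))) right_gen + rep (nat (g' i)) left_gen) + left_gen"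
      using local_cong_add[OF IH[unfolded good_def] local_cong_refl[of Q U left_gen]] by (simp add: ac_simps)
    finally show ?thesis by (simp add: good_def n ac_simps)
  next
    case 3
    show ?thesis
    proof (cases "g i = 0")
      case True
      \<comment> \<open>\<open>g\<close> vanishes on both rays of the cone, so growth on either side
        applies to \<open>- g\<close> as well. Both signs being effective forces \<open>g\<close> to
        vanish on all rays.\<close>
      have "second_diff b (\<lambda>t. 0 - g t) k = 0" if "k \<in> {1..l}" for k
        using diff[OF that] unfolding second_diff_def by simp
      then have "(\<lambda>t. 0 - g t) \<in> divisors 0 0"
        by (intro lin) (use 3 True in auto)
      then have "g t = 0" if "t \<le> Suc l" for t
        using nn[OF that] hom_divisors_nonneg[of "\<lambda>t. 0 - g t" b l 0 0 t] that by simp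
      then have "edge 0 0 g \<doteq> 0" by (intro local_congI edge_zero) auto
      then have "edge 0 0 g \<doteq> base 0" using local_cong_sym[OF base_0] by (rule local_cong_trans)
      then show ?thesis using True 3 by (simp add: good_def)
    next
      case False
      \<comment> \<open>With equal multiplicities, lowering only one of them would break the growth
        condition on its side; the loop lowers both, which is division by xy.\<close>
      define g' where "g' t = g t - loop_divisor b i t" for t
      have v: "g' i = g i - 1" "g' (Suc i) = g (Suc i) - 1" by (simp_all add: g'_def loop_divisor_local)
      have pos: "g i \<ge> 1" using False nn[of i] i_le by simp
      have "second_diff b (loop_divisor b i) k = 0" if "k \<in> {1..l}" for k
        using loop_divisor_local(1) that by (auto simp: hom_divisors_def)
      then have g': "g' \<in> divisors 0 0"
        by (intro lin) (use 3 pos v diff in \<open>auto simp: g'_def[abs_def] second_diff_minus\<close>)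
      have IH: "good 0 g'" using less.hyps[OF _ g'] v 3 pos by simp
      show ?thesis
        by (rule good_add[OF good_loop_divisor loop_divisor_local(1) IH g']) (simp_all add: g'_def)
    qed
  qed
qed

text \<open>Downward induction from \<open>i\<close>. The step from alpha_n to alpha_(n+1) joins two
  base sections, so \<open>good_transfer\<close> applies; multiplied by it, beta_n becomes
  beta_(n+1) times the invariant function with divisor \<open>loop_divisor b n\<close>.\<close>

lemma good_right_all: "j \<le> i \<Longrightarrow> good j (\<lambda>t. continuant b j t)"
proof (induction j rule: inc_induct)
  case base
  show ?case by (rule good_right)
next
  case (step n)
  let ?\<kappa> = "\<lambda>t. continuant b t (Suc n) - continuant b t n"
  have n: "n \<le> l" using step i_le by simp
  show ?case
  proof (rule good_transfer[of n "Suc n" ?\<kappa> _ "\<lambda>t. continuant b n t + ?\<kappa> t"])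
    show "?\<kappa> \<in> divisors n (Suc n)" using left_step[of l b n] b_ge n by blast
    show "(\<lambda>t. continuant b n t) \<in> divisors 0 n" using right_divisor[of l b n] b_ge by blast
    have l: "loop_divisor b n \<in> divisors 0 0" using loop_divisor[of l b n] b_ge n by blast
    show "good (Suc n) (\<lambda>t. continuant b n t + ?\<kappa> t)"
      by (rule good_add[OF good_loop[OF l] l step.IH])
        (use right_divisor[of l b "Suc n"] b_ge n in \<open>auto simp: loop_divisor_def\<close>)
  qed (use step n in \<open>auto simp: base_div_def\<close>)
qed

lemma good_left_all: "Suc i \<le> j \<Longrightarrow> j \<le> Suc l \<Longrightarrow> good j (\<lambda>t. continuant b t j)"
proof (induction j rule: dec_induct)
  case base
  show ?case by (rule good_left)
next
  case (step n)
  let ?\<kappa> = "\<lambda>t. continuant b n t - continuant b (Suc n) t"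
  have n: "n \<le> l" using step by simp
  show ?case
  proof (rule good_transfer[of "Suc n" n ?\<kappa> _ "\<lambda>t. continuant b t (Suc n) + ?\<kappa> t"])
    show "?\<kappa> \<in> divisors (Suc n) n" using right_step[of l b n] b_ge n by blast
    show "(\<lambda>t. continuant b t (Suc n)) \<in> divisors 0 (Suc n)"
      using left_divisor[of l b "Suc n"] b_ge n by simp
    have l: "loop_divisor b n \<in> divisors 0 0" using loop_divisor[of l b n] b_ge n by blast
    show "good n (\<lambda>t. continuant b t (Suc n) + ?\<kappa> t)"
      by (rule good_add[OF good_loop[OF l] l step.IH])
        (use left_divisor[of l b n] b_ge n in \<open>auto simp: loop_divisor_def\<close>)
  qed (use step n in \<open>auto simp: base_div_def\<close>)
qed

lemma good_all:
  assumes j: "j \<le> l" and h: "h \<in> divisors 0 j"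
  shows "good j h"
proof (cases "j = 0")
  case True
  then show ?thesis using good_loop h by simp
next
  case False
  have left: "good j (\<lambda>t. continuant b t j)" and right: "good j (\<lambda>t. continuant b j t)"
  proof -
    have "good j (\<lambda>t. continuant b t j) \<and> good j (\<lambda>t. continuant b j t)"
    proof (cases "j \<le> i")
      case True
      then show ?thesis using good_base[of j] good_right_all[of j] by (simp add: base_div_def)
    next
      case False
      then show ?thesis using good_base[of j] good_left_all[of j] j by (simp add: base_div_def)
    qed
    then show "good j (\<lambda>t. continuant b t j)" "good j (\<lambda>t. continuant b j t)" by auto
  qed
  have d: "(\<lambda>t. continuant b t j) \<in> divisors 0 j" "(\<lambda>t. continuant b j t) \<in> divisors 0 j"
    using left_divisor[of l b j] right_divisor[of l b j] b_ge j by simp_all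
  have "(\<lambda>t. h t - continuant b t j) \<in> divisors 0 0 \<or>
    (\<lambda>t. h t - continuant b j t) \<in> divisors 0 0"
    using divisor_cases[of l b h j] b_ge h j False by auto
  then show ?thesis
  proof
    assume *: "(\<lambda>t. h t - continuant b t j) \<in> divisors 0 0"
    show ?thesis by (rule good_add[OF good_loop[OF *] * left d(1)]) (use j in auto)
  next
    assume *: "(\<lambda>t. h t - continuant b j t) \<in> divisors 0 0"
    show ?thesis by (rule good_add[OF good_loop[OF *] * right d(2)]) (use j in auto)
  qed
qed

text \<open>The base section at the tail brings the arrow back to the vertex 0, so that
  \<open>good_all\<close> applies to the composite as a section of the bundle at the head.\<close>

lemma arrow_normal_form:
  assumes a: "a \<in> arrows Q"
  shows "single a 1 + base (tail Q a) +
      (rep (label Q a (Suc i)) (base i) + rep (label Q a i) (base (Suc i))) \<doteq>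
    base (head Q a) + (rep (label Q a (Suc i)) right_gen + rep (label Q a i) left_gen)"
proof -
  let ?h = "\<lambda>\<rho>. int (label Q a \<rho>)" and ?t = "tail Q a"
  let ?f = "\<lambda>\<rho>. base_div ?t \<rho> + ?h \<rho>"
  have e: "?t \<le> l" "head Q a \<le> l" using arrow_ends[OF a] by auto
  have t: "base_div ?t \<in> divisors 0 ?t" using base_div_divisor e by simp
  have "path_cong Q (base ?t + edge ?t (head Q a) ?h) (edge 0 (head Q a) ?f)"
    unfolding base_def by (rule edge_add) (use e t label_divisor[OF a] in auto)
  then have "path_cong Q (base ?t + single a 1) (edge 0 (head Q a) ?f)"
    using path_cong_add2[OF path_cong_refl arrow_edge[OF a], of "base ?t"] path_cong_trans by blast
  then have "single a 1 + base ?t \<doteq> edge 0 (head Q a) ?f"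
    by (intro local_congI) (simp add: add.commute)
  from local_cong_add[OF this local_cong_refl]
  have "single a 1 + base ?t +
      (rep (label Q a (Suc i)) (base i) + rep (label Q a i) (base (Suc i))) \<doteq>
    edge 0 (head Q a) ?f + (rep (label Q a (Suc i)) (base i) + rep (label Q a i) (base (Suc i)))" .
  also have "\<dots> \<doteq> base (head Q a) + (rep (label Q a (Suc i)) right_gen + rep (label Q a i) left_gen)"
    using good_all[of "head Q a" ?f] e hom_divisors_add[OF t label_divisor[OF a]]
    by (simp add: good_def add.assoc)
  finally show ?thesis .
qed

text \<open>With \<open>f\<close> the tail or the head, this is the product of base sections that a
  monomial collects from \<open>arrow_normal_form\<close> for its arrows.\<close>

definition base_sum :: "('a \<Rightarrow> nat) \<Rightarrow> ('a \<Rightarrow>\<^sub>0 nat) \<Rightarrow> ('a \<Rightarrow>\<^sub>0 nat)" where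
  "base_sum f v = (\<Sum>a\<in>keys v. rep (lookup v a) (base (f a)))"

lemma base_sum_add: "base_sum f (u + v) = base_sum f u + base_sum f v"
  unfolding base_sum_def
  by (rule setsum_keys_plus_distrib[where f = "\<lambda>a n. rep n (base (f a))"]) (simp_all add: rep_add)

lemma base_sum_zero [simp]: "base_sum f 0 = 0"
  by (simp add: base_sum_def)

lemma base_sum_single [simp]: "base_sum f (single a (Suc 0)) = base (f a)"
  by (simp add: base_sum_def)

lemma normal_form:
  "keys v \<subseteq> arrows Q \<Longrightarrow>
    v + base_sum (tail Q) v + (rep (div_exp Q v (Suc i)) (base i) + rep (div_exp Q v i) (base (Suc i))) \<doteq>
    base_sum (head Q) v + (rep (div_exp Q v (Suc i)) right_gen + rep (div_exp Q v i) left_gen)"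
proof (induction v rule: poly_mapping_nat_induct)
  case zero
  then show ?case by (simp add: local_cong_refl)
next
  case (add a v)
  have a: "a \<in> arrows Q" and v: "keys v \<subseteq> arrows Q"
    using add.prems by (auto simp: keys_add_nat)
  from local_cong_add[OF arrow_normal_form[OF a] add.IH[OF v]]
  show ?case by (simp add: base_sum_add div_exp_add div_exp_single rep_add ac_simps)
qed

definition degree_at :: "('a \<Rightarrow> nat) \<Rightarrow> ('a \<Rightarrow>\<^sub>0 nat) \<Rightarrow> nat \<Rightarrow> nat" where
  "degree_at f v j = (\<Sum>a\<in>{a \<in> keys v. f a = j}. lookup v a)"

lemma base_sum_degree:
  assumes "\<And>a. a \<in> keys v \<Longrightarrow> f a \<le> l"
  shows "base_sum f v = (\<Sum>j\<le>l. rep (degree_at f v j) (base j))"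
proof -
  have "base_sum f v = (\<Sum>j\<le>l. \<Sum>a\<in>{a \<in> keys v. f a = j}. rep (lookup v a) (base (f a)))"
    unfolding base_sum_def by (rule sum.group[symmetric]) (use assms in auto)
  also have "\<dots> = (\<Sum>j\<le>l. rep (degree_at f v j) (base j))"
    unfolding degree_at_def rep_sum by (intro sum.cong refl) auto
  finally show ?thesis .
qed

lemma inc_exp_degree: "inc_exp Q v j = int (degree_at (head Q) v j) - int (degree_at (tail Q) v j)"
proof -
  have "(\<Sum>a\<in>keys v. int (lookup v a) * of_bool (j = f a)) = int (degree_at f v j)"
    for f :: "'a \<Rightarrow> nat"
    unfolding degree_at_def of_nat_sum sum.inter_filter[OF finite_keys] by (intro sum.cong) auto
  then show ?thesis
    by (simp add: inc_exp_def right_diff_distrib sum_subtractf)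
qed

text \<open>Equality of \<open>inc_exp\<close> fixes only heads minus tails at each vertex, so the
  tail factors of \<open>v\<close> and \<open>w\<close> may differ. Multiplying the two normal forms
  crosswise by the head factors makes the cofactors of \<open>v\<close> and \<open>w\<close> equal,
  and this common cofactor is a product of base sections, hence cancels. The coordinate factors
  depend only on \<open>div_exp\<close>.\<close>

lemma local_cong_of_same_degree:
  assumes v: "keys v \<subseteq> arrows Q" and w: "keys w \<subseteq> arrows Q"
    and inc: "inc_exp Q v = inc_exp Q w" and div: "div_exp Q v = div_exp Q w"
  shows "v \<doteq> w"
proof -
  let ?T = "base_sum (tail Q)" and ?H = "base_sum (head Q)"
  let ?X = "rep (div_exp Q v (Suc i)) (base i) + rep (div_exp Q v i) (base (Suc i))"
  let ?Y = "rep (div_exp Q v (Suc i)) right_gen + rep (div_exp Q v i) left_gen"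
  have ends: "\<And>a. a \<in> keys v \<Longrightarrow> tail Q a \<le> l \<and> head Q a \<le> l"
    "\<And>a. a \<in> keys w \<Longrightarrow> tail Q a \<le> l \<and> head Q a \<le> l"
    using v w arrow_ends by blast+
  have deg: "degree_at (tail Q) v j + degree_at (head Q) w j = degree_at (tail Q) w j + degree_at (head Q) v j" for j
    using fun_cong[OF inc, of j] by (simp add: inc_exp_degree)
  have eq: "?T v + ?H w = ?T w + ?H v"
  proof -
    have "?T v + ?H w = (\<Sum>j\<le>l. rep (degree_at (tail Q) v j + degree_at (head Q) w j) (base j))"
      using ends by (simp add: base_sum_degree rep_add sum.distrib)
    also have "\<dots> = ?T w + ?H v"
      unfolding deg using ends by (simp add: base_sum_degree rep_add sum.distrib)
    finally show ?thesis .
  qed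
  have bu: "local_unit Q U (base j)" if "j \<le> Suc l" for j
    unfolding base_def using base_unit that by simp
  have units: "local_unit Q U (?T v + ?H w + ?X)"
    unfolding base_sum_def using ends i_le
    by (intro local_unit_add local_unit_sum local_unit_rep bu) (auto intro: le_SucI)
  have "v + (?T v + ?H w + ?X) \<doteq> ?H v + ?H w + ?Y"
    using local_cong_add[OF normal_form[OF v] local_cong_refl[of Q U "?H w"]] by (simp add: ac_simps)
  also have "\<dots> \<doteq> w + (?T w + ?H v + ?X)"
    using local_cong_add[OF local_cong_sym[OF normal_form[OF w]] local_cong_refl[of Q U "?H v"]]
    by (simp add: ac_simps flip: div)
  also have "\<dots> = w + (?T v + ?H w + ?X)" by (simp add: eq)
  finally show ?thesis by (rule local_cong_cancel[OF units])
qed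

end

section \<open>Existence of a chart for every monomial of positive weight\<close>

context mckay_quiver
begin

lemma local_unit_arrow:
  assumes "a \<in> keys U"
  shows "local_unit Q U (single a 1)"
proof -
  have "path_cong Q (single a 1 + (U - single a 1)) (rep 1 U)"
    using poly_mapping_nat_remove[OF assms] by (simp add: path_cong_refl)
  then show ?thesis unfolding local_unit_def by blast
qed

lemma local_unit_path: "set as \<subseteq> keys U \<Longrightarrow> local_unit Q U (path_exp (i, as, j))"
  by (induction as)
    (auto simp: path_exp_simps(1) path_exp_simps(2)[of i _ _ j i] local_unit_zero
      intro!: local_unit_add dest: local_unit_arrow)

text \<open>A cut argument. No arrow in the support of \<open>U\<close> enters the set
  \<open>C\<close> of unreachable vertices from outside, so the net inflow into \<open>C\<close> is
  at most zero. But the weight is positive at every vertex other than 0, and 0 is reachable.\<close>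

lemma reachable:
  assumes U: "keys U \<subseteq> arrows Q" and n: "n > 0"
    and inc: "inc_exp Q U = (\<lambda>i. int n * special_weight l i)" and j: "j \<le> l"
  shows "\<exists>as. walk Q 0 as j \<and> set as \<subseteq> keys U"
proof (rule ccontr)
  assume not: "\<not> ?thesis"
  define C where "C = {j. j \<le> l \<and> \<not> (\<exists>as. walk Q 0 as j \<and> set as \<subseteq> keys U)}"
  have fin: "finite C" by (simp add: C_def)
  have jC: "j \<in> C" using not j by (simp add: C_def)
  have "walk Q 0 [] 0" using verts by simp
  then have C0: "0 \<notin> C" unfolding C_def by (metis (mono_tags, lifting) empty_set empty_subsetI mem_Collect_eq)
  have closed: "tail Q a \<in> C" if a: "a \<in> keys U" "head Q a \<in> C" for a
  proof (rule ccontr)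
    assume "tail Q a \<notin> C"
    moreover have a': "a \<in> arrows Q" "tail Q a \<le> l" "head Q a \<le> l" using a U arrow_ends by blast+
    ultimately obtain as where as: "walk Q 0 as (tail Q a)" "set as \<subseteq> keys U"
      unfolding C_def by blast
    have "walk Q (tail Q a) [a] (head Q a)" using a' verts by simp
    with as(1) have "walk Q 0 (as @ [a]) (head Q a)" by (rule walk_append)
    moreover have "set (as @ [a]) \<subseteq> keys U" using as a by simp
    ultimately show False using a(2) unfolding C_def by blast
  qed
  have "(\<Sum>i\<in>C. inc_exp Q U i) = (\<Sum>a\<in>keys U. int (lookup U a) *
      (\<Sum>i\<in>C. of_bool (i = head Q a) - of_bool (i = tail Q a)))"
    unfolding inc_exp_def by (subst sum.swap) (simp add: sum_distrib_left)
  also have "\<dots> \<le> 0"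
  proof (rule sum_nonpos, rule mult_nonneg_nonpos)
    fix a assume a: "a \<in> keys U"
    have "(\<Sum>i\<in>C. of_bool (i = head Q a) - of_bool (i = tail Q a)) =
        (of_bool (head Q a \<in> C) - of_bool (tail Q a \<in> C) :: int)"
      using fin by (simp add: sum_subtractf of_bool_def)
    also have "\<dots> \<le> 0" using closed[OF a] by auto
    finally show "(\<Sum>i\<in>C. of_bool (i = head Q a) - of_bool (i = tail Q a)) \<le> (0::int)" .
  qed simp
  finally have "(\<Sum>i\<in>C. inc_exp Q U i) \<le> 0" .
  moreover have "0 < inc_exp Q U i" if "i \<in> C" for i
  proof -
    have "i \<noteq> 0" "i \<le> l" using that C0 by (auto simp: C_def intro: gr0I)
    then show ?thesis using n by (simp add: inc special_weight_def)
  qed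
  then have "0 < (\<Sum>i\<in>C. inc_exp Q U i)" using fin jC by (intro sum_pos) auto
  ultimately show False by simp
qed

text \<open>The index is the largest \<open>i\<close> for which alpha_i is invertible. Smaller ones
  follow since alpha_m divides alpha_(m+1). For larger \<open>j\<close>, a path to \<open>j\<close>
  in the support of \<open>U\<close> is invertible and divisible by alpha_j or beta_j, so beta_j
  must be invertible.\<close>

lemma chart_exists:
  assumes U: "keys U \<subseteq> arrows Q" and n: "n > 0"
    and inc: "inc_exp Q U = (\<lambda>i. int n * special_weight l i)"
  obtains i where "mckay_chart Q l b U i"
proof -
  let ?\<alpha> = "\<lambda>j. edge 0 j (\<lambda>t. continuant b t j)" and ?\<beta> = "\<lambda>j. edge 0 j (\<lambda>t. continuant b j t)"
  have cases: "local_unit Q U (?\<alpha> j) \<or> local_unit Q U (?\<beta> j)" if j: "j \<in> {1..l}" for j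
  proof -
    obtain as where as: "walk Q 0 as j" "set as \<subseteq> keys U"
      using reachable[OF U n inc] j by auto
    let ?h = "\<lambda>\<rho>. int (div_path Q (0, as, j) \<rho>)"
    have h: "?h \<in> divisors 0 j" by (rule walk_divisor[OF as(1)])
    have "path_cong Q (path_exp (vtx 0, as, vtx j)) (edge 0 j ?h)"
      by (rule edge_eqI) (use j h as in auto)
    then have u: "local_unit Q U (edge 0 j ?h)"
      by (rule local_unit_cong[OF local_unit_path[OF as(2)]])
    have split: "local_unit Q U (edge 0 j g)"
      if g: "g \<in> divisors 0 j" "(\<lambda>t. ?h t - g t) \<in> divisors 0 0" for g
    proof -
      have "path_cong Q (edge 0 0 (\<lambda>t. ?h t - g t) + edge 0 j g) (edge 0 j ?h)"
        by (rule edge_add) (use j g in auto)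
      from local_unit_addD(2)[OF local_unit_cong[OF u path_cong_sym[OF this]]] show ?thesis .
    qed
    have "(\<lambda>t. ?h t - continuant b t j) \<in> divisors 0 0 \<or>
      (\<lambda>t. ?h t - continuant b j t) \<in> divisors 0 0"
      by (rule divisor_cases[of l b]) (use b_ge h j in auto)
    then show ?thesis
      using split left_divisor[of l b j] right_divisor[of l b j] b_ge j by auto
  qed
  \<comment> \<open>The bound \<open>l\<close> makes the maximum the index of a cone. The set
    contains \<open>0\<close>, because alpha_0 has the zero divisor.\<close>
  define A where "A = {j. j \<le> l \<and> local_unit Q U (?\<alpha> j)}"
  have zero: "local_unit Q U (edge 0 j h)" if "\<And>\<rho>. \<rho> \<le> l + 1 \<Longrightarrow> h \<rho> = 0" "j = 0 \<or> j = Suc l" for h j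
  proof -
    have "path_cong Q (edge 0 0 h) 0" by (rule edge_zero) (use that in auto)
    then have "local_unit Q U (edge 0 0 h)" by (rule local_unit_cong[OF local_unit_zero path_cong_sym])
    then show ?thesis using that(2) edge_0_last by auto
  qed
  have A: "finite A" "0 \<in> A" using zero[of "\<lambda>t. continuant b t 0" 0] by (auto simp: A_def)
  define i where "i = Max A"
  have i: "i \<in> A" unfolding i_def using Max_in[OF A(1)] A(2) by blast
  have i_max: "j \<le> i" if "j \<in> A" for j unfolding i_def using A(1) that by (rule Max_ge)
  have il: "i \<le> l" using i by (simp add: A_def)
  have left: "local_unit Q U (?\<alpha> j)" if "j \<le> i" for j
    using that
  proof (induction j rule: inc_induct)
    case base
    then show ?case using i by (simp add: A_def)
  next
    case (step m)
    have "path_cong Q (?\<alpha> m + edge m (Suc m) (\<lambda>t. continuant b t (Suc m) - continuant b t m)) (?\<alpha> (Suc m))"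
      by (rule edge_add)
        (use step il left_divisor[of l b m] left_step[of l b m] b_ge in auto)
    from local_unit_addD(1)[OF local_unit_cong[OF step.IH path_cong_sym[OF this]]] show ?case .
  qed
  have "local_unit Q U (edge 0 j (if j \<le> i then (\<lambda>t. continuant b t j) else (\<lambda>t. continuant b j t)))"
    if j: "j \<le> l + 1" for j
  proof (cases "j \<le> i")
    case True
    then show ?thesis using left by simp
  next
    case False
    show ?thesis
    \<comment> \<open>beta_(l+1) vanishes on all rays up to \<open>l + 1\<close>, so its path is
      congruent to the trivial one.\<close>
    proof (cases "j = l + 1")
      case True
      then show ?thesis using False zero[of "\<lambda>t. continuant b (Suc l) t" "Suc l"] by simp
    next
      case False
      then have "j \<in> {1..l}" "j \<notin> A" using \<open>\<not> j \<le> i\<close> j i_max[of j] by auto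
      then show ?thesis using cases[of j] \<open>\<not> j \<le> i\<close> by (auto simp: A_def)
    qed
  qed
  then have "mckay_chart Q l b U i"
    by (intro mckay_chart.intro mckay_quiver_axioms mckay_chart_axioms.intro il)
  then show ?thesis by (rule that)
qed

theorem moduli_isomorphic:
  "isomorphic_over_field
     (moduli_space Q (special_weight l) :: (('a, 'k::field) mpoly set, 'k) proj_space)
     (git_quotient Q (special_weight l) (ideal_I_Q Q :: ('a, 'k) mpoly set))"
  unfolding moduli_space_def
proof (rule isomorphic_quotients)
  show "ideal (ideal_I_R Q) (arrow_polys Q :: ('a, 'k) mpoly ring)" by (rule ideal_I_R_ideal)
  show "ideal_I_R Q \<subseteq> (ideal_I_Q Q :: ('a, 'k) mpoly set)"
    by (rule ideal_I_R_subset_ideal_I_Q) (simp add: verts)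
  fix u v w n
  assume u: "keys u \<subseteq> arrows Q" "(0::nat) < n" "inc_exp Q u = (\<lambda>i. int n * special_weight l i)"
    and vw: "keys v \<subseteq> arrows Q" "keys w \<subseteq> arrows Q"
      "inc_exp Q v = inc_exp Q w" "div_exp Q v = div_exp Q w"
  obtain i where "mckay_chart Q l b u i" using chart_exists[OF u] .
  then have "local_cong Q u v w" using vw by (rule mckay_chart.local_cong_of_same_degree)
  then obtain N where N: "path_cong Q (v + rep N u) (w + rep N u)" by (auto simp: local_cong_def)
  have "keys (rep N u) \<subseteq> arrows Q"
    using u(1) by (induction N) (auto simp: keys_add_nat)
  then have "monomial (v + rep N u) - monomial (w + rep N u) \<in> (ideal_I_R Q :: ('a, 'k) mpoly set)"
    using path_cong_ideal[OF N] vw by (simp add: keys_add_nat)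
  moreover have "monomial (v + rep N u) - monomial (w + rep N u) =
      (monomial u ^ N * (monomial v - monomial w) :: ('a, 'k) mpoly)"
    by (simp add: monomial_rep right_diff_distrib mult.commute flip: monomial_mult)
  ultimately show "\<exists>N. monomial u ^ N * (monomial v - monomial w) \<in> (ideal_I_R Q :: ('a, 'k) mpoly set)"
    by auto
qed

end

section \<open>The toric surface\<close>

text \<open>By \<open>uniq\<close> only one pair of exponents contributes to this coefficient, so no
  cancellation occurs. It is applied to lexicographically maximal exponents.\<close>

lemma lookup_mult_extremal:
  fixes f g :: "(int \<times> int) \<Rightarrow>\<^sub>0 'k::comm_ring_1"
  assumes "a \<in> keys f" "c \<in> keys g"
    and uniq: "\<And>x y. x \<in> keys f \<Longrightarrow> y \<in> keys g \<Longrightarrow> x + y = a + c \<Longrightarrow> x = a \<and> y = c"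
  shows "lookup (f * g) (a + c) = lookup f a * lookup g c"
proof -
  have single: "lookup h t = lin (\<lambda>u. of_bool (u = t)) h" for h :: "(int \<times> int) \<Rightarrow>\<^sub>0 'k" and t
    by (auto simp: lin_def of_bool_def if_distrib in_keys_iff cong: if_cong)
  have "lookup (f * g) (a + c) =
      (\<Sum>x\<in>keys f. lookup f x *
        (\<Sum>y\<in>keys g. lookup g y * of_bool (x + y = a + c)))"
    unfolding single lin_mult by (simp add: lin_def)
  also have "\<dots> = (\<Sum>x\<in>keys f. lookup f x *
        (\<Sum>y\<in>keys g. if y = c then lookup g y * of_bool (x = a) else 0))"
  proof (rule sum.cong[OF refl], rule arg_cong2[where f = "(*)"], rule refl, rule sum.cong[OF refl])
    fix x y assume "x \<in> keys f" "y \<in> keys g"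
    then show "lookup g y * of_bool (x + y = a + c) =
        (if y = c then lookup g y * of_bool (x = a) else 0)"
      using uniq[of x y] by auto
  qed
  also have "\<dots> = lookup f a * lookup g c"
  proof -
    have "(\<Sum>y\<in>keys g. if y = c then lookup g y * of_bool (x = a) else 0) =
        lookup g c * of_bool (x = a)" for x
      using assms(2) by simp
    moreover have "(\<Sum>x\<in>keys f. lookup f x * (lookup g c * of_bool (x = a))) =
        (\<Sum>x\<in>keys f. if x = a then lookup f x * lookup g c else 0)"
      by (rule sum.cong) auto
    ultimately show ?thesis using assms(1) by simp
  qed
  finally show ?thesis .
qed

lemma lex_maximal_exists:
  fixes P0 P1 :: "'m \<Rightarrow> int"
  assumes "finite F" "F \<noteq> {}"
  obtains a where "a \<in> F" "\<And>x. x \<in> F \<Longrightarrow> P0 x < P0 a \<or> P0 x = P0 a \<and> P1 x \<le> P1 a"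
proof -
  define F' where "F' = {x \<in> F. P0 x = Max (P0 ` F)}"
  have "Max (P0 ` F) \<in> P0 ` F" using assms by (intro Max_in) auto
  then obtain z where "z \<in> F" "P0 z = Max (P0 ` F)" by auto
  then have F': "finite F'" "F' \<noteq> {}" using assms(1) unfolding F'_def by auto
  then have "Max (P1 ` F') \<in> P1 ` F'" by (intro Max_in) auto
  then obtain a where a: "a \<in> F'" "P1 a = Max (P1 ` F')" by auto
  have "P0 x < P0 a \<or> P0 x = P0 a \<and> P1 x \<le> P1 a" if x: "x \<in> F" for x
  proof (cases "P0 x = P0 a")
    case True
    then have "x \<in> F'" using a x by (simp add: F'_def)
    then show ?thesis using True a(2) F'(1) by simp
  next
    case False
    have "P0 x \<le> P0 a" using x a(1) assms(1) by (simp add: F'_def)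
    then show ?thesis using False by simp
  qed
  moreover have "a \<in> F" using a(1) by (simp add: F'_def)
  ultimately show ?thesis using that by blast
qed

lemma poly_mapping_eq_single:
  assumes "keys f \<subseteq> {m}"
  shows "f = single m (lookup f m)"
  using assms by (intro poly_mapping_eqI) (auto simp: lookup_single when_def in_keys_iff)

text \<open>In characteristic zero \<open>2\<close> has infinite multiplicative order. The torus
  points \<open>(2, 1)\<close> and \<open>(1, 2)\<close> therefore separate Laurent
  monomials.\<close>

lemma power_int_two_inj:
  fixes m n :: int
  assumes "(2::'k::field_char_0) powi m = 2 powi n"
  shows "m = n"
proof -
  have *: "i \<le> j" if "(2::'k) powi j = 2 powi i" for i j
  proof (rule ccontr)
    assume "\<not> i \<le> j"
    then obtain d where d: "i = j + int d" "d > 0" by (intro that[of "nat (i - j)"]) auto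
    then have "(2::'k) powi j * 2 ^ d = 2 powi j * 1" using that by (simp add: power_int_add)
    then have "(2::'k) ^ d = 1" by simp
    then have "of_nat (2 ^ d) = (of_nat 1 :: 'k)" by simp
    then have "(2::nat) ^ d = 1" by (simp only: of_nat_eq_iff)
    then show False using d by simp
  qed
  show ?thesis using *[of n m] *[of m n] assms by simp
qed

lemma lookup_torus_act:
  "lookup (torus_act t f) m = fst t powi fst m * snd t powi snd m * lookup f m"
  by (auto simp: torus_act_def lookup_mapp when_def in_keys_iff)

lemma pair_add: "pair (m + n) u = pair m u + pair n u"
  by (simp add: pair_def algebra_simps)

lemma pair_uminus: "pair (- m) u = - pair m u"
  by (simp add: pair_def algebra_simps)

lemma pair_zero [simp]: "pair 0 u = 0"
  by (simp add: pair_def)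

lemma pair_add_right: "pair m (u + v) = pair m u + pair m v"
  by (simp add: pair_def algebra_simps)

lemma pair_scaleR_right: "pair m (c *\<^sub>R u) = c * pair m u"
  by (simp add: pair_def algebra_simps)

lemma power_int_eq_one_iff:
  fixes \<omega> :: "'k::field"
  assumes \<omega>: "primitive_root r \<omega>" and r: "r > 0"
  shows "\<omega> powi n = 1 \<longleftrightarrow> int r dvd n"
proof -
  have \<omega>r: "\<omega> ^ r = 1" using \<omega> by (simp add: primitive_root_def)
  then have nz: "\<omega> \<noteq> 0" using r by (auto simp: power_0_left)
  have "\<omega> powi n = \<omega> powi (int r * (n div int r)) * \<omega> powi (n mod int r)"
    using nz by (simp flip: power_int_add)
  also have "\<omega> powi (int r * (n div int r)) = 1" by (simp add: power_int_mult \<omega>r)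
  also have "\<omega> powi (n mod int r) = \<omega> ^ nat (n mod int r)"
    using r by (subst power_int_of_nat[symmetric]) simp
  finally have eq: "\<omega> powi n = \<omega> ^ nat (n mod int r)" by simp
  have "nat (n mod int r) < r" using r by (simp add: nat_less_iff)
  then have "\<omega> ^ nat (n mod int r) = 1 \<longleftrightarrow> nat (n mod int r) = 0"
    using \<omega> unfolding primitive_root_def by (metis gr0I power_0)
  also have "\<dots> \<longleftrightarrow> int r dvd n"
  proof -
    have "0 \<le> n mod int r" using r by simp
    then show ?thesis unfolding dvd_eq_mod_eq_0 by linarith
  qed
  finally show ?thesis using eq by simp
qed

lemma invariant_monomials_cyclic:
  fixes \<omega> :: "'k::field"
  assumes \<omega>: "primitive_root r \<omega>" and r: "r > 0"
  shows "m \<in> invariant_monomials (cyclic_diag \<omega> a) \<longleftrightarrow> int r dvd fst m + a * snd m"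
proof -
  have nz: "\<omega> \<noteq> 0" using \<omega> r by (auto simp: primitive_root_def power_0_left)
  have "(\<omega> powi n) powi fst m * ((\<omega> powi a) powi n) powi snd m = \<omega> powi (n * (fst m + a * snd m))" for n
    using nz by (simp add: power_int_add power_int_mult[symmetric] algebra_simps)
  then have "m \<in> invariant_monomials (cyclic_diag \<omega> a) \<longleftrightarrow> (\<forall>n. int r dvd n * (fst m + a * snd m))"
    by (auto simp: invariant_monomials_def cyclic_diag_def power_int_eq_one_iff[OF \<omega> r])
  also have "\<dots> \<longleftrightarrow> int r dvd fst m + a * snd m" by (auto dest: spec[of _ 1])
  finally show ?thesis .
qed

section \<open>Rays, lattice bases and wall relations\<close>

definition ray_det :: "real \<times> real \<Rightarrow> real \<times> real \<Rightarrow> real" where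
  "ray_det u v = fst v * snd u - fst u * snd v"

locale cyclic_resolution =
  fixes r :: nat and a :: int and \<omega> :: "'k::field_char_0" and X :: toric_surface
  assumes r: "r > 0" and \<omega>: "primitive_root r \<omega>"
    and res: "minimal_resolution (cyclic_diag \<omega> a) X"
begin

lemma chars_iff: "m \<in> chars X \<longleftrightarrow> int r dvd fst m + a * snd m"
  using res invariant_monomials_cyclic[OF \<omega> r] by (simp add: minimal_resolution_def)

lemma chars_zero: "0 \<in> chars X"
  by (simp add: chars_iff)

lemma chars_uminus: "m \<in> chars X \<Longrightarrow> - m \<in> chars X"
  using dvd_minus_iff[of "int r" "fst m + a * snd m"] by (simp add: chars_iff del: dvd_minus_iff)

lemma chars_add: "m \<in> chars X \<Longrightarrow> n \<in> chars X \<Longrightarrow> m + n \<in> chars X"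
  using dvd_add[of "int r" "fst m + a * snd m" "fst n + a * snd n"] by (simp add: chars_iff algebra_simps)

lemma ray_nonneg: "i \<le> ell X + 1 \<Longrightarrow> 0 \<le> fst (ray X i) \<and> 0 \<le> snd (ray X i)"
  using res by (simp add: minimal_resolution_def)

lemma det_pos: "i \<le> ell X \<Longrightarrow> 0 < ray_det (ray X i) (ray X (i + 1))"
  using res by (simp add: minimal_resolution_def ray_det_def)

lemma lattice_basis:
  "i \<le> ell X \<Longrightarrow> dual_lattice (chars X) =
    {of_int x *\<^sub>R ray X i + of_int y *\<^sub>R ray X (i + 1) | x y. True}"
  using res unfolding minimal_resolution_def by blast

lemma ray_lattice:
  assumes "\<rho> \<le> ell X + 1"
  shows "ray X \<rho> \<in> dual_lattice (chars X)"
proof (cases "\<rho> \<le> ell X")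
  case True
  have "ray X \<rho> = of_int 1 *\<^sub>R ray X \<rho> + of_int 0 *\<^sub>R ray X (\<rho> + 1)" by simp
  then show ?thesis unfolding lattice_basis[OF True] by blast
next
  case False
  then have \<rho>: "\<rho> = ell X + 1" using assms by simp
  have "ray X \<rho> = of_int 0 *\<^sub>R ray X (ell X) + of_int 1 *\<^sub>R ray X (ell X + 1)" by (simp add: \<rho>)
  then show ?thesis unfolding lattice_basis[OF order_refl] by blast
qed

definition val :: "int \<times> int \<Rightarrow> nat \<Rightarrow> int" where "val m \<rho> = \<lfloor>pair m (ray X \<rho>)\<rfloor>"

lemma val_zero [simp]: "val 0 \<rho> = 0"
  by (simp add: val_def)

lemma val_pair: "m \<in> chars X \<Longrightarrow> \<rho> \<le> ell X + 1 \<Longrightarrow> of_int (val m \<rho>) = pair m (ray X \<rho>)"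
  using ray_lattice[of \<rho>] by (auto simp: val_def dual_lattice_def elim!: Ints_cases)

lemma val_add: "m \<in> chars X \<Longrightarrow> n \<in> chars X \<Longrightarrow> \<rho> \<le> ell X + 1 \<Longrightarrow> val (m + n) \<rho> = val m \<rho> + val n \<rho>"
  using val_pair[of m \<rho>] val_pair[of n \<rho>] val_pair[OF chars_add, of m n \<rho>]
  by (simp add: pair_add flip: of_int_add)

lemma val_uminus: "m \<in> chars X \<Longrightarrow> \<rho> \<le> ell X + 1 \<Longrightarrow> val (- m) \<rho> = - val m \<rho>"
  using val_pair[of m \<rho>] val_pair[OF chars_uminus, of m \<rho>]
  by (simp add: pair_uminus flip: of_int_minus)

lemma pair_zero_imp:
  assumes i: "i \<le> ell X" and m: "pair m (ray X i) = 0" "pair m (ray X (i + 1)) = 0"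
  shows "m = 0"
proof -
  obtain p q where m': "m = (p, q)" by (cases m)
  let ?u = "ray X i" and ?v = "ray X (i + 1)"
  have "of_int p * ray_det ?u ?v = pair m ?v * snd ?u - pair m ?u * snd ?v"
    "of_int q * ray_det ?u ?v = fst ?v * pair m ?u - fst ?u * pair m ?v"
    by (simp_all add: m' pair_def ray_det_def algebra_simps)
  then have "of_int p = (0::real)" "of_int q = (0::real)" using m det_pos[OF i] by simp_all
  then show ?thesis by (simp add: m' zero_prod_def)
qed

lemma val_inj:
  assumes "m \<in> chars X" "n \<in> chars X" "val m 0 = val n 0" "val m 1 = val n 1"
  shows "m = n"
proof -
  have "pair (m - n) (ray X i) = 0" if "val m i = val n i" "i \<le> ell X + 1" for i
    using val_pair[OF assms(1), of i] val_pair[OF assms(2), of i] that pair_add[of "m - n" n "ray X i"] by simp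
  from this[of 0] this[of 1] have "m - n = 0" using assms pair_zero_imp[of 0 "m - n"] by simp
  then show ?thesis by simp
qed

text \<open>Expanding each outer ray in the basis formed by the other two rays gives integers with
  \<open>t * x = 1\<close>, and the common orientation of the two cones makes \<open>x\<close>
  negative, so \<open>x = -1\<close>. The coefficient \<open>y\<close> of the middle ray is positive
  because all rays lie in the quadrant and the first is nonzero; minimality excludes
  \<open>y = 1\<close>.\<close>

lemma wall_relation:
  assumes j: "j \<in> {1..ell X}"
  shows "ray X (j - 1) + ray X (j + 1) = of_int (- self_int X j) *\<^sub>R ray X j"
    and "2 \<le> - self_int X j"
proof -
  obtain k where k: "j = k + 1" "k + 1 \<le> ell X" using j by (cases j) auto
  let ?u = "ray X k" and ?v = "ray X (k + 1)" and ?w = "ray X (k + 2)"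
  have duv: "0 < ray_det ?u ?v" and dvw: "0 < ray_det ?v ?w"
    using det_pos[of k] det_pos[of "k + 1"] k by simp_all
  have "?w \<in> dual_lattice (chars X)" using ray_lattice[of "k + 2"] k by simp
  then obtain x y where w: "?w = of_int x *\<^sub>R ?u + of_int y *\<^sub>R ?v"
    using lattice_basis[of k] k by auto
  have "?u \<in> dual_lattice (chars X)" using ray_lattice[of k] k by simp
  then obtain s t where u: "?u = of_int s *\<^sub>R ?v + of_int t *\<^sub>R ?w"
    using lattice_basis[of "k + 1"] k by auto
  have 1: "ray_det ?v ?w = - of_int x * ray_det ?u ?v"
    by (subst w) (simp add: ray_det_def algebra_simps)
  have "ray_det ?u ?v = - of_int t * ray_det ?v ?w"
    by (subst u) (simp add: ray_det_def algebra_simps)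
  then have "ray_det ?u ?v = of_int (t * x) * ray_det ?u ?v" unfolding 1 by simp
  then have "(of_int (t * x) - 1) * ray_det ?u ?v = 0" by (simp only: left_diff_distrib mult_1 diff_self)
  then have "of_int (t * x) - (1::real) = 0" using duv by (simp only: mult_eq_0_iff) simp
  then have "of_int (t * x) = (of_int 1 :: real)" by simp
  then have "t * x = 1" by (simp only: of_int_eq_iff)
  moreover have "x < 0" using 1 duv dvw by (simp add: mult_less_0_iff)
  ultimately have "x = -1" using zmult_eq_1_iff[of t x] by linarith
  then have uw: "?u + ?w = of_int y *\<^sub>R ?v" using w by simp
  have v0: "?v \<noteq> 0" using duv by (auto simp: ray_det_def)
  have self: "self_int X j = - y"
    unfolding self_int_def
  proof (rule the_equality)
    show "ray X (j - 1) + ray X (j + 1) + of_int (- y) *\<^sub>R ray X j = 0"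
      using uw by (simp add: k)
    fix d assume "ray X (j - 1) + ray X (j + 1) + of_int d *\<^sub>R ray X j = 0"
    then have "of_int (y + d) *\<^sub>R ?v = 0" using uw by (simp add: k scaleR_left_distrib)
    then have "of_int (y + d) = (0::real)" using v0 by (simp only: scaleR_eq_0_iff) simp
    then show "d = - y" by linarith
  qed
  show "ray X (j - 1) + ray X (j + 1) = of_int (- self_int X j) *\<^sub>R ray X j"
    using uw self by (simp add: k)
  have "self_int X j \<noteq> -1" using res j by (simp add: minimal_resolution_def)
  then have "y \<noteq> 1" using self by simp
  moreover have "0 < y"
  proof (rule ccontr)
    assume "\<not> 0 < y"
    then have "of_int y \<le> (0::real)" by simp
    have nn: "0 \<le> fst ?u" "0 \<le> snd ?u" "0 \<le> fst ?v" "0 \<le> snd ?v" "0 \<le> fst ?w" "0 \<le> snd ?w"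
      using ray_nonneg[of k] ray_nonneg[of "k + 1"] ray_nonneg[of "k + 2"] k by auto
    have "fst ?u + fst ?w = of_int y * fst ?v" "snd ?u + snd ?w = of_int y * snd ?v"
      using arg_cong[OF uw, of fst] arg_cong[OF uw, of snd] by simp_all
    moreover have "of_int y * fst ?v \<le> 0" "of_int y * snd ?v \<le> 0"
      using \<open>of_int y \<le> (0::real)\<close> nn by (simp_all add: mult_nonpos_nonneg)
    ultimately have "fst ?u = 0" "snd ?u = 0" using nn by linarith+
    then show False using duv by (simp add: ray_det_def)
  qed
  ultimately show "2 \<le> - self_int X j" using self by simp
qed

abbreviation neg_self :: "nat \<Rightarrow> int" where "neg_self \<equiv> \<lambda>j. - self_int X j"

text \<open>Principal divisors have degree zero on every exceptional curve.\<close>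

lemma second_diff_val:
  assumes m: "m \<in> chars X" and k: "k \<in> {1..ell X}"
  shows "second_diff neg_self (val m) k = 0"
proof -
  have sum: "pair m (ray X (k - 1)) + pair m (ray X (k + 1)) = of_int (neg_self k) * pair m (ray X k)"
    using arg_cong[OF wall_relation(1)[OF k], of "pair m"]
    by (simp only: pair_add_right pair_scaleR_right)
  have "of_int (val m (k - 1)) + of_int (val m (k + 1)) = (of_int (neg_self k * val m k) :: real)"
  proof -
    have "k - 1 \<le> ell X + 1" "k \<le> ell X + 1" "k + 1 \<le> ell X + 1" using k by auto
    then show ?thesis using val_pair[OF m] sum by simp
  qed
  then have "val m (k - 1) + val m (k + 1) = neg_self k * val m k"
    by (simp only: of_int_add[symmetric] of_int_eq_iff)
  then show ?thesis by (simp add: second_diff_def)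
qed

text \<open>The values on the first two rays define a linear form by Cramer's rule. Those rays are a
  basis of the dual lattice, so the form is integral there; that it is an invariant monomial is
  biduality of the lattice, checked on three vectors.\<close>

lemma char_exists:
  fixes p q :: int
  obtains m where "m \<in> chars X" "val m 0 = p" "val m 1 = q"
proof -
  let ?u = "ray X 0" and ?v = "ray X 1"
  define d where "d = ray_det ?u ?v"
  have d: "d > 0" using det_pos[of 0] by (simp add: d_def)
  define x where "x = (of_int q * snd ?u - of_int p * snd ?v) / d"
  define y where "y = (of_int p * fst ?v - of_int q * fst ?u) / d"
  have d': "fst ?v * snd ?u - fst ?u * snd ?v = d" by (simp add: d_def ray_det_def)
  have xd: "x * d = of_int q * snd ?u - of_int p * snd ?v"
    and yd: "y * d = of_int p * fst ?v - of_int q * fst ?u"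
    using d by (simp_all add: x_def y_def)
  have "(x * fst ?u + y * snd ?u) * d = (x * d) * fst ?u + (y * d) * snd ?u" by (simp add: algebra_simps)
  also have "\<dots> = of_int p * d" unfolding xd yd unfolding d'[symmetric] by (simp add: algebra_simps)
  finally have xu: "x * fst ?u + y * snd ?u = of_int p" using d by simp
  have "(x * fst ?v + y * snd ?v) * d = (x * d) * fst ?v + (y * d) * snd ?v" by (simp add: algebra_simps)
  also have "\<dots> = of_int q * d" unfolding xd yd unfolding d'[symmetric] by (simp add: algebra_simps)
  finally have xv: "x * fst ?v + y * snd ?v = of_int q" using d by simp
  have int: "x * fst n + y * snd n \<in> \<int>" if "n \<in> dual_lattice (chars X)" for n
  proof -
    from that obtain s t where n: "n = of_int s *\<^sub>R ?u + of_int t *\<^sub>R ?v"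
      using lattice_basis[of 0] by auto
    have "x * fst n + y * snd n = of_int s * (x * fst ?u + y * snd ?u) + of_int t * (x * fst ?v + y * snd ?v)"
      by (simp add: n algebra_simps)
    also have "\<dots> \<in> \<int>" unfolding xu xv by simp
    finally show ?thesis .
  qed
  have "x \<in> \<int>" using int[of "(1, 0)"] by (simp add: dual_lattice_def pair_def)
  moreover have "y \<in> \<int>" using int[of "(0, 1)"] by (simp add: dual_lattice_def pair_def)
  ultimately obtain x' y' where xy: "x = of_int x'" "y = of_int y'" by (auto elim!: Ints_cases)
  \<comment> \<open>The lattice vector of the group generator diag(omega, omega^a): integrality on
    it is exactly the congruence that defines \<open>chars X\<close>.\<close>
  have "(1 / of_nat r, of_int a / of_nat r) \<in> dual_lattice (chars X)"
  proof -
    have "pair m (1 / of_nat r, of_int a / of_nat r) \<in> \<int>" if "m \<in> chars X" for m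
    proof -
      obtain c where "fst m + a * snd m = int r * c" using \<open>m \<in> chars X\<close> by (auto simp: chars_iff)
      then have "of_int (fst m + a * snd m) = (of_int (int r * c) :: real)" by simp
      then have "pair m (1 / of_nat r, of_int a / of_nat r) = of_int c"
        using r by (simp add: pair_def field_simps)
      then show ?thesis by simp
    qed
    then show ?thesis by (simp add: dual_lattice_def)
  qed
  from int[OF this] obtain c where c: "x * (1 / of_nat r) + y * (of_int a / of_nat r) = of_int c"
    by (auto elim!: Ints_cases)
  then have "of_int (x' + a * y') = (of_int (int r * c) :: real)" using r by (simp add: xy field_simps)
  then have "x' + a * y' = int r * c" by (simp only: of_int_eq_iff)
  then have m: "(x', y') \<in> chars X" by (simp add: chars_iff)
  have "of_int (val (x', y') 0) = (of_int p :: real)" "of_int (val (x', y') 1) = (of_int q :: real)"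
    using val_pair[OF m, of 0] val_pair[OF m, of 1] xu xv by (simp_all add: pair_def xy)
  then show ?thesis using that[OF m] by simp
qed

section \<open>Invariant sections are monomials\<close>

lemma ord_single: "c \<noteq> 0 \<Longrightarrow> ord_along X \<rho> (single m c) = val m \<rho>"
  by (simp add: ord_along_def val_def)

lemma single_eq_zero_iff: "single m c = 0 \<longleftrightarrow> c = 0"
  by (metis lookup_single_eq lookup_zero single_zero)

lemma H0_single:
  "c \<noteq> 0 \<Longrightarrow> single m c \<in> H0 X D \<longleftrightarrow> m \<in> chars X \<and> (\<forall>\<rho>\<le>ell X + 1. 0 \<le> val m \<rho> + D \<rho>)"
  by (auto simp: H0_def ord_single single_eq_zero_iff)

lemma torus_act_single:
  "torus_act t (single m c) = single m (fst t powi fst m * snd t powi snd m * c)"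
  by (rule poly_mapping_eqI) (simp add: lookup_torus_act lookup_single when_def)

lemma invariant_section_single:
  fixes c :: 'k
  assumes c: "c \<noteq> 0" and H0: "single m c \<in> H0 X D"
  shows "invariant_section X D (single m c)"
proof -
  have "same_divisor X (single m c) (torus_act (t1, t2) (single m c))"
    if t: "t1 \<noteq> 0" "t2 \<noteq> 0" for t1 t2 :: 'k
    unfolding same_divisor_def
  proof (intro allI impI)
    fix i
    let ?e = "t1 powi fst m * t2 powi snd m"
    have e: "?e \<noteq> 0" using t by simp
    have chart: "single 0 x \<in> chart_ring X i" for x :: 'k
      using chars_zero by (auto simp: chart_ring_def)
    show "\<exists>u\<in>chart_ring X i. \<exists>w\<in>chart_ring X i.
        u * w = 1 \<and> torus_act (t1, t2) (single m c) = u * single m c"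
      using e by (intro bexI[OF _ chart[of ?e]] bexI[OF _ chart[of "1 / ?e"]])
        (simp add: torus_act_single mult_single)
  qed
  then show ?thesis using c H0 by (simp add: invariant_section_def single_eq_zero_iff)
qed

text \<open>On the chart of the first cone a torus element multiplies \<open>s\<close> by a unit
  that preserves its set of exponents, which forces the unit to be constant. So all exponents of
  \<open>s\<close> give the same character value at every torus point, and the points with
  coordinates \<open>2\<close> and \<open>1\<close> leave room for only one exponent.\<close>

lemma invariant_section_monomial:
  fixes s :: "'k laurent"
  assumes "invariant_section X D s"
  obtains m c where "s = single m c" "c \<noteq> 0" "m \<in> chars X"
proof -
  have s: "s \<noteq> 0" "keys s \<subseteq> chars X"
    using assms by (auto simp: invariant_section_def H0_def)
  have scalar: "\<exists>c. torus_act (t1, t2) s = single 0 c * s"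
    if t: "t1 \<noteq> 0" "t2 \<noteq> 0" for t1 t2 :: 'k
  proof -
    obtain u where u: "u \<in> chart_ring X 0" "torus_act (t1, t2) s = u * s"
      using assms t unfolding invariant_section_def same_divisor_def by blast
    have keys: "keys (u * s) = keys s"
      unfolding u(2)[symmetric] using t by (auto simp: in_keys_iff lookup_torus_act)
    have s0: "keys s \<noteq> {}" using s(1) by simp
    then have u0: "u \<noteq> 0" using keys by (metis keys_zero mult_zero_left)
    have uk: "x \<in> chars X" "0 \<le> val x 0" "0 \<le> val x 1" if "x \<in> keys u" for x
      using u(1) that by (auto simp: chart_ring_def val_def)
    obtain p where p: "p \<in> keys u"
      "\<And>x. x \<in> keys u \<Longrightarrow> val x 0 < val p 0 \<or> val x 0 = val p 0 \<and> val x 1 \<le> val p 1"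
      using lex_maximal_exists[of "keys u" "\<lambda>x. val x 0" "\<lambda>x. val x 1"] u0 by auto
    obtain q where q: "q \<in> keys s"
      "\<And>x. x \<in> keys s \<Longrightarrow> val x 0 < val q 0 \<or> val x 0 = val q 0 \<and> val x 1 \<le> val q 1"
      using lex_maximal_exists[of "keys s" "\<lambda>x. val x 0" "\<lambda>x. val x 1"] s by auto
    have pc: "p \<in> chars X" and qc: "q \<in> chars X" using uk p q s by blast+
    have "lookup (u * s) (p + q) = lookup u p * lookup s q"
    proof (rule lookup_mult_extremal[OF p(1) q(1)])
      fix x y assume xy: "x \<in> keys u" "y \<in> keys s" "x + y = p + q"
      have xc: "x \<in> chars X" and yc: "y \<in> chars X" using xy uk s by blast+
      have "val x i + val y i = val p i + val q i" if "i \<le> ell X + 1" for i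
        using val_add[OF xc yc that] val_add[OF pc qc that] xy(3) by simp
      from this[of 0] this[of 1] have "val x 0 = val p 0" "val x 1 = val p 1"
        using p(2)[OF xy(1)] q(2)[OF xy(2)] by auto
      then have "x = p" using val_inj xc pc by blast
      then show "x = p \<and> y = q" using xy(3) by simp
    qed
    then have "p + q \<in> keys s"
      unfolding keys[symmetric] using p(1) q(1) by (simp add: in_keys_iff)
    \<comment> \<open>\<open>p + q\<close> is an exponent of \<open>s\<close> and cannot exceed the
      maximum \<open>q\<close>, while \<open>p\<close> has nonnegative values on both rays. The
      largest exponent of \<open>u\<close> is therefore \<open>0\<close>, and nonnegativity leaves
      no other.\<close>
    from q(2)[OF this] have "val p 0 = 0" "val p 1 \<le> 0"
      using val_add[OF pc qc, of 0] val_add[OF pc qc, of 1] uk[OF p(1)] by auto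
    then have "x = 0" if "x \<in> keys u" for x
      using p(2)[OF that] uk[OF that] val_inj[OF uk(1)[OF that] chars_zero] by auto
    then have "keys u \<subseteq> {0}" by blast
    from poly_mapping_eq_single[OF this] u(2) show ?thesis by metis
  qed
  have act: "t1 powi fst m * t2 powi snd m = t1 powi fst n * t2 powi snd n"
    if "t1 \<noteq> 0" "t2 \<noteq> 0" "m \<in> keys s" "n \<in> keys s" for t1 t2 :: 'k and m n
  proof -
    obtain c where c: "torus_act (t1, t2) s = single 0 c * s" using scalar \<open>t1 \<noteq> 0\<close> \<open>t2 \<noteq> 0\<close> by blast
    have "lookup (single 0 c * s) k = c * lookup s k" for k
      by (simp flip: mult_map_scale_conv_mult add: map.rep_eq when_def)
    then have "t1 powi fst k * t2 powi snd k = c" if "k \<in> keys s" for k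
      using arg_cong[OF c, of "\<lambda>f. lookup f k"] that
      by (simp add: lookup_torus_act in_keys_iff)
    then show ?thesis using that by simp
  qed
  have "keys s \<noteq> {}" using s(1) by simp
  then obtain m where m: "m \<in> keys s" by blast
  have "n = m" if n: "n \<in> keys s" for n
  proof (rule prod_eqI)
    show "fst n = fst m"
      by (rule power_int_two_inj[where ?'k = 'k]) (use act[of 2 1, OF _ _ n m] in simp)
    show "snd n = snd m"
      by (rule power_int_two_inj[where ?'k = 'k]) (use act[of 1 2, OF _ _ n m] in simp)
  qed
  then have "keys s \<subseteq> {m}" by blast
  show ?thesis
  proof (rule that)
    show "s = single m (lookup s m)"
      by (rule poly_mapping_eq_single) fact
    show "lookup s m \<noteq> 0" "m \<in> chars X" using m s(2) by (auto simp: in_keys_iff)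
  qed
qed

end

section \<open>The Special McKay quiver\<close>

locale special_bundles = cyclic_resolution r a \<omega> X
  for r a and \<omega> :: "'k::field_char_0" and X +
  fixes L :: "nat \<Rightarrow> nat \<Rightarrow> int"
  assumes L_0: "L 0 = (\<lambda>\<rho>. 0)"
    and L_degree: "i \<in> {1..ell X} \<Longrightarrow> j \<in> {1..ell X} \<Longrightarrow> degree_on X (L i) j = of_bool (i = j)"
begin

abbreviation divisors :: "nat \<Rightarrow> nat \<Rightarrow> (nat \<Rightarrow> int) set" where
  "divisors \<equiv> hom_divisors neg_self (ell X)"

lemma degree_second_diff:
  assumes k: "k \<in> {1..ell X}"
  shows "degree_on X D k = second_diff neg_self D k"
proof -
  have "degree_on X D k = (\<Sum>\<rho>\<in>{k - 1, k, k + 1}. D \<rho> * intersection X \<rho> k)"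
    unfolding degree_on_def
    by (rule sum.mono_neutral_right) (use k in \<open>auto simp: intersection_def\<close>)
  also have "\<dots> = second_diff neg_self D k"
    using k by (cases k) (simp_all add: second_diff_def intersection_def)
  finally show ?thesis .
qed

lemma second_diff_L:
  assumes "i \<le> ell X" "k \<in> {1..ell X}"
  shows "second_diff neg_self (L i) k = of_bool (k = i)"
proof (cases "i = 0")
  case True
  then show ?thesis using assms by (simp add: L_0 second_diff_def)
next
  case False
  then show ?thesis using assms L_degree[of i k] by (auto simp flip: degree_second_diff)
qed

text \<open>The divisor of zeroes of the character \<open>m\<close>, regarded as a section of
  Hom(L_i, L_j).\<close>

definition char_div :: "int \<times> int \<Rightarrow> nat \<Rightarrow> nat \<Rightarrow> nat \<Rightarrow> int" where
  "char_div m i j \<rho> = val m \<rho> + (L j \<rho> - L i \<rho>)"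

lemma H0_char_div:
  "c \<noteq> 0 \<Longrightarrow> single m c \<in> H0 X (hom_div (L i) (L j)) \<longleftrightarrow>
    m \<in> chars X \<and> (\<forall>\<rho>\<le>ell X + 1. 0 \<le> char_div m i j \<rho>)"
  by (simp add: H0_single char_div_def)

lemma char_div_divisor:
  assumes ij: "i \<le> ell X" "j \<le> ell X" and c: "c \<noteq> 0" and m: "single m c \<in> H0 X (hom_div (L i) (L j))"
  shows "char_div m i j \<in> divisors i j"
proof -
  have "m \<in> chars X" "\<forall>\<rho>\<le>ell X + 1. 0 \<le> char_div m i j \<rho>" using m H0_char_div[OF c] by auto
  moreover from this have "second_diff neg_self (char_div m i j) k = of_bool (k = j) - of_bool (k = i)"
    if "k \<in> {1..ell X}" for k
    using second_diff_val[OF _ that] second_diff_L[OF ij(1) that] second_diff_L[OF ij(2) that]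
      second_diff_add[of neg_self "val m" "\<lambda>\<rho>. L j \<rho> - L i \<rho>" k]
      second_diff_minus[of neg_self "L j" "L i" k]
    by (simp add: char_div_def[abs_def])
  ultimately show ?thesis unfolding hom_divisors_def by blast
qed

text \<open>After removing the contribution of the bundles, \<open>h\<close> satisfies the
  second-order recursion of a principal divisor, so it is determined by its values on the first two
  rays. \<open>char_exists\<close> provides a character with these values.\<close>

lemma divisor_char:
  assumes ij: "i \<le> ell X" "j \<le> ell X" and h: "h \<in> divisors i j"
  obtains m where "m \<in> chars X" "\<And>\<rho>. \<rho> \<le> ell X + 1 \<Longrightarrow> h \<rho> = char_div m i j \<rho>"
proof -
  define g where "g \<rho> = h \<rho> - (L j \<rho> - L i \<rho>)" for \<rho>
  obtain m where m: "m \<in> chars X" "val m 0 = g 0" "val m 1 = g 1" using char_exists .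
  define f where "f \<rho> = val m \<rho> - g \<rho>" for \<rho>
  have diff: "second_diff neg_self f k = 0" if k: "k \<in> {1..ell X}" for k
    using h k second_diff_val[OF m(1) k] second_diff_L[OF ij(1) k] second_diff_L[OF ij(2) k]
    unfolding f_def[abs_def] g_def second_diff_minus by (simp add: hom_divisors_def)
  have "f \<rho> = 0 \<and> f (\<rho> + 1) = 0" if "\<rho> \<le> ell X" for \<rho>
    using that
  proof (induction \<rho>)
    case 0
    then show ?case using m by (simp add: f_def)
  next
    case (Suc \<rho>)
    then show ?case using diff[of "Suc \<rho>"] by (simp add: second_diff_def)
  qed
  from this[of 0] this have "f \<rho> = 0" if "\<rho> \<le> ell X + 1" for \<rho>
    using that by (cases \<rho>) auto
  then have "h \<rho> = char_div m i j \<rho>" if "\<rho> \<le> ell X + 1" for \<rho>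
    using that by (simp add: f_def g_def char_div_def)
  then show ?thesis using m(1) that by blast
qed

text \<open>The inverse of a monomial section is the opposite monomial, whose divisor is the
  negative; both are effective only if they vanish.\<close>

lemma iso_section_iff:
  fixes c :: 'k
  assumes c: "c \<noteq> 0" and m: "single m c \<in> H0 X (hom_div (L i) (L j))"
  shows "iso_section X (L i) (L j) (single m c) \<longleftrightarrow> (\<forall>\<rho>\<le>ell X + 1. char_div m i j \<rho> = 0)"
proof
  have mc: "m \<in> chars X" and nn: "\<forall>\<rho>\<le>ell X + 1. 0 \<le> char_div m i j \<rho>" using m H0_char_div[OF c] by auto
  have neg: "char_div (- m) j i \<rho> = - char_div m i j \<rho>" if "\<rho> \<le> ell X + 1" for \<rho>
    using val_uminus[OF mc that] by (simp add: char_div_def)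
  have ic: "1 / c \<noteq> 0" using c by simp
  {
    assume "iso_section X (L i) (L j) (single m c)"
    then obtain s' where s': "s' \<in> H0 X (hom_div (L j) (L i))" "single m c * s' = 1"
      by (auto simp: iso_section_def)
    have "s' = single (- m) (1 / c) * (single m c * s')"
      using c by (simp add: mult_single flip: mult.assoc)
    then have "s' = single (- m) (1 / c)" by (simp add: s'(2))
    then have "\<forall>\<rho>\<le>ell X + 1. 0 \<le> char_div (- m) j i \<rho>" using s'(1) H0_char_div[OF ic] by simp
    then show "\<forall>\<rho>\<le>ell X + 1. char_div m i j \<rho> = 0" using nn neg by (fastforce intro: antisym)
  next
    assume *: "\<forall>\<rho>\<le>ell X + 1. char_div m i j \<rho> = 0"
    then have "single (- m) (1 / c) \<in> H0 X (hom_div (L j) (L i))"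
      using H0_char_div[OF ic, where m = "- m" and i = j and j = i] chars_uminus[OF mc] neg by simp
    then show "iso_section X (L i) (L j) (single m c)"
      unfolding iso_section_def using m c by (auto simp: mult_single intro!: bexI)
  }
qed

abbreviation Q where "Q \<equiv> special_mckay_quiver X L :: 'k mckay_arrow quiver"

definition scalar_class :: "'k laurent \<Rightarrow> 'k laurent set" where
  "scalar_class s = {single 0 c * s | c. c \<noteq> 0}"

lemma arrows_Q: "arrows Q = {(i, j, scalar_class s) | i j s.
    i \<le> ell X \<and> j \<le> ell X \<and> irreducible_section X L i j s}"
  by (simp add: special_mckay_quiver_def scalar_class_def)

text \<open>The label is read off an arbitrary element of the scalar class; all of them are nonzero
  multiples of the same monomial and have its divisor.\<close>

lemma label_monomial:
  fixes c :: 'k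
  assumes c: "c \<noteq> 0"
  shows "label Q (i, j, scalar_class (single m c)) \<rho> =
    (if \<rho> \<le> ell X + 1 then nat (char_div m i j \<rho>) else 0)"
proof -
  let ?C = "scalar_class (single m c)"
  have "single 0 1 * single m c \<in> ?C"
    unfolding scalar_class_def by (intro CollectI exI[of _ "1::'k"]) simp
  then have "(SOME s. s \<in> ?C) \<in> ?C" by (rule someI)
  then obtain d where "d \<noteq> 0" "(SOME s. s \<in> ?C) = single 0 d * single m c"
    by (auto simp: scalar_class_def)
  then have "(SOME s. s \<in> ?C) = single m (d * c)" "d * c \<noteq> 0"
    using c by (simp_all add: mult_single)
  then show ?thesis
    by (simp add: special_mckay_quiver_def div_section_def ord_single char_div_def)
qed

lemma arrow_cases:
  assumes "e \<in> arrows Q"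
  obtains i j m c where "e = (i, j, scalar_class (single m c))" "c \<noteq> 0"
    "i \<le> ell X" "j \<le> ell X" "single m c \<in> H0 X (hom_div (L i) (L j))"
proof -
  obtain i j s where e: "e = (i, j, scalar_class s)" "i \<le> ell X" "j \<le> ell X" "irreducible_section X L i j s"
    using assms unfolding arrows_Q by blast
  have inv: "invariant_section X (hom_div (L i) (L j)) s" using e(4) by (simp add: irreducible_section_def)
  then obtain m c where s: "s = single m c" "c \<noteq> 0" "m \<in> chars X" by (rule invariant_section_monomial)
  have "s \<in> H0 X (hom_div (L i) (L j))" using inv by (simp add: invariant_section_def)
  then show ?thesis using that e s by blast
qed

text \<open>Induction on the total multiplicity of \<open>h\<close>. The monomial section with this
  divisor is an arrow if irreducible; otherwise it is a product of two sections that are no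
  isomorphisms. Each of these has a nonzero divisor, so the other one has smaller total
  multiplicity.\<close>

lemma walk_of_divisor:
  assumes "i \<le> ell X" "j \<le> ell X" "h \<in> divisors i j"
  shows "\<exists>as. walk Q i as j \<and> (\<forall>\<rho>\<le>ell X + 1. int (div_path Q (i, as, j) \<rho>) = h \<rho>)"
  using assms
proof (induction "\<Sum>\<rho>\<le>ell X + 1. nat (h \<rho>)" arbitrary: i j h rule: less_induct)
  case less
  note ij = less.prems(1,2) and h = less.prems(3)
  have verts: "verts Q = {0..ell X}" by (simp add: special_mckay_quiver_def)
  have ends: "tail Q (i, j, C) = i" "head Q (i, j, C) = j" for i j C
    by (simp_all add: special_mckay_quiver_def)
  have nn: "0 \<le> h \<rho>" if "\<rho> \<le> ell X + 1" for \<rho> using h that by (simp add: hom_divisors_def)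
  obtain m where m: "m \<in> chars X" "\<And>\<rho>. \<rho> \<le> ell X + 1 \<Longrightarrow> h \<rho> = char_div m i j \<rho>"
    using divisor_char[OF ij h] by blast
  let ?s = "single m (1::'k)"
  have s: "?s \<in> H0 X (hom_div (L i) (L j))" using m nn by (simp add: H0_char_div)
  have inv: "invariant_section X (hom_div (L i) (L j)) ?s" by (rule invariant_section_single) (use s in auto)
  show ?case
  proof (cases "\<forall>\<rho>\<le>ell X + 1. h \<rho> = 0")
    case True
    \<comment> \<open>A section without zeroes has degree zero on every exceptional curve, so
      \<open>i = j\<close> and the trivial path has the required divisor.\<close>
    have "(of_bool (k = j) - of_bool (k = i) :: int) = 0" if "k \<in> {1..ell X}" for k
    proof -
      have "k - 1 \<le> ell X + 1" "k \<le> ell X + 1" "k + 1 \<le> ell X + 1" using that by auto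
      then have "second_diff neg_self h k = 0" using True by (simp add: second_diff_def)
      then show ?thesis using h that by (simp add: hom_divisors_def)
    qed
    from this[of i] this[of j] have "i = j" using ij by (cases "i = 0"; cases "j = 0") (auto split: if_splits)
    then show ?thesis using True ij verts by (intro exI[of _ "[]"]) (auto simp: div_path_def)
  next
    case False
    then have niso: "\<not> iso_section X (L i) (L j) ?s" using iso_section_iff[OF _ s] m by auto
    show ?thesis
    proof (cases "irreducible_section X L i j ?s")
      case True
      let ?e = "(i, j, scalar_class ?s)"
      have "?e \<in> arrows Q" unfolding arrows_Q using True ij by blast
      then have "walk Q i [?e] j" unfolding walk.simps ends verts using ij by simp
      moreover have "int (div_path Q (i, [?e], j) \<rho>) = h \<rho>" if "\<rho> \<le> ell X + 1" for \<rho>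
        using that m nn[OF that] by (simp add: div_path_def label_monomial)
      ultimately show ?thesis by blast
    next
      case False
      then obtain k s1 s2 where k: "k \<le> ell X"
        and s1: "invariant_section X (hom_div (L i) (L k)) s1" "\<not> iso_section X (L i) (L k) s1"
        and s2: "invariant_section X (hom_div (L k) (L j)) s2" "\<not> iso_section X (L k) (L j) s2"
        and s12: "?s = s1 * s2"
        using inv niso unfolding irreducible_section_def by blast
      obtain m1 c1 where m1: "s1 = single m1 c1" "c1 \<noteq> 0" "m1 \<in> chars X"
        using s1(1) by (rule invariant_section_monomial)
      obtain m2 c2 where m2: "s2 = single m2 c2" "c2 \<noteq> 0" "m2 \<in> chars X"
        using s2(1) by (rule invariant_section_monomial)
      have H1: "single m1 c1 \<in> H0 X (hom_div (L i) (L k))"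
        and H2: "single m2 c2 \<in> H0 X (hom_div (L k) (L j))"
        using s1(1) s2(1) m1 m2 by (simp_all add: invariant_section_def)
      have "single m 1 = single (m1 + m2) (c1 * c2)"
        using s12 by (simp add: m1 m2 mult_single)
      then have "keys (single m (1::'k)) = keys (single (m1 + m2) (c1 * c2))"
        by simp
      then have mm: "m = m1 + m2" using m1 m2 by simp
      let ?h1 = "char_div m1 i k" and ?h2 = "char_div m2 k j"
      have d: "?h1 \<in> divisors i k" "?h2 \<in> divisors k j"
        using char_div_divisor[OF ij(1) k m1(2) H1] char_div_divisor[OF k ij(2) m2(2) H2] by auto
      have sum: "h \<rho> = ?h1 \<rho> + ?h2 \<rho>" if "\<rho> \<le> ell X + 1" for \<rho>
        using m(2)[OF that] val_add[OF m1(3) m2(3) that] by (simp add: char_div_def mm)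
      have nn1: "0 \<le> ?h1 \<rho>" "0 \<le> ?h2 \<rho>" if "\<rho> \<le> ell X + 1" for \<rho>
        using d that by (simp_all add: hom_divisors_def)
      obtain \<rho>1 where \<rho>1: "\<rho>1 \<le> ell X + 1" "?h1 \<rho>1 \<noteq> 0"
        using s1(2) iso_section_iff[OF m1(2) H1] m1(1) by auto
      obtain \<rho>2 where \<rho>2: "\<rho>2 \<le> ell X + 1" "?h2 \<rho>2 \<noteq> 0"
        using s2(2) iso_section_iff[OF m2(2) H2] m2(1) by auto
      have "(\<Sum>\<rho>\<le>ell X + 1. nat (?h1 \<rho>)) < (\<Sum>\<rho>\<le>ell X + 1. nat (h \<rho>))"
        by (rule sum_strict_mono_ex1) (use sum nn1 \<rho>2 in \<open>force intro!: bexI[of _ \<rho>2]\<close>)+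
      then obtain as where as: "walk Q i as k" "\<forall>\<rho>\<le>ell X + 1. int (div_path Q (i, as, k) \<rho>) = ?h1 \<rho>"
        using less.hyps[OF _ ij(1) k d(1)] by blast
      have "(\<Sum>\<rho>\<le>ell X + 1. nat (?h2 \<rho>)) < (\<Sum>\<rho>\<le>ell X + 1. nat (h \<rho>))"
        by (rule sum_strict_mono_ex1) (use sum nn1 \<rho>1 in \<open>force intro!: bexI[of _ \<rho>1]\<close>)+
      then obtain bs where bs: "walk Q k bs j" "\<forall>\<rho>\<le>ell X + 1. int (div_path Q (k, bs, j) \<rho>) = ?h2 \<rho>"
        using less.hyps[OF _ k ij(2) d(2)] by blast
      have "walk Q i (as @ bs) j" using as(1) bs(1) by (rule walk_append)
      moreover have "int (div_path Q (i, as @ bs, j) \<rho>) = h \<rho>" if "\<rho> \<le> ell X + 1" for \<rho>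
        unfolding div_path_append[of Q i as bs j i k k j] using as bs sum[OF that] that by simp
      ultimately show ?thesis by blast
    qed
  qed
qed

lemma mckay_quiver: "mckay_quiver Q (ell X) neg_self"
proof
  show "verts Q = {0..ell X}" by (simp add: special_mckay_quiver_def)
  show "2 \<le> - self_int X k" if "k \<in> {1..ell X}" for k using wall_relation(2)[OF that] .
  show "tail Q e \<le> ell X \<and> head Q e \<le> ell X" if "e \<in> arrows Q" for e
    using that by (rule arrow_cases) (simp add: special_mckay_quiver_def)
  show "(\<lambda>\<rho>. int (label Q e \<rho>)) \<in> divisors (tail Q e) (head Q e)" if "e \<in> arrows Q" for e
    using that
  proof (rule arrow_cases)
    fix i j m c
    assume e: "e = (i, j, scalar_class (single m c))" "c \<noteq> 0" "i \<le> ell X" "j \<le> ell X"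
      "single m c \<in> H0 X (hom_div (L i) (L j))"
    have d: "char_div m i j \<in> divisors i j" using e char_div_divisor by blast
    have "int (label Q e \<rho>) = char_div m i j \<rho>" if "\<rho> \<le> ell X + 1" for \<rho>
      using that e d by (simp add: label_monomial hom_divisors_def)
    then have "(\<lambda>\<rho>. int (label Q e \<rho>)) \<in> divisors i j"
      using d by (auto simp: hom_divisors_def second_diff_def)
    then show ?thesis by (simp add: e(1) special_mckay_quiver_def)
  qed
  show "label Q e \<rho> = 0" if "e \<in> arrows Q" "\<rho> > ell X + 1" for e \<rho>
    using that(1) by (rule arrow_cases) (use that(2) in \<open>simp add: label_monomial\<close>)
qed (rule walk_of_divisor)

end

theorem theorem4p17:
  fixes r :: nat and a :: int
    and \<omega> :: "'k::{alg_closed_field, field_char_0}"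
    and X :: toric_surface
    and L :: "nat \<Rightarrow> nat \<Rightarrow> int"
    and Q :: "'k mckay_arrow quiver"
  assumes "r \<ge> 2" and "coprime a (int r)" and "primitive_root r \<omega>"
    and "minimal_resolution (cyclic_diag \<omega> a) X"
    and "L 0 = (\<lambda>\<rho>. 0)"
    and "\<forall>i\<in>{1..ell X}. \<forall>j\<in>{1..ell X}. degree_on X (L i) j = (if i = j then 1 else 0)"
    and "Q = special_mckay_quiver X L"
  shows "isomorphic_over_field
           (moduli_space Q (special_weight (ell X)) ::
              (('k mckay_arrow, 'k) mpoly set, 'k) proj_space)
           (git_quotient Q (special_weight (ell X))
              (ideal_I_Q Q :: ('k mckay_arrow, 'k) mpoly set))"
proof -
  interpret special_bundles r a \<omega> X L
    using assms by unfold_locales auto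
  show ?thesis
    unfolding assms(7) by (rule mckay_quiver.moduli_isomorphic[OF mckay_quiver])
qed

end
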